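(* For $x>0$ let $$V(x)=\sup_{\rho\in\mathcal A_l}E\big[\log X^{(\rho)}_T\big],\qquad X^{(\rho)}_T=x\exp\Big(\int_0^T\rho_s\,dW_s+\int_0^T\big(\rho_s\theta_s-\tfrac12|\rho_s|^2\big)ds\Big),$$ and set $f(t)=\frac12\mathrm{dist}^2(\theta_t,C_t)-\frac12|\theta_t|^2$ for $t\in[0,T]$. Then $$V(x)=\log(x)+E\Big[-\int_0^Tf(s)\,ds\Big],$$ and there exists an optimal trading strategy $\rho^*\in\mathcal A_l$ (i.e. one attaining the supremum) satisfying $\rho^*_t\in\Pi_{C_t}(\theta_t)$.
   Context: Market. $T>0$ is fixed; $(\Omega,\mathcal F,P)$ is a probability space carrying an $m$-dimensional Brownian motion $W=(W_t)_{t\in[0,T]}$; $\mathbb F=(\mathcal F_t)_{t\in[0,T]}$ is the completion of the filtration generated by $W$; $\lambda$ is Lebesgue measure on $[0,T]$. There are a bond with interest rate zero and $d\le m$ stocks with $dS^i_t/S^i_t=b^i_t\,dt+\sigma^i_t\,dW_t$, $i=1,\dots,d$, where $b^i$ ($\mathbb R$-valued) and $\sigma^i$ ($\mathbb R^{1\times m}$-valued) are predictable and uniformly bounded. The $d\times m$ matrix $\sigma_t$ with rows $\sigma^i_t$ has full rank $d$ and $K I_d\ge\sigma\sigma^{tr}\ge\varepsilon I_d$ $P$-a.s. for constants $K>\varepsilon>0$. Put $\theta_t=\sigma_t^{tr}(\sigma_t\sigma_t^{tr})^{-1}b_t$, an $\mathbb R^m$-valued predictable uniformly bounded process. Constraints.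 $\tilde C\subseteq\mathbb R^{1\times d}$ is a nonempty closed (not necessarily convex) set and $C_t(\omega)=\tilde C\sigma_t(\omega)=\{c\,\sigma_t(\omega):c\in\tilde C\}\subseteq\mathbb R^m$, a closed set. Notation. Vectors in $\mathbb R^m$ and $\mathbb R^{1\times m}$ are identified; products such as $\rho_s\theta_s$ are Euclidean inner products, $|\cdot|$ is the Euclidean norm. For closed $C\subseteq\mathbb R^m$ and $a\in\mathbb R^m$: $\mathrm{dist}(a,C)=\min_{b\in C}|a-b|$ and $\Pi_C(a)=\{b\in C:|a-b|=\mathrm{dist}(a,C)\}$. Admissible strategies. $\mathcal A_l$ is the set of $\mathbb R^{1\times m}$-valued predictable processes $\rho$ with $E[\int_0^T|\rho_s|^2ds]<\infty$ and $\rho_t\in C_t$ $\lambda\otimes P$-a.s. (Here $\rho=\tilde\rho\sigma$, where $\tilde\rho^i$ is the fraction of wealth invested in stock $i$.) *)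

theory Defs
  imports "HOL-Probability.Probability"
begin

section \<open>Brownian motion and its filtration\<close>

definition natural_filtration ::
  "'a measure \<Rightarrow> (real \<Rightarrow> 'a \<Rightarrow> real^'m) \<Rightarrow> real \<Rightarrow> 'a measure" where
  "natural_filtration M W t =
     sigma (space M) (\<Union>s\<in>{0..t}. {W s -` B \<inter> space M | B. B \<in> sets borel})"

text \<open>The probability space \<^term>\<open>M\<close> is not assumed to be complete. The filtration is
  augmented by all subsets of null sets, and expectations are therefore taken under
  \<^term>\<open>completion M\<close>, which extends \<^term>\<open>M\<close> and agrees with it if \<^term>\<open>M\<close>
  is already complete.\<close>

definition completed_filtration ::
  "'a measure \<Rightarrow> (real \<Rightarrow> 'a \<Rightarrow> real^'m) \<Rightarrow> real \<Rightarrow> 'a measure" where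
  "completed_filtration M W t =
     sigma (space M) (sets (natural_filtration M W t) \<union> null_sets (completion M))"

definition brownian_motion ::
  "'a measure \<Rightarrow> real \<Rightarrow> (real \<Rightarrow> 'a \<Rightarrow> real^'m) \<Rightarrow> bool" where
  "brownian_motion M T W \<longleftrightarrow>
     prob_space M \<and>
     (\<forall>t\<in>{0..T}. W t \<in> borel_measurable M) \<and>
     (AE \<omega> in M. W 0 \<omega> = 0) \<and>
     (AE \<omega> in M. continuous_on {0..T} (\<lambda>t. W t \<omega>)) \<and>
     (\<forall>s t. 0 \<le> s \<and> s < t \<and> t \<le> T \<longrightarrow>
        prob_space.indep_set M (sets (natural_filtration M W s))
          {(\<lambda>\<omega>. W t \<omega> - W s \<omega>) -` B \<inter> space M | B. B \<in> sets borel} \<and>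
        prob_space.indep_vars M (\<lambda>_. borel) (\<lambda>i \<omega>. (W t \<omega> - W s \<omega>) $ i) UNIV \<and>
        (\<forall>i. distributed M lborel (\<lambda>\<omega>. (W t \<omega> - W s \<omega>) $ i)
               (normal_density 0 (sqrt (t - s)))))"

definition predictable_sigma ::
  "'a measure \<Rightarrow> real \<Rightarrow> (real \<Rightarrow> 'a \<Rightarrow> real^'m) \<Rightarrow> (real \<times> 'a) measure" where
  "predictable_sigma M T W =
     sigma ({0..T} \<times> space M)
       ({{0} \<times> A | A. A \<in> sets (completed_filtration M W 0)} \<union>
        {{s<..t} \<times> A | s t A. 0 \<le> s \<and> s \<le> t \<and> t \<le> T \<and> A \<in> sets (completed_filtration M W s)})"

definition predictable ::
  "'a measure \<Rightarrow> real \<Rightarrow> (real \<Rightarrow> 'a \<Rightarrow> real^'m) \<Rightarrow>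
   (real \<Rightarrow> 'a \<Rightarrow> 'b::topological_space) \<Rightarrow> bool" where
  "predictable M T W X \<longleftrightarrow> (\<lambda>(t, \<omega>). X t \<omega>) \<in> borel_measurable (predictable_sigma M T W)"

definition uniformly_bounded ::
  "'a measure \<Rightarrow> real \<Rightarrow> (real \<Rightarrow> 'a \<Rightarrow> 'b::real_normed_vector) \<Rightarrow> bool" where
  "uniformly_bounded M T X \<longleftrightarrow> (\<exists>B. \<forall>t\<in>{0..T}. \<forall>\<omega>\<in>space M. norm (X t \<omega>) \<le> B)"

section \<open>The Ito integral over the whole time interval\<close>

definition elementary_data ::
  "'a measure \<Rightarrow> real \<Rightarrow> (real \<Rightarrow> 'a \<Rightarrow> real^'m) \<Rightarrow>
   nat \<Rightarrow> (nat \<Rightarrow> real) \<Rightarrow> (nat \<Rightarrow> 'a \<Rightarrow> real^'m) \<Rightarrow> bool" where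
  "elementary_data M T W n \<tau> h \<longleftrightarrow>
     0 \<le> \<tau> 0 \<and> (\<forall>k<n. \<tau> k \<le> \<tau> (Suc k)) \<and> \<tau> n \<le> T \<and>
     (\<forall>k<n. h k \<in> borel_measurable (completed_filtration M W (\<tau> k)) \<and>
            (\<exists>B. \<forall>\<omega>\<in>space M. norm (h k \<omega>) \<le> B))"

definition elementary_process ::
  "nat \<Rightarrow> (nat \<Rightarrow> real) \<Rightarrow> (nat \<Rightarrow> 'a \<Rightarrow> real^'m) \<Rightarrow> real \<Rightarrow> 'a \<Rightarrow> real^'m" where
  "elementary_process n \<tau> h t \<omega> = (\<Sum>k<n. indicator {\<tau> k<..\<tau> (Suc k)} t *\<^sub>R h k \<omega>)"

definition elementary_integral ::
  "(real \<Rightarrow> 'a \<Rightarrow> real^'m) \<Rightarrow>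
   nat \<Rightarrow> (nat \<Rightarrow> real) \<Rightarrow> (nat \<Rightarrow> 'a \<Rightarrow> real^'m) \<Rightarrow> 'a \<Rightarrow> real" where
  "elementary_integral W n \<tau> h \<omega> = (\<Sum>k<n. h k \<omega> \<bullet> (W (\<tau> (Suc k)) \<omega> - W (\<tau> k) \<omega>))"

definition has_ito_integral ::
  "'a measure \<Rightarrow> real \<Rightarrow> (real \<Rightarrow> 'a \<Rightarrow> real^'m) \<Rightarrow>
   (real \<Rightarrow> 'a \<Rightarrow> real^'m) \<Rightarrow> ('a \<Rightarrow> real) \<Rightarrow> bool" where
  "has_ito_integral M T W \<rho> I \<longleftrightarrow>
     I \<in> borel_measurable (completion M) \<and>
     (\<exists>n \<tau> h.
        (\<forall>j. elementary_data M T W (n j) (\<tau> j) (h j)) \<and>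
        (\<lambda>j. \<integral>\<^sup>+\<omega>. (\<integral>\<^sup>+s\<in>{0..T}.
               ennreal ((norm (elementary_process (n j) (\<tau> j) (h j) s \<omega> - \<rho> s \<omega>))\<^sup>2) \<partial>lborel)
             \<partial>completion M) \<longlonglongrightarrow> 0 \<and>
        (\<lambda>j. \<integral>\<^sup>+\<omega>.
               ennreal ((elementary_integral W (n j) (\<tau> j) (h j) \<omega> - I \<omega>)\<^sup>2)
             \<partial>completion M) \<longlonglongrightarrow> 0)"

text \<open>For predictable square-integrable integrands the integral exists and is unique only up to
  almost sure equality; the choice picks one version.\<close>

definition ito_integral ::
  "'a measure \<Rightarrow> real \<Rightarrow> (real \<Rightarrow> 'a \<Rightarrow> real^'m) \<Rightarrow>
   (real \<Rightarrow> 'a \<Rightarrow> real^'m) \<Rightarrow> 'a \<Rightarrow> real" where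
  "ito_integral M T W \<rho> = (SOME I. has_ito_integral M T W \<rho> I)"

section \<open>The market\<close>

text \<open>The Loewner order; it is only used for symmetric matrices.\<close>

definition loewner_le :: "real^'d^'d \<Rightarrow> real^'d^'d \<Rightarrow> bool" where
  "loewner_le A B \<longleftrightarrow> (\<forall>v. 0 \<le> v \<bullet> ((B - A) *v v))"

definition market_price_of_risk ::
  "(real \<Rightarrow> 'a \<Rightarrow> real^'d) \<Rightarrow> (real \<Rightarrow> 'a \<Rightarrow> real^'m^'d) \<Rightarrow> real \<Rightarrow> 'a \<Rightarrow> real^'m" where
  "market_price_of_risk b \<sigma> t \<omega> =
     transpose (\<sigma> t \<omega>) *v (matrix_inv (\<sigma> t \<omega> ** transpose (\<sigma> t \<omega>)) *v b t \<omega>)"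

definition constraint_set ::
  "(real^'d) set \<Rightarrow> (real \<Rightarrow> 'a \<Rightarrow> real^'m^'d) \<Rightarrow> real \<Rightarrow> 'a \<Rightarrow> (real^'m) set" where
  "constraint_set C \<sigma> t \<omega> = {c v* \<sigma> t \<omega> | c. c \<in> C}"

definition proj_set :: "'b::metric_space set \<Rightarrow> 'b \<Rightarrow> 'b set" where
  "proj_set C a = {b \<in> C. dist a b = infdist a C}"

definition admissible ::
  "'a measure \<Rightarrow> real \<Rightarrow> (real \<Rightarrow> 'a \<Rightarrow> real^'m) \<Rightarrow> (real \<Rightarrow> 'a \<Rightarrow> real^'m^'d) \<Rightarrow>
   (real^'d) set \<Rightarrow> (real \<Rightarrow> 'a \<Rightarrow> real^'m) set" where
  "admissible M T W \<sigma> C =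
     {\<rho>. predictable M T W \<rho> \<and>
         (\<integral>\<^sup>+\<omega>. (\<integral>\<^sup>+s\<in>{0..T}. ennreal ((norm (\<rho> s \<omega>))\<^sup>2) \<partial>lborel) \<partial>completion M) < \<infinity> \<and>
         (AE (t, \<omega>) in restrict_space lborel {0..T} \<Otimes>\<^sub>M completion M.
            \<rho> t \<omega> \<in> constraint_set C \<sigma> t \<omega>)}"

definition terminal_wealth ::
  "'a measure \<Rightarrow> real \<Rightarrow> (real \<Rightarrow> 'a \<Rightarrow> real^'m) \<Rightarrow>
   (real \<Rightarrow> 'a \<Rightarrow> real^'d) \<Rightarrow> (real \<Rightarrow> 'a \<Rightarrow> real^'m^'d) \<Rightarrow>
   real \<Rightarrow> (real \<Rightarrow> 'a \<Rightarrow> real^'m) \<Rightarrow> 'a \<Rightarrow> real" where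
  "terminal_wealth M T W b \<sigma> x \<rho> \<omega> =
     x * exp (ito_integral M T W \<rho> \<omega> +
              (LINT s:{0..T}|lborel.
                 \<rho> s \<omega> \<bullet> market_price_of_risk b \<sigma> s \<omega> - 1/2 * (norm (\<rho> s \<omega>))\<^sup>2))"

definition expected_log_utility ::
  "'a measure \<Rightarrow> real \<Rightarrow> (real \<Rightarrow> 'a \<Rightarrow> real^'m) \<Rightarrow>
   (real \<Rightarrow> 'a \<Rightarrow> real^'d) \<Rightarrow> (real \<Rightarrow> 'a \<Rightarrow> real^'m^'d) \<Rightarrow>
   real \<Rightarrow> (real \<Rightarrow> 'a \<Rightarrow> real^'m) \<Rightarrow> real" where
  "expected_log_utility M T W b \<sigma> x \<rho> =
     (LINT \<omega>|completion M. ln (terminal_wealth M T W b \<sigma> x \<rho> \<omega>))"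

text \<open>The supremum is taken in the extended reals, so that its finiteness is part of any
  equation with a real number.\<close>

definition value_function ::
  "'a measure \<Rightarrow> real \<Rightarrow> (real \<Rightarrow> 'a \<Rightarrow> real^'m) \<Rightarrow>
   (real \<Rightarrow> 'a \<Rightarrow> real^'d) \<Rightarrow> (real \<Rightarrow> 'a \<Rightarrow> real^'m^'d) \<Rightarrow>
   (real^'d) set \<Rightarrow> real \<Rightarrow> ereal" where
  "value_function M T W b \<sigma> C x =
     (SUP \<rho>\<in>admissible M T W \<sigma> C. ereal (expected_log_utility M T W b \<sigma> x \<rho>))"

definition driver ::
  "(real \<Rightarrow> 'a \<Rightarrow> real^'d) \<Rightarrow> (real \<Rightarrow> 'a \<Rightarrow> real^'m^'d) \<Rightarrow>
   (real^'d) set \<Rightarrow> real \<Rightarrow> 'a \<Rightarrow> real" where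
  "driver b \<sigma> C t \<omega> =
     1/2 * (infdist (market_price_of_risk b \<sigma> t \<omega>) (constraint_set C \<sigma> t \<omega>))\<^sup>2
     - 1/2 * (norm (market_price_of_risk b \<sigma> t \<omega>))\<^sup>2"

end

(* The expected logarithm splits into log x, the mean of an Ito integral, which vanishes for every
   square-integrable predictable integrand, and the mean of the time integral of
     rho.theta - |rho|^2/2 = |theta|^2/2 - |rho - theta|^2/2.
   The last expression is maximised pointwise by a point of the constraint set nearest to theta, so
   the theorem reduces to choosing such a point predictably.

   Existence of the Ito integral: step processes on uniform grids are dense in the predictable
   square-integrable processes (pi-lambda theorem on the generating rectangles), and by bilinearity
   the isometry for step processes only needs products of two increments, over overlapping
   intervals split at their endpoints.

   Selection: the nonempty closed sets C sigma - theta meet a given closed set on a predictable set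
   of (t, omega).  This property survives minimising a continuous function with compact sublevel
   sets, so minimising first the norm and then all coordinates in turn leaves a single predictable
   point. *)

theory Submission
  imports Defs
begin

section \<open>Brownian increments and the completed filtration\<close>

text \<open>Two mismatches between hypotheses and goal shape the proof. Independence of increments
  is given for the natural filtration, but predictability refers to the filtration with all null
  sets added; hence each event of the larger one is replaced by an almost surely equal event of the
  smaller. And the bounds on \<sigma> hold, for each fixed time, only almost surely, whereas a
  predictable selection must be made at every point: a singular \<open>\<sigma> t \<omega>\<close>
  may map the closed set \<open>C\<close> to a set that is not closed, so a harmless singleton is
  substituted wherever the Gram matrix of \<sigma> is singular. That set is predictable and
  negligible at each time, which is why one strategy is a projection for every t almost surely, not
  only for almost every t. \<open>C\<close> may be unbounded and may omit 0; square integrability of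
  the selection comes from comparing it with one fixed point of \<open>C\<close>. Since Bochner
  integrals of non-integrable functions are 0 by convention, every competitor needs an integrability
  proof before expectations may be split.\<close>

lemma borel_measurable_vec_nth [measurable (raw)]:
  fixes f :: "'a \<Rightarrow> ('b::real_normed_vector)^'n"
  assumes "f \<in> borel_measurable M"
  shows "(\<lambda>x. f x $ i) \<in> borel_measurable M"
  using measurable_compose[OF assms borel_measurable_continuous_onI[of "\<lambda>x. x $ i"]]
  by (simp add: linear_continuous_on bounded_linear_vec_nth)

locale brownian =
  fixes M :: "'a measure" and T :: real and W :: "real \<Rightarrow> 'a \<Rightarrow> real^'m"
  assumes T_pos: "0 < T" and bm: "brownian_motion M T W"
begin

abbreviation P :: "'a measure" where "P \<equiv> completion M"
abbreviation F :: "real \<Rightarrow> 'a measure" where "F \<equiv> completed_filtration M W"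

sublocale M: prob_space M
  using bm by (simp add: brownian_motion_def)

sublocale P: prob_space "completion M"
  by (rule M.prob_space_completion)

lemma W_measurable [measurable (raw)]: "0 \<le> t \<Longrightarrow> t \<le> T \<Longrightarrow> W t \<in> borel_measurable M"
  using bm by (auto simp: brownian_motion_def)

lemma W_measurable_completion: "0 \<le> t \<Longrightarrow> t \<le> T \<Longrightarrow> W t \<in> borel_measurable P"
  by (intro measurable_completion W_measurable)

lemma space_natural_filtration [simp]: "space (natural_filtration M W t) = space M"
  unfolding natural_filtration_def by (rule space_measure_of) auto

lemma space_F [simp]: "space (F t) = space M"
  unfolding completed_filtration_def
  by (rule space_measure_of)
     (use sets.sets_into_space[of _ "natural_filtration M W t"]
          sets.sets_into_space[of _ "completion M"] in \<open>auto dest: null_setsD2\<close>)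

lemma sets_natural_filtration:
  "sets (natural_filtration M W t) =
     sigma_sets (space M) (\<Union>s\<in>{0..t}. {W s -` B \<inter> space M | B. B \<in> sets borel})"
  unfolding natural_filtration_def by (rule sets_measure_of) auto

lemma sets_F:
  "sets (F t) =
     sigma_sets (space M) (sets (natural_filtration M W t) \<union> null_sets (completion M))"
  unfolding completed_filtration_def
  by (rule sets_measure_of)
     (use sets.sets_into_space[of _ "natural_filtration M W t"]
          sets.sets_into_space[of _ "completion M"] in \<open>auto dest: null_setsD2\<close>)

lemma sets_natural_filtration_subset:
  assumes "t \<le> T" shows "sets (natural_filtration M W t) \<subseteq> sets M"
  unfolding sets_natural_filtration
  using assms by (intro sets.sigma_sets_subset) (auto intro!: measurable_sets W_measurable)

lemma sets_F_subset:
  assumes "t \<le> T" shows "sets (F t) \<subseteq> sets P"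
proof -
  have "sigma_sets (space P) (sets (natural_filtration M W t) \<union> null_sets P) \<subseteq> sets P"
    using sets_natural_filtration_subset[OF assms] by (intro sets.sigma_sets_subset) auto
  then show ?thesis unfolding sets_F by simp
qed

lemma sets_natural_filtration_mono:
  assumes "s \<le> t"
  shows "sets (natural_filtration M W s) \<subseteq> sets (natural_filtration M W t)"
  unfolding sets_natural_filtration using assms by (intro sigma_sets_mono') fastforce

lemma sets_F_mono: "s \<le> t \<Longrightarrow> sets (F s) \<subseteq> sets (F t)"
  unfolding sets_F using sets_natural_filtration_mono[of s t] by (intro sigma_sets_mono') auto

lemma measurable_F_mono:
  "s \<le> t \<Longrightarrow> f \<in> measurable (F s) R \<Longrightarrow> f \<in> measurable (F t) R"
  using sets_F_mono[of s t] by (auto simp: measurable_def)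

lemma measurable_F_imp_P: "s \<le> T \<Longrightarrow> f \<in> measurable (F s) R \<Longrightarrow> f \<in> measurable P R"
  using sets_F_subset[of s] by (auto simp: measurable_def)

lemma W_measurable_F:
  assumes "0 \<le> s" "s \<le> t" shows "W s \<in> borel_measurable (F t)"
proof (rule measurableI)
  fix B :: "(real^'m) set" assume "B \<in> sets borel"
  then have "W s -` B \<inter> space M \<in> sets (natural_filtration M W t)"
    unfolding sets_natural_filtration using assms by (intro sigma_sets.Basic UN_I[of s]) auto
  then show "W s -` B \<inter> space (F t) \<in> sets (F t)"
    by (auto simp: sets_F intro: sigma_sets.Basic)
qed auto

text \<open>The events that agree almost surely with an event of the natural filtration include
  every null set and are closed under complements and countable unions, because only countably many
  exceptional null sets are combined; so they exhaust \<open>F s\<close>. This is how independence,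
  assumed for the natural filtration, reaches \<open>F s\<close>.\<close>

lemma F_AE_eq_natural:
  assumes "A \<in> sets (F s)"
  shows "\<exists>A'\<in>sets (natural_filtration M W s). AE \<omega> in P. \<omega> \<in> A \<longleftrightarrow> \<omega> \<in> A'"
  using assms unfolding sets_F
proof (induction rule: sigma_sets.induct)
  case (Basic a)
  then show ?case
  proof
    assume "a \<in> null_sets P"
    then show ?thesis
      using AE_not_in by (intro bexI[of _ "{}"]) auto
  qed auto
next
  case (Compl a)
  then obtain A' where "A' \<in> sets (natural_filtration M W s)" "AE \<omega> in P. \<omega> \<in> a \<longleftrightarrow> \<omega> \<in> A'"
    by auto
  then show ?case
    using sets.compl_sets[of A' "natural_filtration M W s"]
    by (intro bexI[of _ "space M - A'"]) auto
next
  case (Union a)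
  then obtain A' where A': "\<And>i. A' i \<in> sets (natural_filtration M W s)"
    "\<And>i. AE \<omega> in P. \<omega> \<in> a i \<longleftrightarrow> \<omega> \<in> A' i" by metis
  have "AE \<omega> in P. \<forall>i::nat. \<omega> \<in> a i \<longleftrightarrow> \<omega> \<in> A' i"
    unfolding AE_all_countable using A'(2) by blast
  then show ?case
    using A'(1) by (intro bexI[of _ "\<Union>i. A' i"]) auto
qed auto

text \<open>Replacing \<open>A\<close> by an almost surely equal event of the natural filtration
  changes neither the probability of \<open>A\<close> nor that of \<open>A \<inter> D\<close>; all
  other events involved lie in \<open>M\<close>, where the completion has the same
  probabilities.\<close>

lemma increment_indep_set:
  assumes "0 \<le> s" "s < t" "t \<le> T"
  shows "P.indep_set (sets (F s)) {(\<lambda>\<omega>. W t \<omega> - W s \<omega>) -` B \<inter> space M | B. B \<in> sets borel}"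
proof (rule P.indep_setI)
  show "sets (F s) \<subseteq> P.events" using assms by (intro sets_F_subset) auto
  have X: "(\<lambda>\<omega>. W t \<omega> - W s \<omega>) \<in> borel_measurable M"
    using assms W_measurable by (intro borel_measurable_diff) auto
  show sub: "{(\<lambda>\<omega>. W t \<omega> - W s \<omega>) -` B \<inter> space M | B. B \<in> sets borel} \<subseteq> P.events"
    using measurable_sets[OF X] by auto
  fix A D assume A: "A \<in> sets (F s)"
    and D: "D \<in> {(\<lambda>\<omega>. W t \<omega> - W s \<omega>) -` B \<inter> space M | B. B \<in> sets borel}"
  obtain A' where A': "A' \<in> sets (natural_filtration M W s)" "AE \<omega> in P. \<omega> \<in> A \<longleftrightarrow> \<omega> \<in> A'"
    using F_AE_eq_natural[OF A] by blast
  have mM: "A' \<in> sets M" "D \<in> sets M"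
    using sets_natural_filtration_subset[of s] assms A' D measurable_sets[OF X] by auto
  have mP: "A \<in> sets P" using sets_F_subset[of s] assms A by auto
  have "M.indep_set (sets (natural_filtration M W s))
          {(\<lambda>\<omega>. W t \<omega> - W s \<omega>) -` B \<inter> space M | B. B \<in> sets borel}"
    using bm assms by (auto simp: brownian_motion_def)
  from M.indep_setD[OF this A'(1) D]
  have "P.prob (A' \<inter> D) = P.prob A' * P.prob D"
    using mM by simp
  moreover have "P.prob (A \<inter> D) = P.prob (A' \<inter> D)"
    using A'(2) mM mP by (intro P.finite_measure_eq_AE) auto
  moreover have "P.prob A = P.prob A'"
    using A'(2) mM mP by (intro P.finite_measure_eq_AE) auto
  ultimately show "P.prob (A \<inter> D) = P.prob A * P.prob D" by simp
qed

text \<open>Every event described by \<phi> of the increment is an event described by the increment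
  itself, so independence of the two generating families is inherited; both are closed under
  intersection, which extends it to the sigma-algebras they generate.\<close>

lemma increment_indep_var:
  fixes Z :: "'a \<Rightarrow> real" and \<phi> :: "real^'m \<Rightarrow> real"
  assumes "0 \<le> s" "s < t" "t \<le> T"
    and Z: "Z \<in> borel_measurable (F s)" and \<phi>: "\<phi> \<in> borel_measurable borel"
  shows "P.indep_var borel Z borel (\<lambda>\<omega>. \<phi> (W t \<omega> - W s \<omega>))"
  unfolding P.indep_var_eq
proof (intro conjI)
  have X: "(\<lambda>\<omega>. W t \<omega> - W s \<omega>) \<in> borel_measurable P"
    using assms W_measurable_completion by (intro borel_measurable_diff) auto
  show "P.random_variable borel Z" using Z assms(2,3) by (intro measurable_F_imp_P[of s]) auto
  show "P.random_variable borel (\<lambda>\<omega>. \<phi> (W t \<omega> - W s \<omega>))"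
    using measurable_compose[OF X \<phi>] .
  have 1: "{Z -` A \<inter> space P |A. A \<in> sets borel} \<subseteq> sets (F s)"
    using measurable_sets[OF Z] by auto
  have 2: "{(\<lambda>\<omega>. \<phi> (W t \<omega> - W s \<omega>)) -` A \<inter> space P |A. A \<in> sets borel} \<subseteq>
     {(\<lambda>\<omega>. W t \<omega> - W s \<omega>) -` B \<inter> space M | B. B \<in> sets borel}"
  proof safe
    fix A :: "real set" assume "A \<in> sets borel"
    then have "\<phi> -` A \<in> sets borel" using measurable_sets[OF \<phi>, of A] by simp
    then show "\<exists>B. (\<lambda>\<omega>. \<phi> (W t \<omega> - W s \<omega>)) -` A \<inter> space P =
        (\<lambda>\<omega>. W t \<omega> - W s \<omega>) -` B \<inter> space M \<and> B \<in> sets borel"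
      by (intro exI[of _ "\<phi> -` A"]) auto
  qed
  have "P.indep_set {Z -` A \<inter> space P |A. A \<in> sets borel}
     {(\<lambda>\<omega>. \<phi> (W t \<omega> - W s \<omega>)) -` A \<inter> space P |A. A \<in> sets borel}"
    using increment_indep_set[OF assms(1-3)] 1 2 unfolding P.indep_set_def
    by (elim P.indep_sets_mono_sets) (auto split: bool.split)
  then show "P.indep_set (sigma_sets (space P) {Z -` A \<inter> space P |A. A \<in> sets borel})
     (sigma_sets (space P) {(\<lambda>\<omega>. \<phi> (W t \<omega> - W s \<omega>)) -` A \<inter> space P |A. A \<in> sets borel})"
  proof (rule P.indep_set_sigma_sets)
    have "Int_stable {f -` A \<inter> space P |A. A \<in> sets borel}" for f :: "'a \<Rightarrow> real"
    proof (rule Int_stableI, safe)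
      fix A B :: "real set" assume "A \<in> sets borel" "B \<in> sets borel"
      then show "\<exists>D. f -` A \<inter> space P \<inter> (f -` B \<inter> space P) = f -` D \<inter> space P \<and> D \<in> sets borel"
        by (intro exI[of _ "A \<inter> B"]) auto
    qed
    then show "Int_stable {Z -` A \<inter> space P |A. A \<in> sets borel}"
      "Int_stable {(\<lambda>\<omega>. \<phi> (W t \<omega> - W s \<omega>)) -` A \<inter> space P |A. A \<in> sets borel}" by auto
  qed
qed

section \<open>First and second moments of the increments\<close>

lemma increment_distribution:
  assumes "0 \<le> s" "s < t" "t \<le> T"
  shows "M.indep_vars (\<lambda>_. borel) (\<lambda>i \<omega>. (W t \<omega> - W s \<omega>) $ i) UNIV"
    and "distributed M lborel (\<lambda>\<omega>. (W t \<omega> - W s \<omega>) $ i) (normal_density 0 (sqrt (t - s)))"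
proof -
  have "\<forall>s t. 0 \<le> s \<and> s < t \<and> t \<le> T \<longrightarrow>
      M.indep_set (sets (natural_filtration M W s))
        {(\<lambda>\<omega>. W t \<omega> - W s \<omega>) -` B \<inter> space M | B. B \<in> sets borel} \<and>
      M.indep_vars (\<lambda>_. borel) (\<lambda>i \<omega>. (W t \<omega> - W s \<omega>) $ i) UNIV \<and>
      (\<forall>i. distributed M lborel (\<lambda>\<omega>. (W t \<omega> - W s \<omega>) $ i) (normal_density 0 (sqrt (t - s))))"
    using bm unfolding brownian_motion_def by (elim conjE)
  note * = this[rule_format, OF conjI[OF assms(1) conjI[OF assms(2,3)]]]
  show "M.indep_vars (\<lambda>_. borel) (\<lambda>i \<omega>. (W t \<omega> - W s \<omega>) $ i) UNIV"
    using * by (elim conjE)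
  show "distributed M lborel (\<lambda>\<omega>. (W t \<omega> - W s \<omega>) $ i) (normal_density 0 (sqrt (t - s)))"
    using * by (elim conjE allE)
qed

text \<open>Mixed products vanish because distinct coordinates are independent and centred, while
  the square of one coordinate has the normal variance; the strict inequality s < t keeps that
  variance positive.\<close>

lemma increment_moments_base:
  assumes st: "0 \<le> s" "s < t" "t \<le> T"
    and X: "\<And>i. X i = (\<lambda>\<omega>. (W t \<omega> - W s \<omega>) $ i)"
  shows "integrable M (X i)" and "integrable M (\<lambda>\<omega>. X i \<omega> * X j \<omega>)"
    and "integral\<^sup>L M (X i) = 0"
    and "integral\<^sup>L M (\<lambda>\<omega>. X i \<omega> * X j \<omega>) = (if i = j then t - s else 0)"
proof -
  have pos: "0 < sqrt (t - s)" using st by simp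
  have D: "distributed M lborel (X i) (normal_density 0 (sqrt (t - s)))" for i
    unfolding X by (rule increment_distribution(2)[OF st])
  have "integrable lborel (\<lambda>x. normal_density 0 (sqrt (t - s)) x * x)"
    using integrable_normal_moment[OF pos, of 0 1] by (simp del: integrable_mult_right)
  then have I: "integrable M (X i)" for i
    using distributed_integrable[OF D[of i], of "\<lambda>x. x"] by simp
  then show "integrable M (X i)" .
  have E: "integral\<^sup>L M (X i) = 0" for i
    using M.normal_distributed_expectation[OF pos D[of i]] .
  then show "integral\<^sup>L M (X i) = 0" .
  have "integrable lborel (\<lambda>x. normal_density 0 (sqrt (t - s)) x * x\<^sup>2)"
    using integrable_normal_moment[OF pos, of 0 2] by simp
  then have I2: "integrable M (\<lambda>\<omega>. X i \<omega> * X i \<omega>)" for i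
    using distributed_integrable[OF D[of i], of "\<lambda>x. x\<^sup>2"] by (simp add: power2_eq_square)
  have E2: "integral\<^sup>L M (\<lambda>\<omega>. X i \<omega> * X i \<omega>) = t - s" for i
    using M.normal_distributed_variance[OF pos D, of i] E[of i] st
    by (simp add: power2_eq_square)
  have ind: "M.indep_var borel (X i) borel (X j)" if "i \<noteq> j"
  proof -
    have iv: "M.indep_vars (\<lambda>_. borel) X UNIV"
      using increment_distribution(1)[OF st] unfolding X[abs_def, symmetric] .
    \<comment> \<open>Restricting the independent family to the disjoint index sets {i} and {j} and
      reading off the single component of each yields the independence of one pair.\<close>
    have "M.indep_var (Pi\<^sub>M {i} (\<lambda>_. borel)) (\<lambda>\<omega>. restrict (\<lambda>k. X k \<omega>) {i})
        (Pi\<^sub>M {j} (\<lambda>_. borel)) (\<lambda>\<omega>. restrict (\<lambda>k. X k \<omega>) {j})"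
      by (rule M.indep_var_restrict[OF iv]) (use that in auto)
    from M.indep_var_compose[OF this measurable_component_singleton measurable_component_singleton, of i j]
    show ?thesis by (simp add: comp_def)
  qed
  show "integrable M (\<lambda>\<omega>. X i \<omega> * X j \<omega>)"
  proof (cases "i = j")
    case False
    show ?thesis by (rule M.indep_var_integrable[OF ind[OF False] I I])
  qed (use I2 in simp)
  show "integral\<^sup>L M (\<lambda>\<omega>. X i \<omega> * X j \<omega>) = (if i = j then t - s else 0)"
  proof (cases "i = j")
    case False
    then show ?thesis using M.indep_var_lebesgue_integral[OF ind[OF False] I I] E by simp
  qed (use E2 in simp)
qed

text \<open>Adds the degenerate case s = t, where the increment is 0: partitions of step processes
  may repeat a point. Since increments are measurable for \<open>M\<close>, their integrals under
  the completion are those under \<open>M\<close>.\<close>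

lemma increment_moments:
  assumes st: "0 \<le> s" "s \<le> t" "t \<le> T"
  shows "integrable P (\<lambda>\<omega>. (W t \<omega> - W s \<omega>) $ i)"
    and "integrable P (\<lambda>\<omega>. (W t \<omega> - W s \<omega>) $ i * (W t \<omega> - W s \<omega>) $ j)"
    and "(\<integral>\<omega>. (W t \<omega> - W s \<omega>) $ i \<partial>P) = 0"
    and "(\<integral>\<omega>. (W t \<omega> - W s \<omega>) $ i * (W t \<omega> - W s \<omega>) $ j \<partial>P) = (if i = j then t - s else 0)"
proof -
  have "(\<lambda>\<omega>. W t \<omega> - W s \<omega>) \<in> borel_measurable M"
    using assms W_measurable by (intro borel_measurable_diff) auto
  then have X: "(\<lambda>\<omega>. (W t \<omega> - W s \<omega>) $ i) \<in> borel_measurable M" for i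
    by (rule borel_measurable_vec_nth)
  note X2 = borel_measurable_times[OF X[of i] X[of j]]
  have "integrable P (\<lambda>\<omega>. (W t \<omega> - W s \<omega>) $ i) \<and>
    integrable P (\<lambda>\<omega>. (W t \<omega> - W s \<omega>) $ i * (W t \<omega> - W s \<omega>) $ j) \<and>
    (\<integral>\<omega>. (W t \<omega> - W s \<omega>) $ i \<partial>P) = 0 \<and>
    (\<integral>\<omega>. (W t \<omega> - W s \<omega>) $ i * (W t \<omega> - W s \<omega>) $ j \<partial>P) = (if i = j then t - s else 0)"
  proof (cases "s < t")
    case True
    show ?thesis
      unfolding integrable_completion[OF X] integral_completion[OF X]
        integrable_completion[OF X2] integral_completion[OF X2]
      using increment_moments_base[OF st(1) True st(3), of "\<lambda>i \<omega>. (W t \<omega> - W s \<omega>) $ i"] by simp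
  qed (use st in simp)
  then show "integrable P (\<lambda>\<omega>. (W t \<omega> - W s \<omega>) $ i)"
    and "integrable P (\<lambda>\<omega>. (W t \<omega> - W s \<omega>) $ i * (W t \<omega> - W s \<omega>) $ j)"
    and "(\<integral>\<omega>. (W t \<omega> - W s \<omega>) $ i \<partial>P) = 0"
    and "(\<integral>\<omega>. (W t \<omega> - W s \<omega>) $ i * (W t \<omega> - W s \<omega>) $ j \<partial>P) = (if i = j then t - s else 0)"
    by blast+
qed

text \<open>Expectation of a product of independent factors, the form in which independence of
  increments is used from here on. For s = t the second factor is the constant
  \<open>\<phi> 0\<close>, which covers the case not treated by the definition of Brownian
  motion.\<close>

lemma indep_increment_integral:
  fixes Z :: "'a \<Rightarrow> real" and \<phi> :: "real^'m \<Rightarrow> real"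
  assumes st: "0 \<le> s" "s \<le> t" "t \<le> T" and Z: "Z \<in> borel_measurable (F s)" "integrable P Z"
    and \<phi>: "\<phi> \<in> borel_measurable borel" "integrable P (\<lambda>\<omega>. \<phi> (W t \<omega> - W s \<omega>))"
  shows "integrable P (\<lambda>\<omega>. Z \<omega> * \<phi> (W t \<omega> - W s \<omega>))"
    and "(\<integral>\<omega>. Z \<omega> * \<phi> (W t \<omega> - W s \<omega>) \<partial>P) = (\<integral>\<omega>. Z \<omega> \<partial>P) * (\<integral>\<omega>. \<phi> (W t \<omega> - W s \<omega>) \<partial>P)"
proof -
  have "integrable P (\<lambda>\<omega>. Z \<omega> * \<phi> (W t \<omega> - W s \<omega>)) \<and>
    (\<integral>\<omega>. Z \<omega> * \<phi> (W t \<omega> - W s \<omega>) \<partial>P) = (\<integral>\<omega>. Z \<omega> \<partial>P) * (\<integral>\<omega>. \<phi> (W t \<omega> - W s \<omega>) \<partial>P)"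
  proof (cases "s < t")
    case False
    then show ?thesis using st Z P.prob_space by simp
  next
    case True
    from increment_indep_var[OF st(1) True st(3) Z(1) \<phi>(1)] show ?thesis
      using P.indep_var_integrable P.indep_var_lebesgue_integral Z \<phi> by blast
  qed
  then show "integrable P (\<lambda>\<omega>. Z \<omega> * \<phi> (W t \<omega> - W s \<omega>))"
    and "(\<integral>\<omega>. Z \<omega> * \<phi> (W t \<omega> - W s \<omega>) \<partial>P) = (\<integral>\<omega>. Z \<omega> \<partial>P) * (\<integral>\<omega>. \<phi> (W t \<omega> - W s \<omega>) \<partial>P)"
    by auto
qed

end

section \<open>The isometry for step processes\<close>

context brownian
begin

abbreviation L :: "real measure" where "L \<equiv> restrict_space lborel {0..T}"
abbreviation N :: "(real \<times> 'a) measure" where "N \<equiv> L \<Otimes>\<^sub>M P"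

sublocale L: finite_measure L
  by (rule finite_measureI) (use T_pos in \<open>simp add: emeasure_restrict_space space_restrict_space\<close>)

sublocale N: pair_sigma_finite L P ..

sublocale N: finite_measure N
proof (rule finite_measureI)
  have "emeasure N (space N) = emeasure L (space L) * emeasure P (space P)"
    unfolding space_pair_measure by (rule P.emeasure_pair_measure_Times) (rule sets.top)+
  then show "emeasure N (space N) \<noteq> \<infinity>"
    using P.emeasure_space_1 T_pos by (simp add: emeasure_restrict_space space_restrict_space)
qed

lemma space_N: "space N = {0..T} \<times> space M"
  by (simp add: space_pair_measure space_restrict_space)

text \<open>The requirement that \<open>elementary_data\<close> puts on one coefficient, isolated so
  that integrals over single intervals can be treated without a partition.\<close>

definition adapted_bounded :: "real \<Rightarrow> ('a \<Rightarrow> real^'m) \<Rightarrow> bool" where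
  "adapted_bounded s h \<longleftrightarrow>
     h \<in> borel_measurable (F s) \<and> (\<exists>B. \<forall>\<omega>\<in>space M. norm (h \<omega>) \<le> B)"

lemma adapted_bounded_mono: "s \<le> s' \<Longrightarrow> adapted_bounded s h \<Longrightarrow> adapted_bounded s' h"
  unfolding adapted_bounded_def using measurable_F_mono by blast

lemma integrable_bounded_mult:
  fixes h Z :: "'a \<Rightarrow> real"
  assumes "h \<in> borel_measurable P" "\<And>\<omega>. \<omega> \<in> space M \<Longrightarrow> \<bar>h \<omega>\<bar> \<le> B" "integrable P Z"
  shows "integrable P (\<lambda>\<omega>. h \<omega> * Z \<omega>)"
proof (rule Bochner_Integration.integrable_bound)
  show "integrable P (\<lambda>\<omega>. B * \<bar>Z \<omega>\<bar>)" using assms(3) by simp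
  show "(\<lambda>\<omega>. h \<omega> * Z \<omega>) \<in> borel_measurable P"
    using assms by (intro borel_measurable_times) auto
  show "AE \<omega> in P. norm (h \<omega> * Z \<omega>) \<le> norm (B * \<bar>Z \<omega>\<bar>)"
  proof (rule AE_I2)
    fix \<omega> assume "\<omega> \<in> space P"
    then have "\<bar>h \<omega>\<bar> \<le> B" using assms(2) by simp
    then have "\<bar>h \<omega>\<bar> * \<bar>Z \<omega>\<bar> \<le> B * \<bar>Z \<omega>\<bar>" "0 \<le> B" by (auto intro: mult_right_mono)
    then show "norm (h \<omega> * Z \<omega>) \<le> norm (B * \<bar>Z \<omega>\<bar>)" by (simp add: abs_mult)
  qed
qed

lemma adapted_bounded_nth:
  assumes "adapted_bounded s h"
  obtains B where "\<And>i. (\<lambda>\<omega>. h \<omega> $ i) \<in> borel_measurable (F s)"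
    "\<And>i \<omega>. \<omega> \<in> space M \<Longrightarrow> \<bar>h \<omega> $ i\<bar> \<le> B"
proof -
  from assms obtain B where h: "h \<in> borel_measurable (F s)" "\<And>\<omega>. \<omega> \<in> space M \<Longrightarrow> norm (h \<omega>) \<le> B"
    unfolding adapted_bounded_def by blast
  have "\<bar>h \<omega> $ i\<bar> \<le> B" if "\<omega> \<in> space M" for i \<omega>
    using h(2)[OF that] component_le_norm_cart[of "h \<omega>" i] by linarith
  with that[of B] borel_measurable_vec_nth[OF h(1)] show ?thesis by blast
qed

section \<open>Products of integrals over single intervals\<close>

definition increment_integral :: "real \<Rightarrow> real \<Rightarrow> ('a \<Rightarrow> real^'m) \<Rightarrow> 'a \<Rightarrow> real" where
  "increment_integral s t h \<omega> = h \<omega> \<bullet> (W t \<omega> - W s \<omega>)"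

lemma increment_integral_split:
  "increment_integral s t h \<omega> = increment_integral s u h \<omega> + increment_integral u t h \<omega>"
  by (simp add: increment_integral_def inner_diff_right)

lemma increment_integral_measurable:
  assumes "0 \<le> s" "s \<le> t" "adapted_bounded s h"
  shows "increment_integral s t h \<in> borel_measurable (F t)"
proof -
  have "h \<in> borel_measurable (F t)"
    using assms measurable_F_mono unfolding adapted_bounded_def by blast
  then show ?thesis
    unfolding increment_integral_def[abs_def]
    using W_measurable_F[of s t] W_measurable_F[of t t] assms
    by (intro borel_measurable_inner borel_measurable_diff) auto
qed

text \<open>Martingale property: coordinatewise, \<open>Z\<close> times \<open>h\<close> is known at
  time s, and the increment is centred and independent of it. \<open>Z\<close> is merely integrable,
  because it will be the integral over an earlier interval, which is in general unbounded.\<close>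

lemma increment_integral_orthogonal:
  assumes st: "0 \<le> s" "s \<le> t" "t \<le> T" and h: "adapted_bounded s h"
    and Z: "Z \<in> borel_measurable (F s)" "integrable P Z"
  shows "integrable P (\<lambda>\<omega>. Z \<omega> * increment_integral s t h \<omega>)"
    and "(\<integral>\<omega>. Z \<omega> * increment_integral s t h \<omega> \<partial>P) = 0"
proof -
  obtain B where B: "\<And>i. (\<lambda>\<omega>. h \<omega> $ i) \<in> borel_measurable (F s)"
    "\<And>i \<omega>. \<omega> \<in> space M \<Longrightarrow> \<bar>h \<omega> $ i\<bar> \<le> B"
    using adapted_bounded_nth[OF h] by blast
  have 1: "(\<lambda>\<omega>. h \<omega> $ i * Z \<omega>) \<in> borel_measurable (F s)" for i
    by (intro borel_measurable_times B Z)
  have 2: "integrable P (\<lambda>\<omega>. h \<omega> $ i * Z \<omega>)" for i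
    by (rule integrable_bounded_mult[OF measurable_F_imp_P[OF _ B(1)] B(2) Z(2)]) (use st in auto)
  have nth: "(\<lambda>x::real^'m. x $ i) \<in> borel_measurable borel" for i
    by (rule borel_measurable_vec_nth) simp
  note * = indep_increment_integral[OF st 1 2 nth increment_moments(1)[OF st]]
  have eq: "Z \<omega> * increment_integral s t h \<omega> = (\<Sum>i\<in>UNIV. h \<omega> $ i * Z \<omega> * (W t \<omega> - W s \<omega>) $ i)" for \<omega>
    by (simp add: increment_integral_def inner_vec_def sum_distrib_left mult_ac del: vector_minus_component)
  show "integrable P (\<lambda>\<omega>. Z \<omega> * increment_integral s t h \<omega>)"
    unfolding eq by (intro Bochner_Integration.integrable_sum *(1))
  show "(\<integral>\<omega>. Z \<omega> * increment_integral s t h \<omega> \<partial>P) = 0"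
    unfolding eq
    by (subst Bochner_Integration.integral_sum[OF *(1)])
       (simp_all only: *(2) increment_moments(3)[OF st] mult_zero_right sum.neutral_const)
qed

lemma increment_integral_mean_zero:
  assumes "0 \<le> s" "s \<le> t" "t \<le> T" "adapted_bounded s h"
  shows "integrable P (increment_integral s t h)"
    and "(\<integral>\<omega>. increment_integral s t h \<omega> \<partial>P) = 0"
  using increment_integral_orthogonal[OF assms borel_measurable_const, of 1] by simp_all

text \<open>Expanding both inner products gives a double sum over coordinates; the covariance matrix
  of the increment is (t - s) times the identity, so only the diagonal survives and reassembles to
  \<open>h \<omega> \<bullet> g \<omega>\<close>.\<close>

lemma increment_integral_mult_same:
  assumes st: "0 \<le> s" "s \<le> t" "t \<le> T" and h: "adapted_bounded s h" and g: "adapted_bounded s g"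
  shows "integrable P (\<lambda>\<omega>. increment_integral s t h \<omega> * increment_integral s t g \<omega>)"
    and "(\<integral>\<omega>. increment_integral s t h \<omega> * increment_integral s t g \<omega> \<partial>P) =
      (t - s) * (\<integral>\<omega>. h \<omega> \<bullet> g \<omega> \<partial>P)"
proof -
  obtain B where B: "\<And>i. (\<lambda>\<omega>. h \<omega> $ i) \<in> borel_measurable (F s)"
    "\<And>i \<omega>. \<omega> \<in> space M \<Longrightarrow> \<bar>h \<omega> $ i\<bar> \<le> B"
    using adapted_bounded_nth[OF h] by blast
  obtain D where D: "\<And>i. (\<lambda>\<omega>. g \<omega> $ i) \<in> borel_measurable (F s)"
    "\<And>i \<omega>. \<omega> \<in> space M \<Longrightarrow> \<bar>g \<omega> $ i\<bar> \<le> D"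
    using adapted_bounded_nth[OF g] by blast
  have 1: "(\<lambda>\<omega>. h \<omega> $ i * g \<omega> $ j) \<in> borel_measurable (F s)" for i j
    by (intro borel_measurable_times B D)
  have 2: "integrable P (\<lambda>\<omega>. h \<omega> $ i * g \<omega> $ j)" for i j
  proof (rule integrable_bounded_mult[OF measurable_F_imp_P[OF _ B(1)] B(2)])
    show "integrable P (\<lambda>\<omega>. g \<omega> $ j)"
      by (rule P.integrable_const_bound[of _ D])
         (use D measurable_F_imp_P[OF _ D(1)] st in auto)
  qed (use st in auto)
  have nth: "(\<lambda>x::real^'m. x $ i * x $ j) \<in> borel_measurable borel" for i j
    by (intro borel_measurable_times borel_measurable_vec_nth) simp_all
  note * = indep_increment_integral[OF st 1 2 nth increment_moments(2)[OF st]]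
  have eq: "increment_integral s t h \<omega> * increment_integral s t g \<omega> =
      (\<Sum>i\<in>UNIV. \<Sum>j\<in>UNIV. h \<omega> $ i * g \<omega> $ j * ((W t \<omega> - W s \<omega>) $ i * (W t \<omega> - W s \<omega>) $ j))" for \<omega>
    unfolding increment_integral_def inner_vec_def inner_real_def sum_product
    by (simp only: mult_ac)
  show "integrable P (\<lambda>\<omega>. increment_integral s t h \<omega> * increment_integral s t g \<omega>)"
    unfolding eq by (intro Bochner_Integration.integrable_sum *(1))
  have "(\<integral>\<omega>. increment_integral s t h \<omega> * increment_integral s t g \<omega> \<partial>P) =
    (\<Sum>i\<in>UNIV. \<Sum>j\<in>UNIV. (\<integral>\<omega>. h \<omega> $ i * g \<omega> $ j \<partial>P) * (if i = j then t - s else 0))"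
    unfolding eq by (subst Bochner_Integration.integral_sum, intro Bochner_Integration.integrable_sum *(1),
        subst Bochner_Integration.integral_sum, rule *(1), simp only: *(2) increment_moments(4)[OF st])
  also have "\<dots> = (t - s) * (\<Sum>i\<in>UNIV. \<integral>\<omega>. h \<omega> $ i * g \<omega> $ i \<partial>P)"
    by (simp add: sum_distrib_left if_distrib sum.delta mult_ac cong: if_cong)
  also have "(\<Sum>i\<in>UNIV. \<integral>\<omega>. h \<omega> $ i * g \<omega> $ i \<partial>P) = (\<integral>\<omega>. h \<omega> \<bullet> g \<omega> \<partial>P)"
    unfolding inner_vec_def inner_real_def
    by (rule Bochner_Integration.integral_sum[OF 2, symmetric])
  finally show "(\<integral>\<omega>. increment_integral s t h \<omega> * increment_integral s t g \<omega> \<partial>P) =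
      (t - s) * (\<integral>\<omega>. h \<omega> \<bullet> g \<omega> \<partial>P)" .
qed

text \<open>The longer interval is cut where the shorter one ends; the remainder carries a later
  increment and is orthogonal to the other factor. Symmetry of the claim handles either order of t
  and t'.\<close>

lemma increment_integral_mult_same_start:
  assumes st: "0 \<le> s" "s \<le> t" "t \<le> T" "s \<le> t'" "t' \<le> T"
    and h: "adapted_bounded s h" and g: "adapted_bounded s g"
  shows "integrable P (\<lambda>\<omega>. increment_integral s t h \<omega> * increment_integral s t' g \<omega>) \<and>
    (\<integral>\<omega>. increment_integral s t h \<omega> * increment_integral s t' g \<omega> \<partial>P) =
      (min t t' - s) * (\<integral>\<omega>. h \<omega> \<bullet> g \<omega> \<partial>P)"
proof -
  have *: "integrable P (\<lambda>\<omega>. increment_integral s t h \<omega> * increment_integral s t' g \<omega>) \<and>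
    (\<integral>\<omega>. increment_integral s t h \<omega> * increment_integral s t' g \<omega> \<partial>P) =
      (min t t' - s) * (\<integral>\<omega>. h \<omega> \<bullet> g \<omega> \<partial>P)"
    if "s \<le> t" "t \<le> t'" "t' \<le> T" and h: "adapted_bounded s h" and g: "adapted_bounded s g" for t t' h g
  proof -
    have "integrable P (\<lambda>\<omega>. increment_integral s t h \<omega> * increment_integral t t' g \<omega>)"
      "(\<integral>\<omega>. increment_integral s t h \<omega> * increment_integral t t' g \<omega> \<partial>P) = 0"
      using increment_integral_orthogonal[of t t' g "increment_integral s t h"]
        increment_integral_mean_zero(1)[of s t h] increment_integral_measurable[of s t h]
        adapted_bounded_mono[of s t g] that st by auto
    then show ?thesis
      using increment_integral_mult_same[OF st(1) that(1) _ h g] that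
      by (simp add: increment_integral_split[of s t' g _ t] distrib_left min_def)
  qed
  show ?thesis
  proof (cases "t \<le> t'")
    case True
    then show ?thesis using * st h g by blast
  next
    case False
    then show ?thesis using *[of t' t g h] st h g
      by (simp add: min.commute mult.commute inner_commute)
  qed
qed

text \<open>The factor in front is the length of the intersection of the two intervals, with
  \<open>max 0\<close> for disjoint ones. The interval that begins earlier is cut at the later
  starting point: the part before it is known by then and orthogonal, and the rest has a common
  start.\<close>

lemma increment_integral_mult:
  assumes st: "0 \<le> s" "s \<le> t" "t \<le> T" "0 \<le> s'" "s' \<le> t'" "t' \<le> T"
    and h: "adapted_bounded s h" and g: "adapted_bounded s' g"
  shows "integrable P (\<lambda>\<omega>. increment_integral s t h \<omega> * increment_integral s' t' g \<omega>) \<and>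
    (\<integral>\<omega>. increment_integral s t h \<omega> * increment_integral s' t' g \<omega> \<partial>P) =
      max 0 (min t t' - max s s') * (\<integral>\<omega>. h \<omega> \<bullet> g \<omega> \<partial>P)"
proof -
  have *: "integrable P (\<lambda>\<omega>. increment_integral s t h \<omega> * increment_integral s' t' g \<omega>) \<and>
    (\<integral>\<omega>. increment_integral s t h \<omega> * increment_integral s' t' g \<omega> \<partial>P) =
      max 0 (min t t' - max s s') * (\<integral>\<omega>. h \<omega> \<bullet> g \<omega> \<partial>P)"
    if "0 \<le> s" "s \<le> s'" and st: "s \<le> t" "t \<le> T" "s' \<le> t'" "t' \<le> T"
      and h: "adapted_bounded s h" and g: "adapted_bounded s' g" for s s' t t' h g
  proof (cases "t \<le> s'")
    case True
    have "increment_integral s t h \<in> borel_measurable (F s')"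
      using measurable_F_mono[OF True] increment_integral_measurable that by blast
    then show ?thesis
      using increment_integral_orthogonal[of s' t' g "increment_integral s t h"]
        increment_integral_mean_zero(1)[of s t h] that True by simp
  next
    case False
    have "integrable P (\<lambda>\<omega>. increment_integral s s' h \<omega> * increment_integral s' t' g \<omega>)"
      "(\<integral>\<omega>. increment_integral s s' h \<omega> * increment_integral s' t' g \<omega> \<partial>P) = 0"
      using increment_integral_orthogonal[of s' t' g "increment_integral s s' h"]
        increment_integral_mean_zero(1)[of s s' h] increment_integral_measurable[of s s' h]
        that False by auto
    moreover have "adapted_bounded s' h" using that adapted_bounded_mono by blast
    ultimately show ?thesis
      using increment_integral_mult_same_start[of s' t t' h g] that False
      by (simp add: increment_integral_split[of s t h _ s'] distrib_right max_def)
  qed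
  show ?thesis
  proof (cases "s \<le> s'")
    case True
    then show ?thesis using * st h g by blast
  next
    case False
    then show ?thesis using *[of s' s t' t g h] st h g
      by (simp add: min.commute max.commute mult.commute inner_commute)
  qed
qed

section \<open>Step integrals on arbitrary partitions\<close>

lemma elementary_data_adapted:
  assumes "elementary_data M T W n \<tau> h"
  shows "\<And>k. k \<le> n \<Longrightarrow> 0 \<le> \<tau> k" "\<And>k. k \<le> n \<Longrightarrow> \<tau> k \<le> T"
    "\<And>k. k < n \<Longrightarrow> \<tau> k \<le> \<tau> (Suc k)" "\<And>k. k < n \<Longrightarrow> adapted_bounded (\<tau> k) (h k)"
proof -
  have A: "0 \<le> \<tau> 0" "\<tau> n \<le> T" and *: "\<And>k. k < n \<Longrightarrow> \<tau> k \<le> \<tau> (Suc k)"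
    using assms by (auto simp: elementary_data_def)
  then show "\<And>k. k < n \<Longrightarrow> \<tau> k \<le> \<tau> (Suc k)" by blast
  show "\<And>k. k < n \<Longrightarrow> adapted_bounded (\<tau> k) (h k)"
    using assms by (auto simp: elementary_data_def adapted_bounded_def)
  show "0 \<le> \<tau> k" if "k \<le> n" for k
    using that
  proof (induction k)
    case (Suc k)
    then show ?case using *[of k] by linarith
  qed (use A in simp)
  show "\<tau> k \<le> T" if "k \<le> n" for k
    using that
  proof (induction rule: inc_induct)
    case (step k)
    then show ?case using *[of k] by linarith
  qed (use A in simp)
qed

lemma elementary_integral_eq:
  "elementary_integral W n \<tau> h \<omega> = (\<Sum>k<n. increment_integral (\<tau> k) (\<tau> (Suc k)) (h k) \<omega>)"
  by (simp add: elementary_integral_def increment_integral_def)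

lemma elementary_integral_mean_zero:
  assumes "elementary_data M T W n \<tau> h"
  shows "integrable P (elementary_integral W n \<tau> h)"
    and "(\<integral>\<omega>. elementary_integral W n \<tau> h \<omega> \<partial>P) = 0"
proof -
  note ed = elementary_data_adapted[OF assms]
  have *: "integrable P (increment_integral (\<tau> k) (\<tau> (Suc k)) (h k))"
    "(\<integral>\<omega>. increment_integral (\<tau> k) (\<tau> (Suc k)) (h k) \<omega> \<partial>P) = 0" if "k < n" for k
    using increment_integral_mean_zero[of "\<tau> k" "\<tau> (Suc k)" "h k"] ed[of k] ed(2)[of "Suc k"] that by auto
  show "integrable P (elementary_integral W n \<tau> h)"
    unfolding elementary_integral_eq[abs_def] by (intro Bochner_Integration.integrable_sum *) auto
  show "(\<integral>\<omega>. elementary_integral W n \<tau> h \<omega> \<partial>P) = 0"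
    unfolding elementary_integral_eq
    by (subst Bochner_Integration.integral_sum) (use * in auto)
qed

lemma elementary_process_measurable:
  assumes "elementary_data M T W n \<tau> h"
  shows "case_prod (elementary_process n \<tau> h) \<in> borel_measurable N"
proof -
  note ed = elementary_data_adapted[OF assms]
  have "h k \<in> borel_measurable P" if "k < n" for k
  proof (rule measurable_F_imp_P)
    show "\<tau> k \<le> T" using ed(2)[of k] that by simp
    show "h k \<in> borel_measurable (F (\<tau> k))" using ed(4)[OF that] by (simp add: adapted_bounded_def)
  qed
  then have "(\<lambda>x. h k (snd x)) \<in> borel_measurable N" if "k < n" for k
    using that by (intro measurable_compose[OF measurable_snd]) auto
  moreover have "(\<lambda>x. indicator {\<tau> k<..\<tau> (Suc k)} (fst x) :: real) \<in> borel_measurable N" for k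
    by (intro measurable_compose[OF measurable_fst] measurable_restrict_space1) simp
  ultimately have "(\<lambda>x. \<Sum>k<n. indicator {\<tau> k<..\<tau> (Suc k)} (fst x) *\<^sub>R h k (snd x)) \<in> borel_measurable N"
    by (intro borel_measurable_sum borel_measurable_scaleR) auto
  then show ?thesis
    by (simp add: elementary_process_def[abs_def] case_prod_unfold)
qed

text \<open>The form \<open>max 0 (t - s)\<close> allows an empty interval, which arises when
  intervals of two step processes do not overlap.\<close>

lemma rectangle_integral:
  assumes c: "c \<in> borel_measurable P" "\<And>\<omega>. \<omega> \<in> space M \<Longrightarrow> \<bar>c \<omega>\<bar> \<le> B"
    and st: "0 \<le> s" "t \<le> T"
  shows "integrable N (\<lambda>(u, \<omega>). indicator {s<..t} u * c \<omega>) \<and>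
    (\<integral>x. (case x of (u, \<omega>) \<Rightarrow> indicator {s<..t} u * c \<omega>) \<partial>N) = max 0 (t - s) * (\<integral>\<omega>. c \<omega> \<partial>P)"
proof
  have [measurable]: "c \<in> borel_measurable P" by fact
  have [measurable]: "(\<lambda>u. indicator {s<..t} u :: real) \<in> borel_measurable L"
    by (intro measurable_restrict_space1) simp
  show int: "integrable N (\<lambda>(u, \<omega>). indicator {s<..t} u * c \<omega>)"
  proof (rule N.integrable_const_bound[of _ "\<bar>B\<bar>"])
    show "AE x in N. norm (case x of (u, \<omega>) \<Rightarrow> indicator {s<..t} u * c \<omega>) \<le> \<bar>B\<bar>"
    proof (rule AE_I2)
      fix x assume "x \<in> space N"
      then have "\<bar>c (snd x)\<bar> \<le> B" using c(2)[of "snd x"] by (auto simp: space_N)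
      then show "norm (case x of (u, \<omega>) \<Rightarrow> indicator {s<..t} u * c \<omega>) \<le> \<bar>B\<bar>"
        by (auto simp: case_prod_unfold indicator_def)
    qed
  qed measurable
  have "(\<integral>x. (case x of (u, \<omega>) \<Rightarrow> indicator {s<..t} u * c \<omega>) \<partial>N) =
      (\<integral>u. \<integral>\<omega>. indicator {s<..t} u * c \<omega> \<partial>P \<partial>L)"
    using N.integral_fst'[OF int] by simp
  also have "\<dots> = (\<integral>u. indicator {s<..t} u \<partial>L) * (\<integral>\<omega>. c \<omega> \<partial>P)" by simp
  also have "(\<integral>u. indicator {s<..t} u \<partial>L) = measure L {s<..t}"
  proof -
    have "{s<..t} \<inter> space L = {s<..t}" using st by (auto simp: space_restrict_space)
    then show ?thesis by simp
  qed
  also have "measure L {s<..t} = measure lborel {s<..t}"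
    using st by (intro measure_restrict_space) auto
  also have "measure lborel {s<..t} = max 0 (t - s)"
    by (cases "s \<le> t") auto
  finally show "(\<integral>x. (case x of (u, \<omega>) \<Rightarrow> indicator {s<..t} u * c \<omega>) \<partial>N) = max 0 (t - s) * (\<integral>\<omega>. c \<omega> \<partial>P)" .
qed

text \<open>Both sides are double sums over pairs of partition intervals, and the terms agree pair
  by pair: each equals the length \<open>a k l\<close> of the overlap times the expectation of
  \<open>h k \<omega> \<bullet> g l \<omega>\<close>. Two different partitions are thus handled
  without passing to a common refinement.\<close>

lemma elementary_isometry_inner:
  assumes h: "elementary_data M T W n \<tau> h" and g: "elementary_data M T W n' \<tau>' g"
  shows "integrable P (\<lambda>\<omega>. elementary_integral W n \<tau> h \<omega> * elementary_integral W n' \<tau>' g \<omega>)"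
    and "integrable N (\<lambda>(u, \<omega>). elementary_process n \<tau> h u \<omega> \<bullet> elementary_process n' \<tau>' g u \<omega>)"
    and "(\<integral>\<omega>. elementary_integral W n \<tau> h \<omega> * elementary_integral W n' \<tau>' g \<omega> \<partial>P) =
      (\<integral>x. (case x of (u, \<omega>) \<Rightarrow> elementary_process n \<tau> h u \<omega> \<bullet> elementary_process n' \<tau>' g u \<omega>) \<partial>N)"
proof -
  note hd = elementary_data_adapted[OF h]
  note gd = elementary_data_adapted[OF g]
  define a where "a k l = max 0 (min (\<tau> (Suc k)) (\<tau>' (Suc l)) - max (\<tau> k) (\<tau>' l))" for k l
  define J where "J k l \<omega> = increment_integral (\<tau> k) (\<tau> (Suc k)) (h k) \<omega> * increment_integral (\<tau>' l) (\<tau>' (Suc l)) (g l) \<omega>" for k l \<omega>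
  define R where "R k l = (\<lambda>(u, \<omega>). indicator {max (\<tau> k) (\<tau>' l)<..min (\<tau> (Suc k)) (\<tau>' (Suc l))} u * (h k \<omega> \<bullet> g l \<omega>))" for k l
  have J: "integrable P (J k l) \<and> integral\<^sup>L P (J k l) = a k l * (\<integral>\<omega>. h k \<omega> \<bullet> g l \<omega> \<partial>P)" if "k < n" "l < n'" for k l
    unfolding J_def[abs_def] a_def
    by (rule increment_integral_mult) (use that hd(1)[of k] hd(2)[of "Suc k"] hd(3,4)[of k]
          gd(1)[of l] gd(2)[of "Suc l"] gd(3,4)[of l] in auto)
  have R: "integrable N (R k l) \<and> integral\<^sup>L N (R k l) = a k l * (\<integral>\<omega>. h k \<omega> \<bullet> g l \<omega> \<partial>P)" if kl: "k < n" "l < n'" for k l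
  proof -
    obtain B where B: "h k \<in> borel_measurable (F (\<tau> k))" "\<And>\<omega>. \<omega> \<in> space M \<Longrightarrow> norm (h k \<omega>) \<le> B"
      using hd(4)[OF kl(1)] unfolding adapted_bounded_def by blast
    obtain D where D: "g l \<in> borel_measurable (F (\<tau>' l))" "\<And>\<omega>. \<omega> \<in> space M \<Longrightarrow> norm (g l \<omega>) \<le> D"
      using gd(4)[OF kl(2)] unfolding adapted_bounded_def by blast
    have bd: "\<bar>h k \<omega> \<bullet> g l \<omega>\<bar> \<le> B * D" if "\<omega> \<in> space M" for \<omega>
      using Cauchy_Schwarz_ineq2[of "h k \<omega>" "g l \<omega>"] B(2)[OF that] D(2)[OF that]
        mult_mono'[of "norm (h k \<omega>)" B "norm (g l \<omega>)" D] by simp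
    show ?thesis
      unfolding R_def a_def
    proof (rule rectangle_integral[OF _ bd])
      show "(\<lambda>\<omega>. h k \<omega> \<bullet> g l \<omega>) \<in> borel_measurable P"
        using measurable_F_imp_P[OF hd(2) B(1)] measurable_F_imp_P[OF gd(2) D(1)] kl
        by (intro borel_measurable_inner) auto
    qed (use kl hd(1)[of k] hd(2)[of "Suc k"] in auto)
  qed
  have eqJ: "(\<lambda>\<omega>. elementary_integral W n \<tau> h \<omega> * elementary_integral W n' \<tau>' g \<omega>) =
      (\<lambda>\<omega>. \<Sum>k<n. \<Sum>l<n'. J k l \<omega>)"
    by (simp add: elementary_integral_eq J_def sum_product)
  have eqR: "(\<lambda>(u, \<omega>). elementary_process n \<tau> h u \<omega> \<bullet> elementary_process n' \<tau>' g u \<omega>) =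
      (\<lambda>x. \<Sum>k<n. \<Sum>l<n'. R k l x)"
  proof -
    have ind: "indicator {max s s'<..min t t'} u = (indicator {s<..t} u * indicator {s'<..t'} u :: real)"
      for s s' t t' u :: real by (auto simp: indicator_def)
    have "elementary_process n \<tau> h u \<omega> \<bullet> elementary_process n' \<tau>' g u \<omega> =
        (\<Sum>k<n. \<Sum>l<n'. R k l (u, \<omega>))" for u \<omega>
      unfolding elementary_process_def R_def prod.case ind inner_sum_left
      by (rule sum.cong[OF refl]) (simp only: inner_sum_right inner_scaleR_left inner_scaleR_right mult_ac)
    then show ?thesis by auto
  qed
  show "integrable P (\<lambda>\<omega>. elementary_integral W n \<tau> h \<omega> * elementary_integral W n' \<tau>' g \<omega>)"
    unfolding eqJ using J by (intro Bochner_Integration.integrable_sum) auto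
  show "integrable N (\<lambda>(u, \<omega>). elementary_process n \<tau> h u \<omega> \<bullet> elementary_process n' \<tau>' g u \<omega>)"
    unfolding eqR using R by (intro Bochner_Integration.integrable_sum) auto
  have "integral\<^sup>L P (\<lambda>\<omega>. \<Sum>k<n. \<Sum>l<n'. J k l \<omega>) = (\<Sum>k<n. \<Sum>l<n'. integral\<^sup>L P (J k l))"
    using J by (subst Bochner_Integration.integral_sum, intro Bochner_Integration.integrable_sum, simp)
      (intro sum.cong Bochner_Integration.integral_sum refl, simp)
  also have "\<dots> = (\<Sum>k<n. \<Sum>l<n'. integral\<^sup>L N (R k l))"
    using J R by (intro sum.cong) auto
  also have "\<dots> = integral\<^sup>L N (\<lambda>x. \<Sum>k<n. \<Sum>l<n'. R k l x)"
    using R by (subst Bochner_Integration.integral_sum, intro Bochner_Integration.integrable_sum, simp)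
      (intro sum.cong Bochner_Integration.integral_sum[symmetric] refl, simp)
  finally show "(\<integral>\<omega>. elementary_integral W n \<tau> h \<omega> * elementary_integral W n' \<tau>' g \<omega> \<partial>P) =
      (\<integral>x. (case x of (u, \<omega>) \<Rightarrow> elementary_process n \<tau> h u \<omega> \<bullet> elementary_process n' \<tau>' g u \<omega>) \<partial>N)"
    unfolding eqJ eqR .
qed

text \<open>Expanding the two squares leaves only inner products, to which the bilinear isometry
  applies. The statement concerns a difference because members of an approximating sequence live on
  different grids.\<close>

lemma elementary_isometry:
  assumes h: "elementary_data M T W n \<tau> h" and g: "elementary_data M T W n' \<tau>' g"
  shows "(\<integral>\<^sup>+\<omega>. ennreal ((elementary_integral W n \<tau> h \<omega> - elementary_integral W n' \<tau>' g \<omega>)\<^sup>2) \<partial>P) =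
    (\<integral>\<^sup>+x. (case x of (u, \<omega>) \<Rightarrow>
       ennreal ((norm (elementary_process n \<tau> h u \<omega> - elementary_process n' \<tau>' g u \<omega>))\<^sup>2)) \<partial>N)"
proof -
  note hh = elementary_isometry_inner[OF h h]
  note hg = elementary_isometry_inner[OF h g]
  note gg = elementary_isometry_inner[OF g g]
  define I where "I = elementary_integral W n \<tau> h"
  define J where "J = elementary_integral W n' \<tau>' g"
  define p where "p = (\<lambda>x. elementary_process n \<tau> h (fst x) (snd x))"
  define q where "q = (\<lambda>x. elementary_process n' \<tau>' g (fst x) (snd x))"
  note defs = I_def[symmetric] J_def[symmetric] p_def[symmetric] q_def[symmetric]
  have intI: "integrable P (\<lambda>\<omega>. I \<omega> * I \<omega>)" "integrable P (\<lambda>\<omega>. I \<omega> * J \<omega>)" "integrable P (\<lambda>\<omega>. J \<omega> * J \<omega>)"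
    using hh hg gg by (simp_all add: I_def J_def)
  have intp: "integrable N (\<lambda>x. p x \<bullet> p x)" "integrable N (\<lambda>x. p x \<bullet> q x)" "integrable N (\<lambda>x. q x \<bullet> q x)"
    using hh(2) hg(2) gg(2) by (simp_all add: p_def q_def case_prod_unfold)
  have eq: "(\<integral>\<omega>. I \<omega> * I \<omega> \<partial>P) = (\<integral>x. p x \<bullet> p x \<partial>N)" "(\<integral>\<omega>. I \<omega> * J \<omega> \<partial>P) = (\<integral>x. p x \<bullet> q x \<partial>N)"
    "(\<integral>\<omega>. J \<omega> * J \<omega> \<partial>P) = (\<integral>x. q x \<bullet> q x \<partial>N)"
    using hh(3) hg(3) gg(3) by (simp_all add: p_def q_def I_def J_def case_prod_unfold)
  have 1: "(I \<omega> - J \<omega>)\<^sup>2 = I \<omega> * I \<omega> - 2 * (I \<omega> * J \<omega>) + J \<omega> * J \<omega>" for \<omega>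
    by (simp add: power2_eq_square algebra_simps)
  have 2: "(norm (p x - q x))\<^sup>2 = p x \<bullet> p x - 2 * (p x \<bullet> q x) + q x \<bullet> q x" for x
    by (simp add: power2_norm_eq_inner inner_diff_left inner_diff_right inner_commute)
  have i1: "integrable P (\<lambda>\<omega>. (I \<omega> - J \<omega>)\<^sup>2)" unfolding 1 using intI by simp
  have i2: "integrable N (\<lambda>x. (norm (p x - q x))\<^sup>2)" unfolding 2 using intp by simp
  have "(\<integral>\<omega>. (I \<omega> - J \<omega>)\<^sup>2 \<partial>P) = (\<integral>x. (norm (p x - q x))\<^sup>2 \<partial>N)"
    unfolding 1 2 using intI intp eq by simp
  moreover have "(\<integral>\<^sup>+\<omega>. ennreal ((I \<omega> - J \<omega>)\<^sup>2) \<partial>P) = ennreal (\<integral>\<omega>. (I \<omega> - J \<omega>)\<^sup>2 \<partial>P)"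
    by (rule nn_integral_eq_integral[OF i1]) simp
  moreover have "(\<integral>\<^sup>+x. ennreal ((norm (p x - q x))\<^sup>2) \<partial>N) = ennreal (\<integral>x. (norm (p x - q x))\<^sup>2 \<partial>N)"
    by (rule nn_integral_eq_integral[OF i2]) simp
  ultimately show ?thesis
    unfolding I_def J_def p_def q_def by (simp add: case_prod_unfold)
qed

end

section \<open>Density of step processes\<close>

lemma exists_partition_interval:
  fixes \<tau> :: "nat \<Rightarrow> real"
  assumes "\<tau> 0 < u" "u \<le> \<tau> m"
  shows "\<exists>k<m. \<tau> k < u \<and> u \<le> \<tau> (Suc k)"
  using assms(2)
proof (induction m)
  case (Suc m)
  show ?case
  proof (cases "u \<le> \<tau> m")
    case True
    then show ?thesis using Suc.IH less_Suc_eq by blast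
  qed (use Suc.prems in auto)
qed (use assms(1) in simp)

section \<open>Squared distances in L^2\<close>

lemma norm_diff_squared_triangle:
  fixes a b c :: "'a::real_normed_vector"
  shows "(norm (a - c))\<^sup>2 \<le> 2 * (norm (a - b))\<^sup>2 + 2 * (norm (b - c))\<^sup>2"
proof -
  have "norm (a - c) \<le> norm (a - b) + norm (b - c)"
    using norm_triangle_ineq[of "a - b" "b - c"] by simp
  then have "(norm (a - c))\<^sup>2 \<le> (norm (a - b) + norm (b - c))\<^sup>2"
    by (intro power_mono) auto
  also have "\<dots> \<le> 2 * (norm (a - b))\<^sup>2 + 2 * (norm (b - c))\<^sup>2"
    using zero_le_power2[of "norm (a - b) - norm (b - c)"]
    by (simp add: power2_eq_square algebra_simps)
  finally show ?thesis .
qed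

text \<open>Squared L^2 distance with values in [0, \<infinity>], so that it can be estimated before
  integrability is known. Keeping the square avoids roots of extended reals; the price is the
  constant 2 in \<open>sqdist_triangle\<close>.\<close>

definition sqdist :: "'a measure \<Rightarrow> ('a \<Rightarrow> 'b::real_normed_vector) \<Rightarrow> ('a \<Rightarrow> 'b) \<Rightarrow> ennreal" where
  "sqdist Q f g = (\<integral>\<^sup>+x. ennreal ((norm (f x - g x))\<^sup>2) \<partial>Q)"

lemma sqdist_commute: "sqdist Q f g = sqdist Q g f"
  by (simp add: sqdist_def norm_minus_commute)

lemma sqdist_triangle:
  fixes f g h :: "'a \<Rightarrow> 'b::{second_countable_topology, real_normed_vector}"
  assumes [measurable]: "f \<in> borel_measurable Q" "g \<in> borel_measurable Q" "h \<in> borel_measurable Q"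
  shows "sqdist Q f h \<le> 2 * sqdist Q f g + 2 * sqdist Q g h"
proof -
  have *: "ennreal (2 * x + 2 * y) = 2 * ennreal x + 2 * ennreal y" if "0 \<le> x" "0 \<le> y" for x y
    using that by (simp add: ennreal_plus ennreal_mult')
  have "sqdist Q f h \<le> (\<integral>\<^sup>+x. 2 * ennreal ((norm (f x - g x))\<^sup>2) + 2 * ennreal ((norm (g x - h x))\<^sup>2) \<partial>Q)"
    unfolding sqdist_def
    by (intro nn_integral_mono) (subst *[symmetric], simp, simp, intro ennreal_leI norm_diff_squared_triangle)
  also have "\<dots> = 2 * sqdist Q f g + 2 * sqdist Q g h"
    unfolding sqdist_def by (simp add: nn_integral_add nn_integral_cmult)
  finally show ?thesis .
qed

lemma sqdist_add:
  fixes f g f' g' :: "'a \<Rightarrow> 'b::{second_countable_topology, real_normed_vector}"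
  assumes [measurable]: "f \<in> borel_measurable Q" "g \<in> borel_measurable Q"
    "f' \<in> borel_measurable Q" "g' \<in> borel_measurable Q"
  shows "sqdist Q (\<lambda>x. f x + g x) (\<lambda>x. f' x + g' x) \<le> 2 * sqdist Q f f' + 2 * sqdist Q g g'"
proof -
  have "sqdist Q (\<lambda>x. f x + g x) (\<lambda>x. f' x + g' x) \<le>
      2 * sqdist Q (\<lambda>x. f x + g x) (\<lambda>x. f' x + g x) + 2 * sqdist Q (\<lambda>x. f' x + g x) (\<lambda>x. f' x + g' x)"
    by (rule sqdist_triangle) measurable
  then show ?thesis by (simp add: sqdist_def)
qed

text \<open>The limit inherits the bound \<open>w\<close>, so the difference is at most twice
  \<open>w\<close> and its square is dominated by 4 times the square of \<open>w\<close>.\<close>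

lemma sqdist_dominated_convergence:
  fixes f :: "nat \<Rightarrow> 'a \<Rightarrow> 'b::{second_countable_topology, real_normed_vector}"
  assumes [measurable]: "\<And>i. f i \<in> borel_measurable Q" "g \<in> borel_measurable Q" "w \<in> borel_measurable Q"
    and lim: "\<And>x. x \<in> space Q \<Longrightarrow> (\<lambda>i. f i x) \<longlonglongrightarrow> g x"
    and bound: "\<And>i x. x \<in> space Q \<Longrightarrow> norm (f i x) \<le> w x"
    and fin: "(\<integral>\<^sup>+x. ennreal ((w x)\<^sup>2) \<partial>Q) < \<infinity>"
  shows "(\<lambda>i. sqdist Q (f i) g) \<longlonglongrightarrow> 0"
proof -
  have "(\<lambda>i. \<integral>\<^sup>+x. ennreal ((norm (f i x - g x))\<^sup>2) \<partial>Q) \<longlonglongrightarrow> (\<integral>\<^sup>+x. 0 \<partial>Q)"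
  proof (rule nn_integral_dominated_convergence[where w="\<lambda>x. 4 * ennreal ((w x)\<^sup>2)"])
    show "(\<integral>\<^sup>+ x. 4 * ennreal ((w x)\<^sup>2) \<partial>Q) < \<infinity>"
      using fin by (simp add: nn_integral_cmult ennreal_mult_less_top)
    show "AE x in Q. ennreal ((norm (f i x - g x))\<^sup>2) \<le> 4 * ennreal ((w x)\<^sup>2)" for i
    proof (rule AE_I2)
      fix x assume x: "x \<in> space Q"
      have "norm (g x) \<le> w x"
        using bound[OF x] by (intro tendsto_upperbound[OF tendsto_norm[OF lim[OF x]]]) auto
      then have "norm (f i x - g x) \<le> 2 * w x"
        using bound[OF x, of i] norm_triangle_ineq4[of "f i x" "g x"] by linarith
      then have "(norm (f i x - g x))\<^sup>2 \<le> (2 * w x)\<^sup>2" by (intro power_mono) auto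
      then show "ennreal ((norm (f i x - g x))\<^sup>2) \<le> 4 * ennreal ((w x)\<^sup>2)"
        using ennreal_leI[of "(norm (f i x - g x))\<^sup>2" "4 * (w x)\<^sup>2"]
        by (simp add: power_mult_distrib ennreal_mult')
    qed
    show "AE x in Q. (\<lambda>i. ennreal ((norm (f i x - g x))\<^sup>2)) \<longlonglongrightarrow> 0"
    proof (rule AE_I2)
      fix x assume x: "x \<in> space Q"
      have "(\<lambda>i. (norm (f i x - g x))\<^sup>2) \<longlonglongrightarrow> (norm (g x - g x))\<^sup>2"
        using lim[OF x] by (intro tendsto_intros)
      from tendsto_ennrealI[OF this] show "(\<lambda>i. ennreal ((norm (f i x - g x))\<^sup>2)) \<longlonglongrightarrow> 0" by simp
    qed
  qed measurable
  then show ?thesis by (simp add: sqdist_def)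
qed

lemma sqdist_bound:
  assumes "S \<in> sets Q" "AE x in Q. norm (f x - g x) \<le> c * indicator S x"
  shows "sqdist Q f g \<le> ennreal (c\<^sup>2) * emeasure Q S"
proof -
  have "sqdist Q f g \<le> (\<integral>\<^sup>+x. ennreal (c\<^sup>2) * indicator S x \<partial>Q)"
    unfolding sqdist_def
  proof (rule nn_integral_mono_AE, use assms(2) in eventually_elim)
    fix x assume "norm (f x - g x) \<le> c * indicator S x"
    then have "(norm (f x - g x))\<^sup>2 \<le> (c * indicator S x)\<^sup>2" by (intro power_mono) auto
    then show "ennreal ((norm (f x - g x))\<^sup>2) \<le> ennreal (c\<^sup>2) * indicator S x"
      by (auto simp: indicator_def ennreal_leI split: if_splits)
  qed
  also have "\<dots> = ennreal (c\<^sup>2) * emeasure Q S"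
    using assms(1) by (simp add: nn_integral_cmult_indicator)
  finally show ?thesis .
qed

context brownian
begin

section \<open>Generators of the predictable sigma-algebra\<close>

abbreviation predictable_space :: "(real \<times> 'a) measure" where
  "predictable_space \<equiv> predictable_sigma M T W"

definition predictable_generator :: "(real \<times> 'a) set set" where
  "predictable_generator =
     {{0} \<times> A | A. A \<in> sets (F 0)} \<union>
     {{s<..t} \<times> A | s t A. 0 \<le> s \<and> s \<le> t \<and> t \<le> T \<and> A \<in> sets (F s)}"

lemma predictable_generator_subset: "predictable_generator \<subseteq> Pow ({0..T} \<times> space M)"
  unfolding predictable_generator_def
  using T_pos by (auto dest!: sets.sets_into_space[of _ "F _"])

lemma space_predictable_space: "space predictable_space = {0..T} \<times> space M"
  unfolding predictable_sigma_def predictable_generator_def[symmetric]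
  by (rule space_measure_of[OF predictable_generator_subset])

lemma sets_predictable_space:
  "sets predictable_space = sigma_sets ({0..T} \<times> space M) predictable_generator"
  unfolding predictable_sigma_def predictable_generator_def[symmetric]
  by (rule sets_measure_of[OF predictable_generator_subset])

lemma sets_L_Icc: "B \<in> sets borel \<Longrightarrow> B \<subseteq> {0..T} \<Longrightarrow> B \<in> sets L"
  by (auto simp: sets_restrict_space image_iff intro!: bexI[of _ B])

lemma sets_predictable_space_subset: "sets predictable_space \<subseteq> sets N"
proof -
  have "predictable_generator \<subseteq> sets N"
    unfolding predictable_generator_def
  proof safe
    fix A assume "A \<in> sets (F 0)"
    then have "A \<in> sets P" using sets_F_subset[of 0] T_pos by auto
    then show "{0} \<times> A \<in> sets N"
      using T_pos by (intro pair_measureI sets_L_Icc) auto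
  next
    fix s t :: real and A assume *: "A \<in> sets (F s)" "0 \<le> s" "s \<le> t" "t \<le> T"
    then have "A \<in> sets P" using sets_F_subset[of s] by auto
    then show "{s<..t} \<times> A \<in> sets N"
      using * by (intro pair_measureI sets_L_Icc) auto
  qed
  then show ?thesis
    unfolding sets_predictable_space space_N[symmetric] by (rule sets.sigma_sets_subset)
qed

lemma measurable_predictable_imp_N: "f \<in> measurable predictable_space R \<Longrightarrow> f \<in> measurable N R"
  using sets_predictable_space_subset
  by (auto simp: measurable_def space_predictable_space space_N)

text \<open>Two rectangles over half-open intervals meet in one that starts at the later left
  endpoint, where both events are already known since the filtration increases. Empty intersections
  are exhibited as the generator \<open>{0} \<times> {}\<close>.\<close>

lemma Int_stable_predictable_generator: "Int_stable predictable_generator"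
proof (rule Int_stableI)
  fix X Y assume "X \<in> predictable_generator" "Y \<in> predictable_generator"
  then consider A B where "X = {0} \<times> A" "A \<in> sets (F 0)" "Y = {0} \<times> B" "B \<in> sets (F 0)"
    | A s t B where "X = {0} \<times> A" "Y = {s<..t} \<times> B" "0 \<le> s"
    | A s t B where "Y = {0} \<times> A" "X = {s<..t} \<times> B" "0 \<le> s"
    | A s t B s' t' where "X = {s<..t} \<times> A" "Y = {s'<..t'} \<times> B" "0 \<le> s" "s \<le> t" "t \<le> T"
        "A \<in> sets (F s)" "0 \<le> s'" "s' \<le> t'" "t' \<le> T" "B \<in> sets (F s')"
    unfolding predictable_generator_def by blast
  then show "X \<inter> Y \<in> predictable_generator"
  proof cases
    case 1
    then have "X \<inter> Y = {0} \<times> (A \<inter> B)" "A \<inter> B \<in> sets (F 0)" by auto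
    then show ?thesis unfolding predictable_generator_def by blast
  next
    case 2
    then have "X \<inter> Y = {0} \<times> {}" by auto
    moreover have "{} \<in> sets (F 0)" by simp
    ultimately show ?thesis unfolding predictable_generator_def by blast
  next
    case 3
    then have "X \<inter> Y = {0} \<times> {}" by auto
    moreover have "{} \<in> sets (F 0)" by simp
    ultimately show ?thesis unfolding predictable_generator_def by blast
  next
    case 4
    define a b where "a = max s s'" and "b = min t t'"
    have eq: "X \<inter> Y = {a<..b} \<times> (A \<inter> B)" using 4 by (auto simp: a_def b_def)
    show ?thesis
    proof (cases "a \<le> b")
      case True
      have "A \<in> sets (F a)" "B \<in> sets (F a)"
        using sets_F_mono[of s a] sets_F_mono[of s' a] 4 by (auto simp: a_def)
      then have "A \<inter> B \<in> sets (F a)" by auto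
      moreover have "0 \<le> a" "b \<le> T" using 4 by (auto simp: a_def b_def)
      ultimately show ?thesis using True eq unfolding predictable_generator_def by blast
    next
      case False
      then have "X \<inter> Y = {0} \<times> {}" using eq by auto
      moreover have "{} \<in> sets (F 0)" by simp
      ultimately show ?thesis unfolding predictable_generator_def by blast
    qed
  qed
qed

section \<open>Approximation by step processes on uniform grids\<close>

definition grid :: "nat \<Rightarrow> nat \<Rightarrow> real" where
  "grid n k = T * real k / real (Suc n)"

lemma grid_Suc: "grid n (Suc k) = grid n k + T / real (Suc n)"
  by (simp add: grid_def distrib_left add_divide_distrib add.commute)

lemma grid_0 [simp]: "grid n 0 = 0" and grid_last [simp]: "grid n (Suc n) = T"
  by (simp_all add: grid_def)

lemma grid_mono: "k \<le> l \<Longrightarrow> grid n k \<le> grid n l"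
  unfolding grid_def using T_pos by (intro divide_right_mono mult_left_mono) auto

lemma grid_nonneg: "0 \<le> grid n k"
  using grid_mono[of 0 k n] by simp

lemma elementary_data_grid:
  assumes "\<And>k. k < Suc n \<Longrightarrow> adapted_bounded (grid n k) (h k)"
  shows "elementary_data M T W (Suc n) (grid n) h"
  unfolding elementary_data_def
  using assms grid_mono[of _ "Suc _" n] by (auto simp: adapted_bounded_def)

definition grid_process :: "nat \<Rightarrow> (nat \<Rightarrow> 'a \<Rightarrow> real^'m) \<Rightarrow> real \<times> 'a \<Rightarrow> real^'m" where
  "grid_process n h x = elementary_process (Suc n) (grid n) h (fst x) (snd x)"

lemma grid_process_measurable:
  assumes "\<And>k. k < Suc n \<Longrightarrow> adapted_bounded (grid n k) (h k)"
  shows "grid_process n h \<in> borel_measurable N"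
  using elementary_process_measurable[OF elementary_data_grid[OF assms]]
  by (simp add: grid_process_def[abs_def] case_prod_unfold)

lemma elementary_process_at:
  assumes mono: "\<And>i j. i \<le> j \<Longrightarrow> \<tau> i \<le> \<tau> j" and k: "k < n" "\<tau> k < u" "u \<le> \<tau> (Suc k)"
  shows "elementary_process n \<tau> h u \<omega> = h k \<omega>"
proof -
  have "(indicator {\<tau> l<..\<tau> (Suc l)} u :: real) = (if l = k then 1 else 0)" for l
  proof (cases l k rule: linorder_cases)
    case less
    then have "\<tau> (Suc l) \<le> \<tau> k" by (intro mono) auto
    then show ?thesis using less k by auto
  next
    case greater
    then have "\<tau> (Suc k) \<le> \<tau> l" by (intro mono) auto
    then show ?thesis using greater k by auto
  qed (use k in auto)
  then have "elementary_process n \<tau> h u \<omega> = (\<Sum>l<n. if l = k then h l \<omega> else 0)"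
    unfolding elementary_process_def by (intro sum.cong) auto
  then show ?thesis using k by simp
qed

text \<open>Approximation is demanded on every sufficiently fine uniform grid, not just on some
  grid. This makes the class closed under addition: both summands are approximated on the same grid,
  where coefficients are added, and partitions never need to be merged.\<close>

definition approximable :: "(real \<times> 'a \<Rightarrow> real^'m) \<Rightarrow> bool" where
  "approximable f \<longleftrightarrow> f \<in> borel_measurable N \<and>
     (\<forall>e>0. \<forall>\<^sub>F n in sequentially. \<exists>h. (\<forall>k<Suc n. adapted_bounded (grid n k) (h k)) \<and>
        sqdist N (grid_process n h) f \<le> ennreal e)"

lemma adapted_bounded_add:
  assumes "adapted_bounded s h" "adapted_bounded s g"
  shows "adapted_bounded s (\<lambda>\<omega>. h \<omega> + g \<omega>)"
proof -
  obtain B D where *: "h \<in> borel_measurable (F s)" "g \<in> borel_measurable (F s)"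
    "\<And>\<omega>. \<omega> \<in> space M \<Longrightarrow> norm (h \<omega>) \<le> B" "\<And>\<omega>. \<omega> \<in> space M \<Longrightarrow> norm (g \<omega>) \<le> D"
    using assms unfolding adapted_bounded_def by blast
  have "norm (h \<omega> + g \<omega>) \<le> B + D" if "\<omega> \<in> space M" for \<omega>
    using norm_triangle_ineq[of "h \<omega>" "g \<omega>"] *(3,4)[OF that] by linarith
  moreover have "(\<lambda>\<omega>. h \<omega> + g \<omega>) \<in> borel_measurable (F s)"
    using *(1,2) by (rule borel_measurable_add)
  ultimately show ?thesis unfolding adapted_bounded_def by blast
qed

text \<open>The error budget for \<open>sqdist_triangle\<close> and \<open>sqdist_add\<close>: each
  of two errors e / 4 gets doubled.\<close>

lemma ennreal_quarter: "0 \<le> e \<Longrightarrow> 2 * ennreal (e / 4) + 2 * ennreal (e / 4) = ennreal e"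
proof -
  assume e: "0 \<le> e"
  have "2 * ennreal (e / 4) = ennreal (e / 2)"
    using ennreal_mult'[of 2 "e / 4"] by simp
  then show ?thesis using e by (simp flip: ennreal_plus)
qed

lemma approximable_add:
  assumes f: "approximable f" and g: "approximable g"
  shows "approximable (\<lambda>x. f x + g x)"
  unfolding approximable_def
proof (intro conjI allI impI)
  have fm: "f \<in> borel_measurable N" and gm: "g \<in> borel_measurable N"
    using f g by (auto simp: approximable_def)
  then show "(\<lambda>x. f x + g x) \<in> borel_measurable N" by (rule borel_measurable_add)
  fix e :: real assume e: "0 < e"
  then have "\<forall>\<^sub>F n in sequentially. \<exists>h. (\<forall>k<Suc n. adapted_bounded (grid n k) (h k)) \<and>
        sqdist N (grid_process n h) f \<le> ennreal (e / 4)"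
    "\<forall>\<^sub>F n in sequentially. \<exists>h. (\<forall>k<Suc n. adapted_bounded (grid n k) (h k)) \<and>
        sqdist N (grid_process n h) g \<le> ennreal (e / 4)"
    using f g by (auto simp: approximable_def)
  then show "\<forall>\<^sub>F n in sequentially. \<exists>h. (\<forall>k<Suc n. adapted_bounded (grid n k) (h k)) \<and>
        sqdist N (grid_process n h) (\<lambda>x. f x + g x) \<le> ennreal e"
  proof eventually_elim
    case (elim n)
    then obtain h h' where
      h: "\<And>k. k < Suc n \<Longrightarrow> adapted_bounded (grid n k) (h k)" "sqdist N (grid_process n h) f \<le> ennreal (e / 4)" and
      h': "\<And>k. k < Suc n \<Longrightarrow> adapted_bounded (grid n k) (h' k)" "sqdist N (grid_process n h') g \<le> ennreal (e / 4)"
      by blast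
    have eq: "grid_process n (\<lambda>k \<omega>. h k \<omega> + h' k \<omega>) = (\<lambda>x. grid_process n h x + grid_process n h' x)"
      by (simp add: grid_process_def elementary_process_def fun_eq_iff scaleR_add_right sum.distrib)
    have "sqdist N (grid_process n (\<lambda>k \<omega>. h k \<omega> + h' k \<omega>)) (\<lambda>x. f x + g x) \<le>
        2 * sqdist N (grid_process n h) f + 2 * sqdist N (grid_process n h') g"
      unfolding eq by (intro sqdist_add grid_process_measurable h h' fm gm)
    also have "\<dots> \<le> 2 * ennreal (e / 4) + 2 * ennreal (e / 4)"
      using h(2) h'(2) by (intro add_mono mult_left_mono) auto
    also have "\<dots> = ennreal e" using e by (intro ennreal_quarter) simp
    finally show ?case
      using h(1) h'(1) adapted_bounded_add by (intro exI[of _ "\<lambda>k \<omega>. h k \<omega> + h' k \<omega>"]) auto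
  qed
qed

lemma approximable_limit:
  assumes f: "\<And>i::nat. approximable (f i)" and g: "g \<in> borel_measurable N"
    and lim: "(\<lambda>i. sqdist N (f i) g) \<longlonglongrightarrow> 0"
  shows "approximable g"
  unfolding approximable_def
proof (intro conjI allI impI g)
  fix e :: real assume e: "0 < e"
  have "\<forall>\<^sub>F i in sequentially. sqdist N (f i) g < ennreal (e / 4)"
    using lim e by (intro order_tendstoD) auto
  then obtain i where i: "sqdist N (f i) g \<le> ennreal (e / 4)"
    unfolding eventually_sequentially by (meson less_imp_le order_refl)
  have fm: "f i \<in> borel_measurable N" using f by (auto simp: approximable_def)
  have "\<forall>\<^sub>F n in sequentially. \<exists>h. (\<forall>k<Suc n. adapted_bounded (grid n k) (h k)) \<and>
        sqdist N (grid_process n h) (f i) \<le> ennreal (e / 4)"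
    using f e by (auto simp: approximable_def)
  then show "\<forall>\<^sub>F n in sequentially. \<exists>h. (\<forall>k<Suc n. adapted_bounded (grid n k) (h k)) \<and>
        sqdist N (grid_process n h) g \<le> ennreal e"
  proof eventually_elim
    case (elim n)
    then obtain h where
      h: "\<And>k. k < Suc n \<Longrightarrow> adapted_bounded (grid n k) (h k)" "sqdist N (grid_process n h) (f i) \<le> ennreal (e / 4)"
      by blast
    have "sqdist N (grid_process n h) g \<le>
        2 * sqdist N (grid_process n h) (f i) + 2 * sqdist N (f i) g"
      by (intro sqdist_triangle grid_process_measurable h fm g)
    also have "\<dots> \<le> 2 * ennreal (e / 4) + 2 * ennreal (e / 4)"
      using h(2) i by (intro add_mono mult_left_mono) auto
    also have "\<dots> = ennreal e" using e by (intro ennreal_quarter) simp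
    finally show ?case using h(1) by blast
  qed
qed

lemma approximable_cong_AE:
  assumes "approximable f" "g \<in> borel_measurable N" "AE x in N. f x = g x"
  shows "approximable g"
proof (rule approximable_limit[of "\<lambda>_. f"])
  have "sqdist N f g = (\<integral>\<^sup>+x. 0 \<partial>N)"
    unfolding sqdist_def by (rule nn_integral_cong_AE) (use assms(3) in eventually_elim, simp)
  then show "(\<lambda>i. sqdist N f g) \<longlonglongrightarrow> 0" by simp
qed (use assms in auto)

lemma approximable_0: "approximable (\<lambda>_. 0)"
  unfolding approximable_def
proof (intro conjI allI impI always_eventually)
  fix e :: real and n
  have "sqdist N (grid_process n (\<lambda>_ _. 0)) (\<lambda>_. 0) = 0"
    by (simp add: sqdist_def grid_process_def elementary_process_def)
  then show "\<exists>h. (\<forall>k<Suc n. adapted_bounded (grid n k) (h k)) \<and>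
        sqdist N (grid_process n h) (\<lambda>_. 0) \<le> ennreal e"
    by (intro exI[of _ "\<lambda>_ _. 0"]) (auto simp: adapted_bounded_def)
qed simp

lemma approximable_sum:
  "finite I \<Longrightarrow> (\<And>i. i \<in> I \<Longrightarrow> approximable (f i)) \<Longrightarrow> approximable (\<lambda>x. \<Sum>i\<in>I. f i x)"
  by (induction I rule: finite_induct) (auto intro: approximable_0 approximable_add)

lemma emeasure_N_strip:
  assumes B: "B \<in> sets borel"
  shows "(B \<inter> {0..T}) \<times> space M \<in> sets N"
    and "emeasure N ((B \<inter> {0..T}) \<times> space M) \<le> emeasure lborel B"
proof -
  have BL: "B \<inter> {0..T} \<in> sets L" using B by (intro sets_L_Icc) auto
  have SP: "space M \<in> sets P" using sets.top[of P] by simp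
  show "(B \<inter> {0..T}) \<times> space M \<in> sets N" using BL SP by (rule pair_measureI)
  have "emeasure N ((B \<inter> {0..T}) \<times> space M) = emeasure L (B \<inter> {0..T}) * emeasure P (space M)"
    by (rule P.emeasure_pair_measure_Times[OF BL SP])
  also have "\<dots> = emeasure L (B \<inter> {0..T})" using P.emeasure_space_1 by simp
  also have "\<dots> = emeasure lborel (B \<inter> {0..T})" by (intro emeasure_restrict_space) auto
  also have "\<dots> \<le> emeasure lborel B" using B by (intro emeasure_mono) auto
  finally show "emeasure N ((B \<inter> {0..T}) \<times> space M) \<le> emeasure lborel B" .
qed

text \<open>Only grid intervals lying inside [s, t] receive the value \<open>v\<close> on
  \<open>A\<close>. Dropping those that begin before s keeps the coefficients adapted, since
  \<open>A\<close> is known from time s on; the error is confined to two time strips of the width of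
  the mesh, next to s and t.\<close>

lemma approximable_rectangle:
  assumes st: "0 \<le> s" "s \<le> t" "t \<le> T" and A: "A \<in> sets (F s)"
  shows "approximable (\<lambda>x. indicator ({s<..t} \<times> A) x *\<^sub>R v)"
  unfolding approximable_def
proof (intro conjI allI impI)
  have AM: "A \<subseteq> space M" using sets.sets_into_space[OF A] by simp
  have "{s<..t} \<times> A \<in> sets N"
    using sets_predictable_space_subset A st unfolding sets_predictable_space predictable_generator_def
    by blast
  then show "(\<lambda>x. indicator ({s<..t} \<times> A) x *\<^sub>R v) \<in> borel_measurable N"
    by (intro borel_measurable_scaleR borel_measurable_indicator) auto
  fix e :: real assume e: "0 < e"
  \<comment> \<open>The eventual bound on the squared error: |v|^2 times the length of two strips of
    one mesh width.\<close>
  have "(\<lambda>n. (norm v)\<^sup>2 * (2 * (T / real (Suc n)))) \<longlonglongrightarrow> (norm v)\<^sup>2 * (2 * 0)"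
    by (intro tendsto_intros LIMSEQ_Suc[OF lim_const_over_n])
  then have "\<forall>\<^sub>F n in sequentially. (norm v)\<^sup>2 * (2 * (T / real (Suc n))) < e"
    using e by (intro order_tendstoD) auto
  then show "\<forall>\<^sub>F n in sequentially. \<exists>h. (\<forall>k<Suc n. adapted_bounded (grid n k) (h k)) \<and>
        sqdist N (grid_process n h) (\<lambda>x. indicator ({s<..t} \<times> A) x *\<^sub>R v) \<le> ennreal e"
  proof eventually_elim
    case (elim n)
    define \<delta> where "\<delta> = T / real (Suc n)"
    have \<delta>: "0 \<le> \<delta>" using T_pos by (simp add: \<delta>_def)
    define inside where "inside k \<longleftrightarrow> s \<le> grid n k \<and> grid n (Suc k) \<le> t" for k
    define h where "h k \<omega> = (if inside k then indicator A \<omega> *\<^sub>R v else 0)" for k \<omega>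
    have h: "adapted_bounded (grid n k) (h k)" for k
    proof (cases "inside k")
      case True
      then have "A \<in> sets (F (grid n k))" using A sets_F_mono[of s "grid n k"] by (auto simp: inside_def)
      then have "h k \<in> borel_measurable (F (grid n k))"
        using True by (simp add: h_def[abs_def])
      moreover have "norm (h k \<omega>) \<le> norm v" for \<omega> by (simp add: h_def indicator_def)
      ultimately show ?thesis unfolding adapted_bounded_def by blast
    qed (auto simp: h_def[abs_def] adapted_bounded_def)
    \<comment> \<open>If u in (s, t] belongs to a grid interval that sticks out, the interval starts
      before s or ends after t, so u is less than one mesh away from s or from t.\<close>
    define B where "B = {s<..s + \<delta>} \<union> {t - \<delta><..t}"
    define S where "S = (B \<inter> {0..T}) \<times> space M"
    have B: "B \<in> sets borel" by (simp add: B_def)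
    have close: "norm (grid_process n h x - indicator ({s<..t} \<times> A) x *\<^sub>R v) \<le> norm v * indicator S x"
      if "x \<in> space N" for x
    proof -
      obtain u \<omega> where x: "x = (u, \<omega>)" by (cases x)
      have u: "0 \<le> u" "u \<le> T" "\<omega> \<in> space M" using that by (auto simp: x space_N)
      show ?thesis
      proof (cases "u = 0")
        case True
        have "elementary_process (Suc n) (grid n) h 0 \<omega> = 0"
          unfolding elementary_process_def
        proof (rule sum.neutral, rule ballI)
          fix k show "indicator {grid n k<..grid n (Suc k)} 0 *\<^sub>R h k \<omega> = 0"
            using grid_nonneg[of n k] by simp
        qed
        then show ?thesis using True st by (simp add: x grid_process_def)
      next
        case False
        then obtain k where k: "k < Suc n" "grid n k < u" "u \<le> grid n (Suc k)"
          using exists_partition_interval[of "grid n" u "Suc n"] u by auto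
        have ep: "grid_process n h x = h k \<omega>"
          unfolding x grid_process_def fst_conv snd_conv
          by (rule elementary_process_at[OF grid_mono k])
        have gS: "grid n (Suc k) = grid n k + \<delta>" by (simp add: grid_Suc \<delta>_def)
        consider "\<omega> \<notin> A" | "\<omega> \<in> A" "inside k" | "\<omega> \<in> A" "\<not> inside k" "u \<notin> {s<..t}"
          | "\<omega> \<in> A" "\<not> inside k" "u \<in> {s<..t}" by blast
        then show ?thesis
        proof cases
          case 2
          then have "u \<in> {s<..t}" using k by (auto simp: inside_def)
          then show ?thesis using 2 ep by (simp add: h_def x)
        next
          case 4
          then have "u \<in> B" using k gS by (auto simp: inside_def B_def)
          then have "x \<in> S" using u by (simp add: S_def x)
          then show ?thesis using 4 ep by (simp add: h_def x)
        qed (use ep in \<open>auto simp: h_def x\<close>)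
      qed
    qed
    have "sqdist N (grid_process n h) (\<lambda>x. indicator ({s<..t} \<times> A) x *\<^sub>R v) \<le>
        ennreal ((norm v)\<^sup>2) * emeasure N S"
      using emeasure_N_strip(1)[OF B] close by (intro sqdist_bound AE_I2) (auto simp: S_def)
    also have "\<dots> \<le> ennreal ((norm v)\<^sup>2) * ennreal (2 * \<delta>)"
    proof (intro mult_left_mono)
      have "emeasure N S \<le> emeasure lborel B" unfolding S_def by (rule emeasure_N_strip(2)[OF B])
      also have "\<dots> \<le> emeasure lborel {s<..s + \<delta>} + emeasure lborel {t - \<delta><..t}"
        unfolding B_def by (intro emeasure_subadditive) auto
      also have "\<dots> = ennreal (2 * \<delta>)"
        using \<delta> by (simp add: ennreal_plus[symmetric] del: ennreal_plus)
      finally show "emeasure N S \<le> ennreal (2 * \<delta>)" .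
    qed simp
    also have "\<dots> = ennreal ((norm v)\<^sup>2 * (2 * \<delta>))" using \<delta> by (simp add: ennreal_mult')
    also have "\<dots> \<le> ennreal e" using elim by (intro ennreal_leI) (simp add: \<delta>_def)
    finally show ?case using h by blast
  qed
qed

text \<open>The time 0 has Lebesgue measure zero, so these generators are approximated by the zero
  process.\<close>

lemma approximable_initial:
  assumes A: "A \<in> sets (F 0)"
  shows "approximable (\<lambda>x. indicator ({0} \<times> A) x *\<^sub>R v)"
proof (rule approximable_cong_AE[OF approximable_0])
  have "{0} \<times> A \<in> sets N"
    using sets_predictable_space_subset A unfolding sets_predictable_space predictable_generator_def
    by blast
  then show "(\<lambda>x. indicator ({0} \<times> A) x *\<^sub>R v) \<in> borel_measurable N"
    by (intro borel_measurable_scaleR borel_measurable_indicator) auto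
  have "({0} \<inter> {0..T}) \<times> space M \<in> null_sets N"
    using emeasure_N_strip[of "{0}"] by (auto simp: null_sets_def)
  then have "AE x in N. x \<notin> ({0} \<inter> {0..T}) \<times> space M" by (rule AE_not_in)
  moreover have "AE x in N. x \<in> space N" by (rule AE_space)
  ultimately show "AE x in N. 0 = indicator ({0} \<times> A) x *\<^sub>R v"
  proof eventually_elim
    case (elim x)
    then have "x \<notin> {0} \<times> A" by (auto simp: space_N)
    then show ?case by simp
  qed
qed

lemma approximable_indicator:
  assumes "S \<in> sets predictable_space"
  shows "approximable (\<lambda>x. indicator S x *\<^sub>R v)"
  using Int_stable_predictable_generator predictable_generator_subset
    assms[unfolded sets_predictable_space]
proof (induction arbitrary: v rule: sigma_sets_induct_disjoint)
  case (basic A)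
  then show ?case
    unfolding predictable_generator_def using approximable_rectangle approximable_initial by auto
next
  case empty
  show ?case using approximable_0 by simp
next
  case (compl A)
  \<comment> \<open>The indicator of the whole space is assembled from the two generators over (0,
    T] and {0}; subtracting \<open>A\<close> uses the induction hypothesis for \<open>- v\<close>,
    hence the generalisation over \<open>v\<close>.\<close>
  have "space M \<in> sets (F 0)" using sets.top[of "F 0"] by simp
  then have "approximable (\<lambda>x. indicator ({0<..T} \<times> space M) x *\<^sub>R v + indicator ({0} \<times> space M) x *\<^sub>R v
      + indicator A x *\<^sub>R (- v))" (is "approximable ?f")
    using T_pos by (intro approximable_add approximable_rectangle approximable_initial compl.IH) auto
  moreover have "{0..T} \<times> space M - A \<in> sets N"
    using compl sets_predictable_space_subset
    unfolding sets_predictable_space by (auto intro: sigma_sets.Compl)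
  then have "(\<lambda>x. indicator ({0..T} \<times> space M - A) x *\<^sub>R v) \<in> borel_measurable N"
    by (intro borel_measurable_scaleR borel_measurable_indicator) auto
  moreover have "?f x = indicator ({0..T} \<times> space M - A) x *\<^sub>R v" if "x \<in> space N" for x
    using that by (auto simp: space_N indicator_def)
  ultimately show ?case by (rule approximable_cong_AE[OF _ _ AE_I2])
next
  case (union A)
  have A: "A i \<in> sets N" for i
    using union sets_predictable_space_subset unfolding sets_predictable_space by blast
  have eq: "(\<Sum>i<n. indicator (A i) x *\<^sub>R v) = indicator (\<Union>i<n. A i) x *\<^sub>R v" for n x
  proof -
    have "indicator (\<Union>i<n. A i) x = (\<Sum>i<n. indicator (A i) x :: real)"
      using union(1) by (intro indicator_UN_disjoint) (auto simp: disjoint_family_on_def)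
    then show ?thesis by (simp add: scaleR_sum_left)
  qed
  show ?case
  proof (rule approximable_limit)
    show "approximable (\<lambda>x. \<Sum>i<n. indicator (A i) x *\<^sub>R v)" for n
      using union by (intro approximable_sum) auto
    have UA: "(\<Union>i. A i) \<in> sets N" using A by auto
    show "(\<lambda>x. indicator (\<Union>i. A i) x *\<^sub>R v) \<in> borel_measurable N"
      by (intro borel_measurable_scaleR borel_measurable_indicator UA) auto
    show "(\<lambda>n. sqdist N (\<lambda>x. \<Sum>i<n. indicator (A i) x *\<^sub>R v) (\<lambda>x. indicator (\<Union>i. A i) x *\<^sub>R v)) \<longlonglongrightarrow> 0"
      unfolding eq
    \<comment> \<open>On the finite measure \<open>N\<close> the constant |v| is a square-integrable
      bound for all partial unions.\<close>
    proof (rule sqdist_dominated_convergence[where w="\<lambda>_. norm v"])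
      show "(\<lambda>x. indicator (\<Union>i<n. A i) x *\<^sub>R v) \<in> borel_measurable N" for n
        using A by (intro borel_measurable_scaleR borel_measurable_indicator sets.finite_UN) auto
      show "(\<lambda>n. indicator (\<Union>i<n. A i) x *\<^sub>R v) \<longlonglongrightarrow> indicator (\<Union>i. A i) x *\<^sub>R v" for x
        by (intro tendsto_intros LIMSEQ_indicator_UN)
      show "norm (indicator (\<Union>i<n. A i) x *\<^sub>R v) \<le> norm v" for n x
        by (simp add: indicator_def)
      show "(\<integral>\<^sup>+ x. ennreal ((norm v)\<^sup>2) \<partial>N) < \<infinity>"
        using N.emeasure_finite[of "space N", unfolded infinity_ennreal_def top.not_eq_extremum]
        by (simp add: ennreal_mult_less_top)
    qed (use UA in \<open>auto intro!: borel_measurable_scaleR borel_measurable_indicator\<close>)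
  qed
qed

text \<open>Simple functions converging to \<open>f\<close> and bounded by 2 |f| are finite sums of
  indicators of predictable sets; dominated convergence, with the square integrability of
  \<open>f\<close>, turns pointwise convergence into L^2 convergence.\<close>

lemma predictable_approximable:
  assumes f: "f \<in> borel_measurable predictable_space"
    and fin: "(\<integral>\<^sup>+x. ennreal ((norm (f x))\<^sup>2) \<partial>N) < \<infinity>"
  shows "approximable f"
proof -
  obtain s where s: "\<And>i. simple_function predictable_space (s i)"
    "\<And>x. x \<in> space predictable_space \<Longrightarrow> (\<lambda>i. s i x) \<longlonglongrightarrow> f x"
    "\<And>i x. x \<in> space predictable_space \<Longrightarrow> dist (s i x) 0 \<le> 2 * dist (f x) 0"
    using borel_measurable_implies_sequence_metric[OF f, of 0] by blast
  have fN: "f \<in> borel_measurable N" by (rule measurable_predictable_imp_N[OF f])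
  have sN: "s i \<in> borel_measurable N" for i
    by (rule measurable_predictable_imp_N[OF borel_measurable_simple_function[OF s(1)]])
  have spaces: "space N = space predictable_space" by (simp add: space_N space_predictable_space)
  show ?thesis
  proof (rule approximable_limit[of s])
    fix i
    have "approximable (\<lambda>x. \<Sum>y\<in>s i ` space predictable_space.
        indicator (s i -` {y} \<inter> space predictable_space) x *\<^sub>R y)"
      using simple_functionD[OF s(1)[of i]] by (intro approximable_sum approximable_indicator) auto
    moreover have "AE x in N. (\<Sum>y\<in>s i ` space predictable_space.
        indicator (s i -` {y} \<inter> space predictable_space) x *\<^sub>R y) = s i x"
      by (rule AE_I2, unfold spaces)
        (rule simple_function_indicator_representation_banach[OF s(1), symmetric])
    ultimately show "approximable (s i)"
      by (intro approximable_cong_AE[OF _ sN])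
  next
    have "(\<lambda>x. 2 * norm (f x)) \<in> borel_measurable N" using fN by measurable
    moreover have "(\<integral>\<^sup>+ x. ennreal ((2 * norm (f x))\<^sup>2) \<partial>N) < \<infinity>"
    proof -
      have "(\<integral>\<^sup>+ x. ennreal ((2 * norm (f x))\<^sup>2) \<partial>N) = (\<integral>\<^sup>+ x. 4 * ennreal ((norm (f x))\<^sup>2) \<partial>N)"
        by (intro nn_integral_cong) (simp add: power_mult_distrib ennreal_mult')
      also have "\<dots> = 4 * (\<integral>\<^sup>+ x. ennreal ((norm (f x))\<^sup>2) \<partial>N)"
        using fN by (intro nn_integral_cmult measurable_compose[OF _ measurable_ennreal]
            borel_measurable_power measurable_compose[OF fN borel_measurable_norm])
      finally show ?thesis using fin by (simp add: ennreal_mult_less_top)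
    qed
    ultimately show "(\<lambda>i. sqdist N (s i) f) \<longlonglongrightarrow> 0"
      using s(2,3) by (intro sqdist_dominated_convergence[OF sN fN, of "\<lambda>x. 2 * norm (f x)"])
        (auto simp: spaces)
  qed (rule fN)
qed

end

section \<open>Existence and mean of the Ito integral\<close>

lemma tendsto_0_le_ennreal:
  fixes f g :: "'a \<Rightarrow> ennreal"
  assumes "\<And>j. f j \<le> g j" "(g \<longlongrightarrow> 0) G"
  shows "(f \<longlongrightarrow> 0) G"
  by (rule tendsto_sandwich[of "\<lambda>_. 0" f G g 0]) (use assms in auto)

text \<open>The rate 16^-j makes consecutive differences summable in mean, hence almost surely
  absolutely summable, which produces a pointwise limit; Fatou's lemma upgrades it to an L^2 limit.
  The bound 2 / 16^i + 2 / 16^j is what \<open>sqdist_triangle\<close> yields from squared errors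
  16^-i and 16^-j.\<close>

lemma sqdist_fast_Cauchy_limit:
  fixes J :: "nat \<Rightarrow> 'a \<Rightarrow> real"
  assumes "prob_space Q"
    and J[measurable]: "\<And>j. J j \<in> borel_measurable Q"
    and Cauchy: "\<And>i j. sqdist Q (J i) (J j) \<le> ennreal (2 / 16 ^ i + 2 / 16 ^ j)"
  obtains I where "I \<in> borel_measurable Q" "(\<lambda>j. sqdist Q (J j) I) \<longlonglongrightarrow> 0"
proof -
  interpret prob_space Q by fact
  define Y where "Y j x = \<bar>J (Suc j) x - J j x\<bar>" for j x
  have Ym[measurable]: "Y j \<in> borel_measurable Q" for j
    unfolding Y_def[abs_def] by measurable
  have Y: "(\<integral>\<^sup>+x. ennreal (Y j x) \<partial>Q) \<le> ennreal (5 * (1 / 4) ^ j)" for j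
  proof -
    \<comment> \<open>A substitute for the Cauchy-Schwarz inequality: small y are covered by the
      additive term, large y by the quadratic one. With a second moment of at most 4 / 16^j it gives
      4 / 4^j + 1 / 4^j, the origin of the 5.\<close>
    have le: "y \<le> 4 ^ j * y\<^sup>2 + 1 / 4 ^ j" if "0 \<le> y" for y :: real
    proof (cases "y \<le> 1 / 4 ^ j")
      case True
      moreover have "0 \<le> 4 ^ j * y\<^sup>2" by simp
      ultimately show ?thesis by linarith
    next
      case False
      then have "1 \<le> 4 ^ j * y" by (simp add: field_simps)
      then have "1 * y \<le> (4 ^ j * y) * y" using that by (intro mult_right_mono)
      then have "y \<le> 4 ^ j * y\<^sup>2" by (simp add: power2_eq_square mult_ac)
      moreover have "0 \<le> 1 / (4::real) ^ j" by simp
      ultimately show ?thesis by linarith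
    qed
    have "(\<integral>\<^sup>+x. ennreal (Y j x) \<partial>Q) \<le>
        (\<integral>\<^sup>+x. ennreal (4 ^ j) * ennreal ((norm (J j x - J (Suc j) x))\<^sup>2) + ennreal (1 / 4 ^ j) \<partial>Q)"
    proof (rule nn_integral_mono)
      fix x
      have "ennreal (Y j x) \<le> ennreal (4 ^ j * (Y j x)\<^sup>2 + 1 / 4 ^ j)"
        using le[of "Y j x"] by (intro ennreal_leI) (simp add: Y_def)
      also have "\<dots> = ennreal (4 ^ j) * ennreal ((Y j x)\<^sup>2) + ennreal (1 / 4 ^ j)"
        by (subst ennreal_plus) (auto simp: ennreal_mult')
      also have "(Y j x)\<^sup>2 = (norm (J j x - J (Suc j) x))\<^sup>2"
        unfolding Y_def by (simp add: power2_commute)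
      finally show "ennreal (Y j x) \<le>
          ennreal (4 ^ j) * ennreal ((norm (J j x - J (Suc j) x))\<^sup>2) + ennreal (1 / 4 ^ j)" .
    qed
    also have "\<dots> = ennreal (4 ^ j) * sqdist Q (J j) (J (Suc j)) + ennreal (1 / 4 ^ j)"
      unfolding sqdist_def by (simp add: nn_integral_add nn_integral_cmult emeasure_space_1)
    also have "\<dots> \<le> ennreal (4 ^ j) * ennreal (4 / 16 ^ j) + ennreal (1 / 4 ^ j)"
    proof (intro add_mono mult_left_mono order_refl)
      have "2 / 16 ^ j + 2 / 16 ^ Suc j \<le> (4::real) / 16 ^ j" by (simp add: field_simps)
      then show "sqdist Q (J j) (J (Suc j)) \<le> ennreal (4 / 16 ^ j)"
        using order_trans[OF Cauchy[of j "Suc j"] ennreal_leI] by blast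
    qed simp
    also have "\<dots> = ennreal (4 ^ j * (4 / 16 ^ j) + 1 / 4 ^ j)"
      using ennreal_mult'[of "4 ^ j" "4 / 16 ^ j"] by (subst ennreal_plus) auto
    also have "(4::real) ^ j * (4 / 16 ^ j) + 1 / 4 ^ j = 5 * (1 / 4) ^ j"
    proof -
      have "(16::real) ^ j = 4 ^ j * 4 ^ j" by (simp flip: power_mult_distrib)
      then show ?thesis by (simp add: power_divide field_simps)
    qed
    finally show ?thesis .
  qed
  have "(\<integral>\<^sup>+x. (\<Sum>j. ennreal (Y j x)) \<partial>Q) = (\<Sum>j. \<integral>\<^sup>+x. ennreal (Y j x) \<partial>Q)"
    by (intro nn_integral_suminf) measurable
  also have "\<dots> \<le> (\<Sum>j. ennreal (5 * (1 / 4) ^ j))"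
    by (intro suminf_le Y) auto
  also have "\<dots> = ennreal (\<Sum>j. 5 * (1 / 4) ^ j)"
    by (intro suminf_ennreal2 summable_mult summable_geometric) auto
  finally have "(\<integral>\<^sup>+x. (\<Sum>j. ennreal (Y j x)) \<partial>Q) \<noteq> \<infinity>"
    by (auto simp: top_unique)
  then have "AE x in Q. (\<Sum>j. ennreal (Y j x)) \<noteq> \<infinity>"
    by (intro nn_integral_noteq_infinite) measurable
  then have conv: "AE x in Q. (\<lambda>j. J j x) \<longlonglongrightarrow> lim (\<lambda>j. J j x)"
  proof eventually_elim
    case (elim x)
    then have "summable (\<lambda>j. Y j x)"
      by (intro summable_suminf_not_top) (auto simp: Y_def)
    then have "summable (\<lambda>j. J (Suc j) x - J j x)"
      unfolding Y_def by (rule summable_rabs_cancel)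
    then have "convergent (\<lambda>n. \<Sum>j<n. J (Suc j) x - J j x)"
      by (simp add: summable_iff_convergent)
    then have "convergent (\<lambda>n. J n x - J 0 x)"
      by (simp add: sum_lessThan_telescope[of "\<lambda>j. J j x"])
    from convergent_add[OF this convergent_const[of "J 0 x"]] show ?case
      by (simp add: convergent_LIMSEQ_iff)
  qed
  \<comment> \<open>\<open>lim\<close> is total, so \<open>I\<close> is defined and measurable
    everywhere; the points where \<open>J j x\<close> diverges form a null set.\<close>
  define I where "I x = lim (\<lambda>j. J j x)" for x
  have I[measurable]: "I \<in> borel_measurable Q"
    unfolding I_def[abs_def] by (rule borel_measurable_lim_metric) measurable
  have bound: "sqdist Q (J i) I \<le> ennreal (4 / 16 ^ i)" for i
  proof -
    \<comment> \<open>The limit inside the integral is written as a liminf so that Fatou's lemma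
      applies; for j at least i the Cauchy bound is at most 4 / 16^i.\<close>
    have "sqdist Q (J i) I = (\<integral>\<^sup>+x. liminf (\<lambda>j. ennreal ((norm (J i x - J j x))\<^sup>2)) \<partial>Q)"
      unfolding sqdist_def
    proof (rule nn_integral_cong_AE, use conv in eventually_elim)
      case (elim x)
      have "(\<lambda>j. ennreal ((norm (J i x - J j x))\<^sup>2)) \<longlonglongrightarrow> ennreal ((norm (J i x - I x))\<^sup>2)"
        using elim unfolding I_def by (intro tendsto_intros)
      from lim_imp_Liminf[OF _ this] show ?case by simp
    qed
    also have "\<dots> \<le> liminf (\<lambda>j. sqdist Q (J i) (J j))"
      unfolding sqdist_def by (rule nn_integral_liminf) measurable
    also have "\<dots> \<le> liminf (\<lambda>j. ennreal (4 / 16 ^ i))"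
    proof (rule Liminf_mono)
      show "\<forall>\<^sub>F j in sequentially. sqdist Q (J i) (J j) \<le> ennreal (4 / 16 ^ i)"
        using eventually_ge_at_top[of i]
      proof eventually_elim
        case (elim j)
        then have "(16::real) ^ i \<le> 16 ^ j" by (intro power_increasing) auto
        then have "2 / 16 ^ j \<le> (2::real) / 16 ^ i" by (intro divide_left_mono) auto
        then have "2 / 16 ^ i + 2 / 16 ^ j \<le> (4::real) / 16 ^ i" by (simp add: field_simps)
        then show ?case using order_trans[OF Cauchy[of i j] ennreal_leI] by blast
      qed
    qed
    finally show ?thesis by (simp add: Liminf_const)
  qed
  have "(\<lambda>i. ennreal (4 * (1 / 16) ^ i)) \<longlonglongrightarrow> ennreal (4 * 0)"
    by (intro tendsto_ennrealI tendsto_intros LIMSEQ_power_zero) auto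
  then have "(\<lambda>i. ennreal (4 / 16 ^ i)) \<longlonglongrightarrow> 0" by (simp add: power_divide)
  then have "(\<lambda>i. sqdist Q (J i) I) \<longlonglongrightarrow> 0"
    by (rule tendsto_0_le_ennreal[OF bound])
  with I that show ?thesis by blast
qed

context brownian
begin

text \<open>Tonelli's theorem in the shape of the definitions, which integrate over time inside and
  over \<omega> outside, whereas time is the first coordinate of \<open>N\<close>.\<close>

lemma nn_integral_N_iterated:
  assumes "g \<in> borel_measurable N"
  shows "(\<integral>\<^sup>+\<omega>. (\<integral>\<^sup>+s\<in>{0..T}. g (s, \<omega>) \<partial>lborel) \<partial>P) = (\<integral>\<^sup>+x. g x \<partial>N)"
proof -
  have "(\<integral>\<^sup>+s\<in>{0..T}. g (s, \<omega>) \<partial>lborel) = (\<integral>\<^sup>+s. g (s, \<omega>) \<partial>L)" for \<omega>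
    by (rule nn_integral_restrict_space[symmetric]) simp
  then show ?thesis using N.nn_integral_snd[OF assms] by simp
qed

lemma sqdist_N_iterated:
  fixes f :: "real \<times> 'a \<Rightarrow> real^'m"
  assumes "f \<in> borel_measurable N" "case_prod \<rho> \<in> borel_measurable N"
  shows "(\<integral>\<^sup>+\<omega>. (\<integral>\<^sup>+s\<in>{0..T}. ennreal ((norm (f (s, \<omega>) - \<rho> s \<omega>))\<^sup>2) \<partial>lborel) \<partial>P) =
    sqdist N f (case_prod \<rho>)"
proof -
  have "(\<lambda>x. ennreal ((norm (f x - case_prod \<rho> x))\<^sup>2)) \<in> borel_measurable N"
    using borel_measurable_diff[OF assms]
    by (intro measurable_compose[OF _ measurable_ennreal] borel_measurable_power
        measurable_compose[OF _ borel_measurable_norm])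
  from nn_integral_N_iterated[OF this] show ?thesis by (simp add: sqdist_def)
qed

text \<open>Grid approximations with squared error at most 16^-j are chosen; the isometry turns
  their mutual distances into those of the step integrals, which therefore form a fast Cauchy
  sequence. The approximations and the limit are then the witnesses demanded by
  \<open>has_ito_integral\<close>.\<close>

lemma ito_integral_exists:
  assumes \<rho>: "predictable M T W \<rho>"
    and fin: "(\<integral>\<^sup>+\<omega>. (\<integral>\<^sup>+s\<in>{0..T}. ennreal ((norm (\<rho> s \<omega>))\<^sup>2) \<partial>lborel) \<partial>P) < \<infinity>"
  shows "\<exists>I. has_ito_integral M T W \<rho> I"
proof -
  have pm: "case_prod \<rho> \<in> borel_measurable predictable_space"
    using \<rho> by (simp add: predictable_def)
  have \<rho>m: "case_prod \<rho> \<in> borel_measurable N"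
    by (rule measurable_predictable_imp_N[OF pm])
  have "sqdist N (\<lambda>_. 0) (case_prod \<rho>) < \<infinity>"
    using fin sqdist_N_iterated[of "\<lambda>_. 0" \<rho>] \<rho>m by simp
  then have "approximable (case_prod \<rho>)"
    by (intro predictable_approximable pm) (simp add: sqdist_def)
  then have "\<exists>n h. (\<forall>k<Suc n. adapted_bounded (grid n k) (h k)) \<and>
      sqdist N (grid_process n h) (case_prod \<rho>) \<le> ennreal (1 / 16 ^ j)" for j
  proof -
    assume "approximable (case_prod \<rho>)"
    then have "\<forall>\<^sub>F n in sequentially. \<exists>h. (\<forall>k<Suc n. adapted_bounded (grid n k) (h k)) \<and>
      sqdist N (grid_process n h) (case_prod \<rho>) \<le> ennreal (1 / 16 ^ j)"
      by (simp add: approximable_def)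
    then show ?thesis unfolding eventually_sequentially by blast
  qed
  then obtain n h where h: "\<And>j k. k < Suc (n j) \<Longrightarrow> adapted_bounded (grid (n j) k) (h j k)"
    and le: "\<And>j. sqdist N (grid_process (n j) (h j)) (case_prod \<rho>) \<le> ennreal (1 / 16 ^ j)"
    by metis
  define J where "J j = elementary_integral W (Suc (n j)) (grid (n j)) (h j)" for j
  have ed: "elementary_data M T W (Suc (n j)) (grid (n j)) (h j)" for j
    by (rule elementary_data_grid[OF h])
  have Jm: "J j \<in> borel_measurable P" for j
    using elementary_integral_mean_zero(1)[OF ed[of j]] unfolding J_def by (rule borel_measurable_integrable)
  have "sqdist P (J i) (J j) \<le> ennreal (2 / 16 ^ i + 2 / 16 ^ j)" for i j
  proof -
    have "sqdist P (J i) (J j) = sqdist N (grid_process (n i) (h i)) (grid_process (n j) (h j))"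
      using elementary_isometry[OF ed[of i] ed[of j]]
      by (simp add: sqdist_def J_def grid_process_def case_prod_unfold)
    also have "\<dots> \<le> 2 * sqdist N (grid_process (n i) (h i)) (case_prod \<rho>) +
        2 * sqdist N (case_prod \<rho>) (grid_process (n j) (h j))"
      by (intro sqdist_triangle grid_process_measurable h \<rho>m)
    also have "\<dots> \<le> 2 * ennreal (1 / 16 ^ i) + 2 * ennreal (1 / 16 ^ j)"
      using le by (subst (2) sqdist_commute) (intro add_mono mult_left_mono, auto)
    also have "\<dots> = ennreal (2 / 16 ^ i + 2 / 16 ^ j)"
      using ennreal_mult'[of 2 "1 / 16 ^ i"] ennreal_mult'[of 2 "1 / 16 ^ j"]
      by (subst ennreal_plus) auto
    finally show ?thesis .
  qed
  then obtain I where I: "I \<in> borel_measurable P" "(\<lambda>j. sqdist P (J j) I) \<longlonglongrightarrow> 0"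
    using sqdist_fast_Cauchy_limit[of P J, OF P.prob_space_axioms Jm] by blast
  have "(\<lambda>j. ennreal (1 / 16 ^ j)) \<longlonglongrightarrow> ennreal 0"
    using LIMSEQ_power_zero[of "1 / 16 :: real"] by (intro tendsto_ennrealI) (simp add: power_divide)
  then have "(\<lambda>j. sqdist N (grid_process (n j) (h j)) (case_prod \<rho>)) \<longlonglongrightarrow> 0"
    using tendsto_0_le_ennreal[OF le] by simp
  moreover have "(\<integral>\<^sup>+\<omega>. (\<integral>\<^sup>+s\<in>{0..T}. ennreal ((norm (elementary_process (Suc (n j)) (grid (n j)) (h j) s \<omega> - \<rho> s \<omega>))\<^sup>2) \<partial>lborel) \<partial>P) =
      sqdist N (grid_process (n j) (h j)) (case_prod \<rho>)" for j
    using sqdist_N_iterated[OF grid_process_measurable[of "n j" "h j", OF h] \<rho>m]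
    by (simp add: grid_process_def)
  ultimately have "has_ito_integral M T W \<rho> I"
    unfolding has_ito_integral_def using I ed
    by (intro conjI exI[of _ "\<lambda>j. Suc (n j)"] exI[of _ "\<lambda>j. grid (n j)"] exI[of _ h])
       (simp_all add: sqdist_def J_def)
  then show ?thesis by blast
qed

text \<open>Stated for every \<open>I\<close> satisfying the definition, so that it applies to
  whichever version the choice operator returns and uniqueness never enters. A step integral
  \<open>J\<close> is centred, so the mean of \<open>I\<close> is minus that of the error
  \<open>D = J - I\<close>; the square of that mean is at most the second moment of
  \<open>D\<close>, which can be made arbitrarily small.\<close>

lemma ito_integral_mean_zero:
  assumes "has_ito_integral M T W \<rho> I"
  shows "integrable P I" and "(\<integral>\<omega>. I \<omega> \<partial>P) = 0"
proof -
  obtain n \<tau> h where I: "I \<in> borel_measurable P"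
    and ed: "\<And>j. elementary_data M T W (n j) (\<tau> j) (h j)"
    and lim: "(\<lambda>j::nat. \<integral>\<^sup>+\<omega>. ennreal ((elementary_integral W (n j) (\<tau> j) (h j) \<omega> - I \<omega>)\<^sup>2) \<partial>P) \<longlonglongrightarrow> 0"
    using assms unfolding has_ito_integral_def by blast
  have *: "integrable P I \<and> (\<integral>\<omega>. I \<omega> \<partial>P)\<^sup>2 \<le> e" if e: "0 < e" for e
  proof -
    have "\<forall>\<^sub>F j in sequentially.
        (\<integral>\<^sup>+\<omega>. ennreal ((elementary_integral W (n j) (\<tau> j) (h j) \<omega> - I \<omega>)\<^sup>2) \<partial>P) < ennreal e"
      using lim e by (intro order_tendstoD) auto
    then obtain j where j:
      "(\<integral>\<^sup>+\<omega>. ennreal ((elementary_integral W (n j) (\<tau> j) (h j) \<omega> - I \<omega>)\<^sup>2) \<partial>P) < ennreal e"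
      unfolding eventually_sequentially by blast
    define J where "J = elementary_integral W (n j) (\<tau> j) (h j)"
    define D where "D \<omega> = J \<omega> - I \<omega>" for \<omega>
    have J: "integrable P J" "(\<integral>\<omega>. J \<omega> \<partial>P) = 0"
      using elementary_integral_mean_zero[OF ed[of j]] by (simp_all add: J_def)
    have Dm: "D \<in> borel_measurable P"
      unfolding D_def[abs_def] using I J(1) by (intro borel_measurable_diff) auto
    have D2: "(\<integral>\<^sup>+\<omega>. ennreal ((D \<omega>)\<^sup>2) \<partial>P) < ennreal e" using j by (simp add: D_def J_def)
    have iD2: "integrable P (\<lambda>\<omega>. (D \<omega>)\<^sup>2)"
    proof (rule integrableI_bounded)
      show "(\<lambda>\<omega>. (D \<omega>)\<^sup>2) \<in> borel_measurable P" using Dm by (rule borel_measurable_power)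
      show "(\<integral>\<^sup>+ \<omega>. ennreal (norm ((D \<omega>)\<^sup>2)) \<partial>P) < \<infinity>" using less_trans[OF D2 ennreal_less_top] by simp
    qed
    then have iD: "integrable P D" by (rule P.square_integrable_imp_integrable[OF Dm])
    have "(\<integral>\<^sup>+\<omega>. ennreal ((D \<omega>)\<^sup>2) \<partial>P) = ennreal (\<integral>\<omega>. (D \<omega>)\<^sup>2 \<partial>P)"
      by (rule nn_integral_eq_integral[OF iD2]) simp
    then have "(\<integral>\<omega>. (D \<omega>)\<^sup>2 \<partial>P) \<le> e" using D2 e by (simp add: ennreal_less_iff)
    \<comment> \<open>Jensen's inequality for the square, read off from nonnegativity of the
      variance.\<close>
    moreover have "(\<integral>\<omega>. D \<omega> \<partial>P)\<^sup>2 \<le> (\<integral>\<omega>. (D \<omega>)\<^sup>2 \<partial>P)"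
      using P.variance_positive[of D] P.variance_eq[OF iD iD2] by simp
    moreover have eq: "I = (\<lambda>\<omega>. J \<omega> - D \<omega>)" by (simp add: D_def fun_eq_iff)
    have "integrable P I"
      by (subst eq) (rule Bochner_Integration.integrable_diff[OF J(1) iD])
    moreover have "(\<integral>\<omega>. I \<omega> \<partial>P) = - (\<integral>\<omega>. D \<omega> \<partial>P)"
      by (subst eq) (simp add: Bochner_Integration.integral_diff[OF J(1) iD] J(2))
    ultimately show ?thesis by simp
  qed
  from *[of 1] show "integrable P I" by simp
  have "(\<integral>\<omega>. I \<omega> \<partial>P)\<^sup>2 \<le> 0"
  proof (rule field_le_epsilon)
    fix e :: real assume "0 < e"
    from *[OF this] show "(\<integral>\<omega>. I \<omega> \<partial>P)\<^sup>2 \<le> 0 + e" by simp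
  qed
  then show "(\<integral>\<omega>. I \<omega> \<partial>P) = 0" by simp
qed

end

section \<open>Measurability of the market price of risk\<close>

lemma borel_measurable_vecI:
  fixes f :: "'a \<Rightarrow> real^'n"
  assumes "\<And>i. (\<lambda>x. f x $ i) \<in> borel_measurable Q"
  shows "f \<in> borel_measurable Q"
  using assms
  by (subst borel_measurable_euclidean_space) (auto simp: Basis_vec_def inner_axis)

lemma borel_measurable_det:
  fixes A :: "'a \<Rightarrow> real^'n^'n"
  assumes "\<And>i j. (\<lambda>x. A x $ i $ j) \<in> borel_measurable Q"
  shows "(\<lambda>x. det (A x)) \<in> borel_measurable Q"
  unfolding det_def
  by (intro borel_measurable_sum borel_measurable_times borel_measurable_const
      borel_measurable_prod assms)

lemma matrix_inv_mult_vec: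
  fixes A :: "real^'n^'n"
  assumes "det A \<noteq> 0"
  shows "A *v (matrix_inv A *v b) = b"
proof -
  have "\<exists>A'. A ** A' = mat 1 \<and> A' ** A = mat 1"
    using assms invertible_det_nz[of A] by (simp add: invertible_def)
  then have "A ** matrix_inv A = mat 1 \<and> matrix_inv A ** A = mat 1"
    unfolding matrix_inv_def by (rule someI_ex)
  then show ?thesis by (simp add: matrix_vector_mul_assoc)
qed

text \<open>For a singular matrix the predicate behind the choice in \<open>matrix_inv\<close> is
  identically false, so the choice no longer depends on the matrix.\<close>

lemma matrix_inv_singular:
  fixes A :: "real^'n^'n"
  assumes "det A = 0"
  shows "matrix_inv A = (SOME A'. False)"
proof -
  have "(\<lambda>A'. A ** A' = mat 1 \<and> A' ** A = mat 1) = (\<lambda>A'. False)"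
    using assms invertible_det_nz[of A] by (auto simp: invertible_def fun_eq_iff)
  then show ?thesis unfolding matrix_inv_def by (rule arg_cong)
qed

text \<open>Cramer's rule on the regular matrices; on the singular ones \<^const>\<open>matrix_inv\<close> is a
  fixed junk matrix, so measurability is not lost there.\<close>

lemma borel_measurable_matrix_inv_mult:
  fixes A :: "'a \<Rightarrow> real^'n^'n" and b :: "'a \<Rightarrow> real^'n"
  assumes A: "\<And>i j. (\<lambda>x. A x $ i $ j) \<in> borel_measurable Q"
    and b: "\<And>i. (\<lambda>x. b x $ i) \<in> borel_measurable Q"
  shows "(\<lambda>x. matrix_inv (A x) *v b x) \<in> borel_measurable Q"
proof (rule borel_measurable_vecI)
  fix k
  define Z :: "real^'n^'n" where "Z = (SOME A'. False)"
  have eq: "(matrix_inv (A x) *v b x) $ k =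
    (if det (A x) = 0 then \<Sum>j\<in>UNIV. Z $ k $ j * b x $ j
     else det (\<chi> i j. if j = k then b x $ i else A x $ i $ j) / det (A x))" for x
  proof (cases "det (A x) = 0")
    case True
    then show ?thesis
      by (simp add: matrix_inv_singular Z_def matrix_vector_mult_def)
  next
    case False
    then have "matrix_inv (A x) *v b x =
        (\<chi> k. det (\<chi> i j. if j = k then b x $ i else A x $ i $ j) / det (A x))"
      using cramer[OF False] matrix_inv_mult_vec[OF False] by blast
    then show ?thesis using False by (simp only: if_False vec_lambda_beta)
  qed
  have D: "(\<lambda>x. det (A x)) \<in> borel_measurable Q" by (rule borel_measurable_det[OF A])
  have "(\<lambda>x. det (\<chi> i j. if j = k then b x $ i else A x $ i $ j)) \<in> borel_measurable Q"
  proof (rule borel_measurable_det)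
    fix i j
    show "(\<lambda>x. (\<chi> i j. if j = k then b x $ i else A x $ i $ j) $ i $ j) \<in> borel_measurable Q"
      using A[of i j] b[of i] by (cases "j = k") simp_all
  qed
  then show "(\<lambda>x. (matrix_inv (A x) *v b x) $ k) \<in> borel_measurable Q"
    unfolding eq using D b
    by (intro measurable_If borel_measurable_sum borel_measurable_times borel_measurable_const
        borel_measurable_divide) auto
qed

lemma borel_measurable_vector_matrix_mult:
  fixes A :: "'a \<Rightarrow> real^'m^'n" and v :: "'a \<Rightarrow> real^'n"
  assumes "A \<in> borel_measurable Q" "v \<in> borel_measurable Q"
  shows "(\<lambda>x. v x v* A x) \<in> borel_measurable Q"
  by (rule borel_measurable_vecI, unfold vector_matrix_mult_def vec_lambda_beta)
    (intro borel_measurable_sum borel_measurable_times borel_measurable_vec_nth assms)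

lemma borel_measurable_gram_nth:
  fixes A :: "'a \<Rightarrow> real^'m^'n"
  assumes "A \<in> borel_measurable Q"
  shows "(\<lambda>x. (A x ** transpose (A x)) $ i $ j) \<in> borel_measurable Q"
  unfolding matrix_matrix_mult_def transpose_def vec_lambda_beta
  by (intro borel_measurable_sum borel_measurable_times borel_measurable_vec_nth assms)

text \<open>Through this identity the Loewner bounds on the Gram matrix become two-sided bounds on
  how much \<open>A\<close> stretches row vectors.\<close>

lemma gram_inner: "v \<bullet> ((A ** transpose A) *v v) = (norm (v v* A))\<^sup>2" for A :: "real^'m^'n"
proof -
  have "v \<bullet> ((A ** transpose A) *v v) = v \<bullet> (A *v (v v* A))"
    by (simp flip: matrix_vector_mul_assoc)
  also have "\<dots> = (v v* A) \<bullet> (v v* A)" by (rule dot_lmul_matrix[symmetric])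
  finally show ?thesis by (simp add: power2_norm_eq_inner)
qed

lemma loewner_le_mat_gram:
  fixes A :: "real^'m^'n"
  assumes "loewner_le (mat \<epsilon>) (A ** transpose A)"
  shows "\<epsilon> * (norm v)\<^sup>2 \<le> (norm (v v* A))\<^sup>2"
proof -
  have "(mat \<epsilon> :: real^'n^'n) *v v = \<epsilon> *\<^sub>R v"
    by (simp add: mat_def matrix_vector_mult_def vec_eq_iff if_distrib[of "\<lambda>x. x * _"] cong: if_cong)
  moreover have "0 \<le> v \<bullet> ((A ** transpose A - mat \<epsilon>) *v v)"
    using assms by (simp add: loewner_le_def)
  ultimately show ?thesis
    unfolding matrix_vector_mult_diff_rdistrib inner_diff_right gram_inner
    by (simp add: power2_norm_eq_inner)
qed

lemma loewner_le_gram_mat: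
  fixes A :: "real^'m^'n"
  assumes "loewner_le (A ** transpose A) (mat K)"
  shows "(norm (v v* A))\<^sup>2 \<le> K * (norm v)\<^sup>2"
proof -
  have "(mat K :: real^'n^'n) *v v = K *\<^sub>R v"
    by (simp add: mat_def matrix_vector_mult_def vec_eq_iff if_distrib[of "\<lambda>x. x * _"] cong: if_cong)
  moreover have "0 \<le> v \<bullet> ((mat K - A ** transpose A) *v v)"
    using assms by (simp add: loewner_le_def)
  ultimately show ?thesis
    unfolding matrix_vector_mult_diff_rdistrib inner_diff_right gram_inner
    by (simp add: power2_norm_eq_inner)
qed

text \<open>A kernel vector v of the Gram matrix has \<open>v v* A\<close> of length 0, and the
  lower bound with positive \<epsilon> then forces v = 0.\<close>

lemma gram_det_nonzero:
  fixes A :: "real^'m^'n"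
  assumes "0 < \<epsilon>" "loewner_le (mat \<epsilon>) (A ** transpose A)"
  shows "det (A ** transpose A) \<noteq> 0"
proof -
  have "v = 0" if "(A ** transpose A) *v v = 0" for v
  proof -
    have "(norm (v v* A))\<^sup>2 = 0" using gram_inner[of v A] that by simp
    then have "\<epsilon> * (norm v)\<^sup>2 \<le> 0" using loewner_le_mat_gram[OF assms(2), of v] by simp
    then show ?thesis using assms(1) by (simp add: mult_le_0_iff)
  qed
  then have "\<exists>B. B ** (A ** transpose A) = mat 1"
    unfolding matrix_left_invertible_ker by blast
  then show ?thesis
    using invertible_det_nz[of "A ** transpose A"] invertible_left_inverse by blast
qed

text \<open>Applying \<open>A\<close> to both sides of \<open>v v* A = w v* A\<close> brings in the
  regular Gram matrix. Injectivity is what later makes the image of the closed set \<open>C\<close>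
  closed.\<close>

lemma vector_matrix_mult_injective:
  fixes A :: "real^'m^'n"
  assumes "det (A ** transpose A) \<noteq> 0"
  shows "inj (\<lambda>v. v v* A)"
proof (rule injI)
  fix v w assume "v v* A = w v* A"
  then have "(A ** transpose A) *v v = (A ** transpose A) *v w"
    by (simp flip: matrix_vector_mul_assoc)
  moreover have "inj ((*v) (A ** transpose A))"
    using assms invertible_det_nz inj_matrix_vector_mult by blast
  ultimately show "v = w" by (auto dest: injD)
qed

lemma linear_vector_matrix_mult: "linear (\<lambda>v. v v* A)" for A :: "real^'m^'n"
  using matrix_vector_mul_linear[of "transpose A"] by simp

text \<open>With w the solution of the Gram system, the squared norm on the left equals the inner
  product of w and b. The lower bound gives \<epsilon> |w|^2 \<le> |w| |b|, hence |w| \<le> |b| /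
  \<epsilon>, and Cauchy-Schwarz gives the claim. The uniform bound on the market price of risk
  rests on this.\<close>

lemma norm_market_price_of_risk_le:
  fixes A :: "real^'m^'n"
  assumes \<epsilon>: "0 < \<epsilon>" "loewner_le (mat \<epsilon>) (A ** transpose A)"
  shows "(norm (transpose A *v (matrix_inv (A ** transpose A) *v b)))\<^sup>2 \<le> (norm b)\<^sup>2 / \<epsilon>"
proof -
  define w where "w = matrix_inv (A ** transpose A) *v b"
  have w: "(A ** transpose A) *v w = b"
    unfolding w_def by (rule matrix_inv_mult_vec[OF gram_det_nonzero[OF \<epsilon>]])
  have 1: "(norm (w v* A))\<^sup>2 = w \<bullet> b" using gram_inner[of w A] w by simp
  have 2: "\<epsilon> * (norm w)\<^sup>2 \<le> norm w * norm b"
    using loewner_le_mat_gram[OF \<epsilon>(2), of w] 1 norm_cauchy_schwarz[of w b] by linarith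
  have 3: "\<epsilon> * norm w \<le> norm b"
  proof (cases "norm w = 0")
    case False
    then have "0 < norm w" by simp
    moreover have "norm w * (\<epsilon> * norm w) \<le> norm w * norm b"
      using 2 by (simp add: power2_eq_square mult_ac)
    ultimately show ?thesis by (simp only: mult_le_cancel_left_pos)
  qed simp
  have "(norm (w v* A))\<^sup>2 \<le> norm w * norm b" using 1 norm_cauchy_schwarz[of w b] by simp
  also have "\<dots> \<le> (norm b / \<epsilon>) * norm b"
    using 3 \<epsilon>(1) by (intro mult_right_mono) (auto simp: field_simps)
  finally show ?thesis by (simp add: w_def power2_eq_square)
qed

section \<open>Measurable selection of a point of minimal norm\<close>

text \<open>Measurability of a set-valued map, tested on closed sets. Closed tests stay closed when
  intersected with sublevel sets of continuous functions, which the minimisation steps need; for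
  singleton values the condition is Borel measurability.\<close>

definition hit_measurable :: "'a measure \<Rightarrow> ('a \<Rightarrow> 'b::topological_space set) \<Rightarrow> bool" where
  "hit_measurable Q \<Phi> \<longleftrightarrow> (\<forall>K. closed K \<longrightarrow> {x \<in> space Q. \<Phi> x \<inter> K \<noteq> {}} \<in> sets Q)"

definition argmins :: "('b \<Rightarrow> real) \<Rightarrow> 'b set \<Rightarrow> 'b set" where
  "argmins g S = {y \<in> S. \<forall>z\<in>S. g y \<le> g z}"

lemma argmins_subset: "argmins g S \<subseteq> S"
  by (auto simp: argmins_def)

text \<open>It suffices to minimise over the compact sublevel set through an arbitrary point of
  \<open>S\<close>; the minimisers are then the sublevel set at the minimal value, hence
  compact.\<close>

lemma argmins_nonempty_compact:
  fixes g :: "'b::topological_space \<Rightarrow> real"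
  assumes S: "S \<noteq> {}" and cpt: "\<And>r. compact (S \<inter> {y. g y \<le> r})" and g: "continuous_on UNIV g"
  shows "argmins g S \<noteq> {}" "compact (argmins g S)"
proof -
  obtain y0 where y0: "y0 \<in> S" using S by blast
  have "\<exists>y\<in>S \<inter> {y. g y \<le> g y0}. \<forall>z\<in>S \<inter> {y. g y \<le> g y0}. g y \<le> g z"
    using y0 continuous_on_subset[OF g]
    by (intro continuous_attains_inf[OF cpt]) auto
  then obtain y where y: "y \<in> S" "g y \<le> g y0" "\<And>z. z \<in> S \<Longrightarrow> g z \<le> g y0 \<Longrightarrow> g y \<le> g z" by blast
  then have "g y \<le> g z" if "z \<in> S" for z using that by (cases "g z \<le> g y0") force+
  with y have yy: "y \<in> argmins g S" by (auto simp: argmins_def)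
  then show "argmins g S \<noteq> {}" by blast
  have "argmins g S = S \<inter> {z. g z \<le> g y}"
    using yy by (auto simp: argmins_def intro: order_trans)
  then show "compact (argmins g S)" using cpt by simp
qed

text \<open>A minimiser lies in \<open>K\<close> exactly if, for every rational q,
  \<open>\<Phi> x \<inter> K\<close> meets the sublevel set of \<open>g\<close> at q as soon as
  \<open>\<Phi> x\<close> does. These are countably many hitting events of closed sets. Compactness
  serves the converse direction, where the infimum over \<open>K\<close> must be attained.\<close>

lemma hit_measurable_argmins:
  fixes \<Phi> :: "'a \<Rightarrow> 'b::t2_space set"
  assumes hit: "hit_measurable Q \<Phi>" and g: "continuous_on UNIV g"
    and ne: "\<And>x. x \<in> space Q \<Longrightarrow> \<Phi> x \<noteq> {}"
    and cpt: "\<And>x r. x \<in> space Q \<Longrightarrow> compact (\<Phi> x \<inter> {y. g y \<le> r})"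
  shows "hit_measurable Q (\<lambda>x. argmins g (\<Phi> x))"
  unfolding hit_measurable_def
proof (intro allI impI)
  fix K :: "'b set" assume K: "closed K"
  define A where "A q = {x \<in> space Q. \<Phi> x \<inter> {y. g y \<le> q} \<noteq> {}}" for q
  define B where "B q = {x \<in> space Q. \<Phi> x \<inter> (K \<inter> {y. g y \<le> q}) \<noteq> {}}" for q
  have cl: "closed {y. g y \<le> q}" for q
    using closed_Collect_le[OF g, of "\<lambda>_. q"] by simp
  have AB: "A q \<in> sets Q" "B q \<in> sets Q" for q
    using hit cl[of q] closed_Int[OF K cl[of q]] unfolding A_def B_def hit_measurable_def by blast+
  have "{x \<in> space Q. argmins g (\<Phi> x) \<inter> K \<noteq> {}} = (\<Inter>q\<in>\<rat>. (space Q - A q) \<union> B q)"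
  proof (intro equalityI subsetI)
    fix x assume "x \<in> {x \<in> space Q. argmins g (\<Phi> x) \<inter> K \<noteq> {}}"
    then obtain y where y: "x \<in> space Q" "y \<in> \<Phi> x" "\<And>z. z \<in> \<Phi> x \<Longrightarrow> g y \<le> g z" "y \<in> K"
      by (auto simp: argmins_def)
    show "x \<in> (\<Inter>q\<in>\<rat>. (space Q - A q) \<union> B q)"
    proof
      fix q :: real
      show "x \<in> (space Q - A q) \<union> B q"
      proof (cases "x \<in> A q")
        case True
        then obtain z where "z \<in> \<Phi> x" "g z \<le> q" by (auto simp: A_def)
        then have "g y \<le> q" using y(3)[of z] by linarith
        then show ?thesis using y by (auto simp: B_def)
      qed (use y in auto)
    qed
  next
    fix x assume x: "x \<in> (\<Inter>q\<in>\<rat>. (space Q - A q) \<union> B q)"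
    then have "x \<in> (space Q - A 0) \<union> B 0" using Rats_0 by blast
    then have xs: "x \<in> space Q" by (auto simp: B_def)
    obtain y0 where y0: "y0 \<in> \<Phi> x" "\<And>z. z \<in> \<Phi> x \<Longrightarrow> g y0 \<le> g z"
      using argmins_nonempty_compact(1)[OF ne[OF xs] cpt[OF xs] g] by (auto simp: argmins_def)
    have ex: "\<exists>z\<in>\<Phi> x \<inter> K. g z \<le> q" if "q \<in> \<rat>" "g y0 < q" for q
    proof -
      have "x \<in> A q" using y0 that xs by (auto simp: A_def)
      then have "x \<in> B q" using x that(1) by blast
      then show ?thesis by (auto simp: B_def)
    qed
    \<comment> \<open>A rational level above the minimum cuts the search for a minimiser in
      \<open>K\<close> down to a compact set, nonempty by \<open>ex\<close>.\<close>
    obtain q0 where q0: "q0 \<in> \<rat>" "g y0 < q0"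
      using Rats_dense_in_real[of "g y0" "g y0 + 1"] by auto
    let ?S = "\<Phi> x \<inter> {y. g y \<le> q0} \<inter> K"
    have "\<exists>y\<in>?S. \<forall>z\<in>?S. g y \<le> g z"
      using ex[OF q0] continuous_on_subset[OF g]
      by (intro continuous_attains_inf compact_Int_closed[OF cpt[OF xs] K]) auto
    then obtain y1 where y1: "y1 \<in> ?S" "\<And>z. z \<in> ?S \<Longrightarrow> g y1 \<le> g z" by blast
    \<comment> \<open>Otherwise a rational level strictly between the two minima would be reached on
      \<open>\<Phi> x\<close> but not on \<open>\<Phi> x \<inter> K\<close>.\<close>
    have "g y1 \<le> g y0"
    proof (rule ccontr)
      assume "\<not> g y1 \<le> g y0"
      then obtain q where q: "q \<in> \<rat>" "g y0 < q" "q < min (g y1) q0"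
        using Rats_dense_in_real[of "g y0" "min (g y1) q0"] q0 by auto
      then obtain z where "z \<in> \<Phi> x \<inter> K" "g z \<le> q" using ex by blast
      then show False using y1(2)[of z] q by auto
    qed
    then have "y1 \<in> argmins g (\<Phi> x)"
      using y1(1) y0(2) by (force simp: argmins_def)
    then show "x \<in> {x \<in> space Q. argmins g (\<Phi> x) \<inter> K \<noteq> {}}" using y1(1) xs by auto
  qed
  moreover have "(\<Inter>q\<in>\<rat>. (space Q - A q) \<union> B q) \<in> sets Q"
    using AB countable_rat Rats_0 by (intro sets.countable_INT') auto
  ultimately show "{x \<in> space Q. argmins g (\<Phi> x) \<inter> K \<noteq> {}} \<in> sets Q" by simp
qed

section \<open>Minimising several functions in turn\<close>

fun lex_argmins :: "('b \<Rightarrow> real) list \<Rightarrow> 'b set \<Rightarrow> 'b set" where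
  "lex_argmins [] S = S"
| "lex_argmins (g # gs) S = lex_argmins gs (argmins g S)"

lemma lex_argmins_subset: "lex_argmins gs S \<subseteq> S"
  by (induction gs arbitrary: S) (use argmins_subset in fastforce)+

text \<open>A function is constant on the minimisers of its own stage, and later stages only shrink
  the set. Applied to all coordinates, this leaves at most one point.\<close>

lemma lex_argmins_constant:
  assumes "g \<in> set gs" "y \<in> lex_argmins gs S" "z \<in> lex_argmins gs S"
  shows "g y = g z"
  using assms
proof (induction gs arbitrary: S)
  case (Cons h gs)
  show ?case
  proof (cases "g = h")
    case True
    have "y \<in> argmins g S" "z \<in> argmins g S"
      using Cons.prems lex_argmins_subset True by fastforce+
    then show ?thesis by (auto simp: argmins_def intro: order_antisym)
  qed (use Cons in auto)
qed simp

lemma lex_argmins_compact: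
  fixes S :: "'b::t2_space set"
  assumes "compact S" "S \<noteq> {}" "\<And>g. g \<in> set gs \<Longrightarrow> continuous_on UNIV g"
  shows "compact (lex_argmins gs S) \<and> lex_argmins gs S \<noteq> {}"
  using assms
proof (induction gs arbitrary: S)
  case (Cons g gs)
  have g: "continuous_on UNIV g" using Cons.prems by simp
  have "compact (S \<inter> {y. g y \<le> r})" for r
    using compact_Int_closed[OF Cons.prems(1) closed_Collect_le[OF g, of "\<lambda>_. r"]] by simp
  from argmins_nonempty_compact[OF Cons.prems(2) this g] show ?case
    using Cons by simp
qed simp

lemma hit_measurable_lex_argmins:
  fixes \<Phi> :: "'a \<Rightarrow> 'b::t2_space set"
  assumes "hit_measurable Q \<Phi>" "\<And>x. x \<in> space Q \<Longrightarrow> compact (\<Phi> x)"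
    "\<And>x. x \<in> space Q \<Longrightarrow> \<Phi> x \<noteq> {}" "\<And>g. g \<in> set gs \<Longrightarrow> continuous_on UNIV g"
  shows "hit_measurable Q (\<lambda>x. lex_argmins gs (\<Phi> x))"
  using assms
proof (induction gs arbitrary: \<Phi>)
  case (Cons g gs)
  have g: "continuous_on UNIV g" using Cons.prems by simp
  have cpt: "compact (\<Phi> x \<inter> {y. g y \<le> r})" if "x \<in> space Q" for x r
    using compact_Int_closed[OF Cons.prems(2)[OF that] closed_Collect_le[OF g, of "\<lambda>_. r"]] by simp
  have "hit_measurable Q (\<lambda>x. argmins g (\<Phi> x))"
    by (rule hit_measurable_argmins[OF Cons.prems(1) g Cons.prems(3) cpt])
  then show ?case
    using argmins_nonempty_compact[OF Cons.prems(3) cpt g] Cons.prems(4)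
    by (simp add: Cons.IH)
qed simp

text \<open>Among the points of minimal norm the lexicographically smallest one is selected.\<close>

lemma measurable_norm_minimizer:
  fixes \<Phi> :: "'a \<Rightarrow> 'b::euclidean_space set"
  assumes hit: "hit_measurable Q \<Phi>" and cl: "\<And>x. x \<in> space Q \<Longrightarrow> closed (\<Phi> x)"
    and ne: "\<And>x. x \<in> space Q \<Longrightarrow> \<Phi> x \<noteq> {}"
  obtains f where "f \<in> borel_measurable Q"
    "\<And>x. x \<in> space Q \<Longrightarrow> f x \<in> \<Phi> x" "\<And>x y. x \<in> space Q \<Longrightarrow> y \<in> \<Phi> x \<Longrightarrow> norm (f x) \<le> norm y"
proof -
  obtain bs :: "'b list" where bs: "set bs = Basis" using finite_list[OF finite_Basis] by blast
  define gs :: "('b \<Rightarrow> real) list" where "gs = map (\<lambda>b y. y \<bullet> b) bs"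
  have gs: "continuous_on UNIV g" if "g \<in> set gs" for g
    using that by (auto simp: gs_def intro!: continuous_intros)
  define \<Psi> where "\<Psi> x = argmins norm (\<Phi> x)" for x
  have n: "continuous_on UNIV (norm :: 'b \<Rightarrow> real)" by (intro continuous_intros)
  have cpt: "compact (\<Phi> x \<inter> {y. norm y \<le> r})" if "x \<in> space Q" for x r
  proof -
    have "{y :: 'b. norm y \<le> r} = cball 0 r" by (auto simp: mem_cball_0)
    then show ?thesis using closed_Int_compact[OF cl[OF that] compact_cball[of 0 r]] by simp
  qed
  have \<Psi>1: "hit_measurable Q \<Psi>"
    unfolding \<Psi>_def[abs_def] by (rule hit_measurable_argmins[OF hit n ne cpt])
  have \<Psi>2: "compact (\<Psi> x)" "\<Psi> x \<noteq> {}" if "x \<in> space Q" for x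
    unfolding \<Psi>_def using argmins_nonempty_compact[OF ne[OF that] cpt[OF that] n] by blast+
  define \<Theta> where "\<Theta> x = lex_argmins gs (\<Psi> x)" for x
  have \<Theta>1: "hit_measurable Q \<Theta>"
    unfolding \<Theta>_def[abs_def] by (rule hit_measurable_lex_argmins[OF \<Psi>1 \<Psi>2 gs])
  have \<Theta>2: "\<Theta> x \<noteq> {}" if "x \<in> space Q" for x
    unfolding \<Theta>_def using lex_argmins_compact[OF \<Psi>2[OF that] gs] by blast
  have \<Theta>3: "y = z" if "y \<in> \<Theta> x" "z \<in> \<Theta> x" for x y z
  proof (rule euclidean_eqI)
    fix b :: 'b assume "b \<in> Basis"
    then have "(\<lambda>y. y \<bullet> b) \<in> set gs" by (auto simp: gs_def bs)
    from lex_argmins_constant[OF this that[unfolded \<Theta>_def]] show "y \<bullet> b = z \<bullet> b" .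
  qed
  define f where "f x = (SOME y. y \<in> \<Theta> x)" for x
  have f: "f x \<in> \<Theta> x" if "x \<in> space Q" for x
    unfolding f_def using \<Theta>2[OF that] some_in_eq by blast
  \<comment> \<open>Since each \<open>\<Theta> x\<close> is a single point, the choice in
    \<open>f\<close> is forced, and preimages under \<open>f\<close> are hitting events.\<close>
  have fx: "f -` K \<inter> space Q = {x \<in> space Q. \<Theta> x \<inter> K \<noteq> {}}" for K
    using f \<Theta>3 by blast
  have fm: "f \<in> borel_measurable Q"
  proof (rule borel_measurableI)
    fix S :: "'b set" assume "open S"
    then have "f -` (- S) \<inter> space Q \<in> sets Q"
      using \<Theta>1 unfolding fx hit_measurable_def by (simp add: closed_def)
    then have "space Q - (f -` (- S) \<inter> space Q) \<in> sets Q" by (rule sets.compl_sets)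
    moreover have "space Q - (f -` (- S) \<inter> space Q) = f -` S \<inter> space Q" by blast
    ultimately show "f -` S \<inter> space Q \<in> sets Q" by simp
  qed
  have f\<Psi>: "f x \<in> \<Psi> x" if "x \<in> space Q" for x
    using subsetD[OF lex_argmins_subset f[OF that, unfolded \<Theta>_def]] .
  have "f x \<in> \<Phi> x" if "x \<in> space Q" for x
    using f\<Psi>[OF that] by (simp add: \<Psi>_def argmins_def)
  moreover have "norm (f x) \<le> norm y" if "x \<in> space Q" "y \<in> \<Phi> x" for x y
    using f\<Psi>[OF that(1)] that(2) by (simp add: \<Psi>_def argmins_def)
  ultimately show ?thesis using that[OF fm] by blast
qed

text \<open>\<open>C\<close> is exhausted by the compact pieces \<open>E m\<close>. On such a piece
  the distance of \<open>\<psi> x c\<close> to \<open>K\<close> attains its infimum, so some point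
  of the piece is mapped into \<open>K\<close> exactly if distances below every 1 / (k + 1) occur,
  and by continuity it is enough to look for them on a countable dense subset.\<close>

lemma hit_measurable_parametrized:
  fixes \<psi> :: "'a \<Rightarrow> 'c::euclidean_space \<Rightarrow> 'b::metric_space" and C :: "'c set"
  assumes C: "closed C" and meas: "\<And>c. (\<lambda>x. \<psi> x c) \<in> borel_measurable Q"
    and cont: "\<And>x. continuous_on UNIV (\<psi> x)"
  shows "hit_measurable Q (\<lambda>x. \<psi> x ` C)"
  unfolding hit_measurable_def
proof (intro allI impI)
  fix K :: "'b set" assume K: "closed K"
  show "{x \<in> space Q. \<psi> x ` C \<inter> K \<noteq> {}} \<in> sets Q"
  \<comment> \<open>\<open>infdist\<close> to the empty set is 0 by convention, so an empty
    \<open>K\<close> has to be excluded before distance 0 can mean membership.\<close>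
  proof (cases "K = {}")
    case False
    define E where "E m = C \<inter> cball 0 (real m)" for m
    have E: "compact (E m)" for m
      unfolding E_def by (intro closed_Int_compact C compact_cball)
    have "\<forall>m. \<exists>D. countable D \<and> D \<subseteq> E m \<and> E m \<subseteq> closure D"
    proof
      fix m
      obtain D where "countable D" "D \<subseteq> E m" "E m \<subseteq> closure D" by (rule separable)
      then show "\<exists>D. countable D \<and> D \<subseteq> E m \<and> E m \<subseteq> closure D" by blast
    qed
    then obtain D where D: "\<And>m. countable (D m)" "\<And>m. D m \<subseteq> E m" "\<And>m. E m \<subseteq> closure (D m)"
      by metis
    define A where "A d k = {x \<in> space Q. infdist (\<psi> x d) K < 1 / real (Suc k)}" for d k
    have "(\<lambda>x. infdist (\<psi> x d) K) \<in> borel_measurable Q" for d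
      by (rule measurable_compose[OF meas borel_measurable_continuous_onI])
        (intro continuous_intros)
    then have A: "A d k \<in> sets Q" for d k
      unfolding A_def by (rule borel_measurable_less) simp
    have "{x \<in> space Q. \<psi> x ` C \<inter> K \<noteq> {}} = (\<Union>m. \<Inter>k. \<Union>d\<in>D m. A d k)"
    proof (intro equalityI subsetI)
      fix x assume "x \<in> {x \<in> space Q. \<psi> x ` C \<inter> K \<noteq> {}}"
      then obtain c where c: "x \<in> space Q" "c \<in> C" "\<psi> x c \<in> K" by auto
      obtain m :: nat where "norm c \<le> real m" using real_arch_simple by blast
      then have cm: "c \<in> closure (D m)" using c D(3)[of m] by (auto simp: E_def)
      have "x \<in> (\<Union>d\<in>D m. A d k)" for k
      proof -
        let ?U = "{d. infdist (\<psi> x d) K < 1 / real (Suc k)}"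
        have "open ?U"
          by (intro open_Collect_less continuous_intros cont)
        moreover have "c \<in> ?U" using c by simp
        ultimately have "?U \<inter> D m \<noteq> {}"
          using cm open_Int_closure_eq_empty[of ?U "D m"] by blast
        then show ?thesis using c(1) by (auto simp: A_def)
      qed
      then show "x \<in> (\<Union>m. \<Inter>k. \<Union>d\<in>D m. A d k)" by blast
    next
      fix x assume "x \<in> (\<Union>m. \<Inter>k. \<Union>d\<in>D m. A d k)"
      then obtain m where m: "\<And>k. x \<in> (\<Union>d\<in>D m. A d k)" by blast
      then have xs: "x \<in> space Q" by (auto simp: A_def)
      have ex: "\<exists>d\<in>E m. infdist (\<psi> x d) K < 1 / real (Suc k)" for k
        using m[of k] D(2)[of m] by (auto simp: A_def)
      have "continuous_on (E m) (\<lambda>d. infdist (\<psi> x d) K)"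
        by (intro continuous_intros continuous_on_subset[OF cont]) auto
      then have "\<exists>c\<in>E m. \<forall>d\<in>E m. infdist (\<psi> x c) K \<le> infdist (\<psi> x d) K"
        using ex[of 0] by (intro continuous_attains_inf E) auto
      then obtain c where c: "c \<in> E m" "\<And>d. d \<in> E m \<Longrightarrow> infdist (\<psi> x c) K \<le> infdist (\<psi> x d) K"
        by blast
      have "infdist (\<psi> x c) K < 1 / real (Suc k)" for k
        using ex[of k] c(2) by force
      then have "infdist (\<psi> x c) K \<le> 0"
        using nat_approx_posE[of "infdist (\<psi> x c) K"] by (meson not_le less_trans less_irrefl)
      then have "\<psi> x c \<in> K"
        using in_closed_iff_infdist_zero[OF K False] infdist_nonneg[of "\<psi> x c" K] by fastforce
      then show "x \<in> {x \<in> space Q. \<psi> x ` C \<inter> K \<noteq> {}}" using c(1) xs by (auto simp: E_def)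
    qed
    moreover have "(\<Union>m. \<Inter>k. \<Union>d\<in>D m. A d k) \<in> sets Q"
      using A D(1) by (intro sets.countable_UN sets.countable_INT sets.countable_UN' image_subsetI) auto
    ultimately show ?thesis by simp
  qed simp
qed

section \<open>Optimality\<close>

lemma hit_measurable_If:
  fixes \<Phi> \<Psi> :: "'a \<Rightarrow> 'b::topological_space set"
  assumes "hit_measurable Q \<Phi>" "hit_measurable Q \<Psi>" and R: "{x \<in> space Q. R x} \<in> sets Q"
  shows "hit_measurable Q (\<lambda>x. if R x then \<Phi> x else \<Psi> x)"
  unfolding hit_measurable_def
proof (intro allI impI)
  fix K :: "'b set" assume K: "closed K"
  have "{x \<in> space Q. (if R x then \<Phi> x else \<Psi> x) \<inter> K \<noteq> {}} =
    ({x \<in> space Q. R x} \<inter> {x \<in> space Q. \<Phi> x \<inter> K \<noteq> {}}) \<union>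
    ({x \<in> space Q. \<Psi> x \<inter> K \<noteq> {}} - {x \<in> space Q. R x})"
    by (auto split: if_splits)
  moreover have "{x \<in> space Q. \<Phi> x \<inter> K \<noteq> {}} \<in> sets Q" "{x \<in> space Q. \<Psi> x \<inter> K \<noteq> {}} \<in> sets Q"
    using assms(1,2) K by (auto simp: hit_measurable_def)
  ultimately show "{x \<in> space Q. (if R x then \<Phi> x else \<Psi> x) \<inter> K \<noteq> {}} \<in> sets Q"
    using R by auto
qed

lemma hit_measurable_const: "hit_measurable Q (\<lambda>x. S)"
  unfolding hit_measurable_def
proof (intro allI impI)
  fix K
  show "{x \<in> space Q. S \<inter> K \<noteq> {}} \<in> sets Q" by (cases "S \<inter> K = {}") auto
qed

text \<open>The distance is below r exactly if the shifted set meets a ball around 0 of some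
  rational radius q < r. The shift by \<open>a x\<close> turns a moving ball into a fixed closed
  test set.\<close>

lemma borel_measurable_infdist_hit:
  fixes a :: "'a \<Rightarrow> 'b::euclidean_space"
  assumes hit: "hit_measurable Q (\<lambda>x. (\<lambda>z. z - a x) ` S x)" and ne: "\<And>x. S x \<noteq> {}"
  shows "(\<lambda>x. infdist (a x) (S x)) \<in> borel_measurable Q"
proof (rule borel_measurableI_less)
  fix r :: real
  define A where "A q = {x \<in> space Q. (\<lambda>z. z - a x) ` S x \<inter> cball 0 q \<noteq> {}}" for q
  have "{x \<in> space Q. infdist (a x) (S x) < r} = (\<Union>q\<in>{q\<in>\<rat>. q < r}. A q)"
  proof (intro equalityI subsetI)
    fix x assume "x \<in> {x \<in> space Q. infdist (a x) (S x) < r}"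
    then have x: "x \<in> space Q" "(INF z\<in>S x. dist (a x) z) < r"
      using infdist_notempty[OF ne] by auto
    then obtain z where z: "z \<in> S x" "dist (a x) z < r"
      using cInf_lessD[of "dist (a x) ` S x" r] ne by auto
    then obtain q where "q \<in> \<rat>" "dist (a x) z < q" "q < r"
      using Rats_dense_in_real by blast
    then show "x \<in> (\<Union>q\<in>{q\<in>\<rat>. q < r}. A q)"
      using x z by (intro UN_I[of q]) (auto simp: A_def dist_norm norm_minus_commute intro!: bexI[of _ z])
  next
    fix x assume "x \<in> (\<Union>q\<in>{q\<in>\<rat>. q < r}. A q)"
    then obtain q z where "q < r" "x \<in> space Q" "z \<in> S x" "norm (z - a x) \<le> q"
      by (auto simp: A_def)
    then show "x \<in> {x \<in> space Q. infdist (a x) (S x) < r}"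
      using infdist_le[of z "S x" "a x"] by (auto simp: dist_norm norm_minus_commute)
  qed
  moreover have "(\<Union>q\<in>{q\<in>\<rat>. q < r}. A q) \<in> sets Q"
  proof -
    have "countable {q\<in>\<rat>. q < r}" by (rule countable_subset[OF _ countable_rat]) auto
    moreover have "A q \<in> sets Q" for q using hit by (auto simp: A_def hit_measurable_def)
    ultimately show ?thesis by (intro sets.countable_UN') auto
  qed
  ultimately show "{x \<in> space Q. infdist (a x) (S x) < r} \<in> sets Q" by simp
qed

text \<open>Completing the square turns the concave local utility into a distance.\<close>

lemma inner_minus_half_square:
  fixes a \<theta> :: "'a::real_inner"
  shows "a \<bullet> \<theta> - 1/2 * (norm a)\<^sup>2 = 1/2 * (norm \<theta>)\<^sup>2 - 1/2 * (dist \<theta> a)\<^sup>2"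
  unfolding dist_norm power2_norm_eq_inner
  by (simp add: inner_diff_left inner_diff_right inner_commute algebra_simps)

lemma proj_setI_norm_minimal:
  assumes a: "a \<in> S" and min: "\<And>z. z \<in> S \<Longrightarrow> dist \<theta> a \<le> dist \<theta> z"
  shows "a \<in> proj_set S \<theta>"
proof -
  have "dist \<theta> a \<le> (INF z\<in>S. dist \<theta> z)" using a min by (intro cINF_greatest) auto
  then have "dist \<theta> a = infdist \<theta> S"
    using infdist_le[OF a, of \<theta>] infdist_notempty[of S \<theta>] a by (metis empty_iff order_antisym)
  then show ?thesis using a by (simp add: proj_set_def dist_commute)
qed

context brownian
begin

lemma iterated_integral_N:
  fixes g :: "real \<Rightarrow> 'a \<Rightarrow> real"
  assumes "integrable N (case_prod g)"
  shows "integrable P (\<lambda>\<omega>. LINT s:{0..T}|lborel. g s \<omega>)"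
    and "(LINT \<omega>|P. (LINT s:{0..T}|lborel. g s \<omega>)) = (\<integral>x. case_prod g x \<partial>N)"
proof -
  have "(LINT s:{0..T}|lborel. g s \<omega>) = (\<integral>s. g s \<omega> \<partial>L)" for \<omega>
    unfolding set_lebesgue_integral_def by (rule integral_restrict_space[symmetric]) simp
  then show "integrable P (\<lambda>\<omega>. LINT s:{0..T}|lborel. g s \<omega>)"
    and "(LINT \<omega>|P. (LINT s:{0..T}|lborel. g s \<omega>)) = (\<integral>x. case_prod g x \<partial>N)"
    using N.integrable_snd[OF assms] N.integral_snd[OF assms] by simp_all
qed

text \<open>Admissibility without the constraint. The utility formula holds in this generality; the
  constraint enters only when local utilities are compared with the distance.\<close>

definition square_integrable_predictable :: "(real \<Rightarrow> 'a \<Rightarrow> real^'m) \<Rightarrow> bool" where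
  "square_integrable_predictable \<rho> \<longleftrightarrow> predictable M T W \<rho> \<and>
     (\<integral>\<^sup>+\<omega>. (\<integral>\<^sup>+s\<in>{0..T}. ennreal ((norm (\<rho> s \<omega>))\<^sup>2) \<partial>lborel) \<partial>P) < \<infinity>"

lemma square_integrable_predictable_imp_N:
  assumes "square_integrable_predictable \<rho>"
  shows "case_prod \<rho> \<in> borel_measurable N" "integrable N (\<lambda>x. (norm (case_prod \<rho> x))\<^sup>2)"
proof -
  show m: "case_prod \<rho> \<in> borel_measurable N"
    using assms by (auto simp: square_integrable_predictable_def predictable_def
        intro: measurable_predictable_imp_N)
  have m2: "(\<lambda>x. (norm (case_prod \<rho> x))\<^sup>2) \<in> borel_measurable N"
    by (intro borel_measurable_power measurable_compose[OF m borel_measurable_norm])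
  then show "integrable N (\<lambda>x. (norm (case_prod \<rho> x))\<^sup>2)"
  proof (rule integrableI_bounded)
    have "(\<integral>\<^sup>+x. ennreal ((norm (case_prod \<rho> x))\<^sup>2) \<partial>N) < \<infinity>"
      using assms nn_integral_N_iterated[OF measurable_compose[OF m2 measurable_ennreal]]
      by (simp add: square_integrable_predictable_def)
    then show "(\<integral>\<^sup>+x. ennreal (norm ((norm (case_prod \<rho> x))\<^sup>2)) \<partial>N) < \<infinity>" by simp
  qed
qed

text \<open>The mixed term is dominated by the sum of the squares of both factors, and \<theta> is
  bounded almost everywhere on a finite measure space. Integrability justifies exchanging the order
  of integration for every competitor, not only for the optimal one.\<close>

lemma integrable_local_utility:
  assumes \<rho>: "square_integrable_predictable \<rho>" and \<theta>: "case_prod \<theta> \<in> borel_measurable N"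
    and R: "AE x in N. (norm (case_prod \<theta> x))\<^sup>2 \<le> R"
  shows "integrable N (\<lambda>(s, \<omega>). \<rho> s \<omega> \<bullet> \<theta> s \<omega> - 1/2 * (norm (\<rho> s \<omega>))\<^sup>2)"
proof -
  note \<rho>N = square_integrable_predictable_imp_N[OF \<rho>]
  have \<theta>2: "integrable N (\<lambda>x. (norm (case_prod \<theta> x))\<^sup>2)"
    using R by (intro N.integrable_const_bound[of _ R] borel_measurable_power
        measurable_compose[OF \<theta> borel_measurable_norm]) auto
  have "integrable N (\<lambda>x. case_prod \<rho> x \<bullet> case_prod \<theta> x)"
  proof (rule Bochner_Integration.integrable_bound)
    show "integrable N (\<lambda>x. (norm (case_prod \<rho> x))\<^sup>2 + (norm (case_prod \<theta> x))\<^sup>2)"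
      by (rule Bochner_Integration.integrable_add[OF \<rho>N(2) \<theta>2])
    show "(\<lambda>x. case_prod \<rho> x \<bullet> case_prod \<theta> x) \<in> borel_measurable N"
      by (rule borel_measurable_inner[OF \<rho>N(1) \<theta>])
    have "\<bar>u \<bullet> v\<bar> \<le> (norm u)\<^sup>2 + (norm v)\<^sup>2" for u v :: "real^'m"
    proof -
      have "\<bar>u \<bullet> v\<bar> \<le> norm u * norm v" by (rule Cauchy_Schwarz_ineq2)
      also have "\<dots> \<le> (norm u)\<^sup>2 + (norm v)\<^sup>2"
        using sum_squares_bound[of "norm u" "norm v"] mult_nonneg_nonneg[OF norm_ge_zero norm_ge_zero, of u v]
          by linarith
      finally show ?thesis .
    qed
    then show "AE x in N. norm (case_prod \<rho> x \<bullet> case_prod \<theta> x) \<le>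
        norm ((norm (case_prod \<rho> x))\<^sup>2 + (norm (case_prod \<theta> x))\<^sup>2)" by simp
  qed
  from Bochner_Integration.integrable_diff[OF this integrable_mult_right[OF \<rho>N(2), of "1/2"]]
  show ?thesis by (simp add: case_prod_unfold)
qed

text \<open>Existence of the integral guarantees that the choice in \<open>ito_integral\<close>
  returns a genuine integral, so its mean vanishes and only the drift part contributes.\<close>

lemma expected_log_utility_eq:
  assumes \<rho>: "square_integrable_predictable \<rho>" and x: "0 < x"
    and \<theta>: "case_prod (market_price_of_risk b \<sigma>) \<in> borel_measurable N"
    and R: "AE x in N. (norm (case_prod (market_price_of_risk b \<sigma>) x))\<^sup>2 \<le> R"
  shows "expected_log_utility M T W b \<sigma> x \<rho> = ln x +
    (\<integral>(s, \<omega>). \<rho> s \<omega> \<bullet> market_price_of_risk b \<sigma> s \<omega> - 1/2 * (norm (\<rho> s \<omega>))\<^sup>2 \<partial>N)"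
proof -
  define G where "G \<omega> = (LINT s:{0..T}|lborel.
      \<rho> s \<omega> \<bullet> market_price_of_risk b \<sigma> s \<omega> - 1/2 * (norm (\<rho> s \<omega>))\<^sup>2)" for \<omega>
  have "\<exists>I. has_ito_integral M T W \<rho> I"
    using \<rho> by (intro ito_integral_exists) (auto simp: square_integrable_predictable_def)
  then have "has_ito_integral M T W \<rho> (ito_integral M T W \<rho>)"
    unfolding ito_integral_def by (rule someI_ex)
  note I = ito_integral_mean_zero[OF this]
  note G = iterated_integral_N[OF integrable_local_utility[OF \<rho> \<theta> R], folded G_def]
  have "ln (terminal_wealth M T W b \<sigma> x \<rho> \<omega>) = ln x + (ito_integral M T W \<rho> \<omega> + G \<omega>)" for \<omega>
    using x by (simp add: terminal_wealth_def G_def ln_mult)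
  then have "expected_log_utility M T W b \<sigma> x \<rho> =
      (\<integral>\<omega>. ln x + (ito_integral M T W \<rho> \<omega> + G \<omega>) \<partial>P)"
    by (simp add: expected_log_utility_def)
  also have "\<dots> = ln x + (\<integral>\<omega>. G \<omega> \<partial>P)"
    using I G(1) P.prob_space by simp
  finally show ?thesis using G(2) by simp
qed

end

theorem mainTheorem3:
  fixes M :: "'a measure"
    and T :: real
    and W :: "real \<Rightarrow> 'a \<Rightarrow> real^'m"
    and b :: "real \<Rightarrow> 'a \<Rightarrow> real^'d"
    and \<sigma> :: "real \<Rightarrow> 'a \<Rightarrow> real^'m^'d"
    and C :: "(real^'d) set"
    and K \<epsilon> x :: real
  assumes "prob_space M"
    and "0 < T"
    and "brownian_motion M T W"
    and "CARD('d) \<le> CARD('m)"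
    and "predictable M T W b" and "uniformly_bounded M T b"
    and "predictable M T W \<sigma>" and "uniformly_bounded M T \<sigma>"
    and "0 < \<epsilon>" and "\<epsilon> < K"
    and "\<forall>t\<in>{0..T}. AE \<omega> in M.
           rank (\<sigma> t \<omega>) = CARD('d) \<and>
           loewner_le (mat \<epsilon>) (\<sigma> t \<omega> ** transpose (\<sigma> t \<omega>)) \<and>
           loewner_le (\<sigma> t \<omega> ** transpose (\<sigma> t \<omega>)) (mat K)"
    and "C \<noteq> {}" and "closed C"
    and "0 < x"
  shows "value_function M T W b \<sigma> C x =
           ereal (ln x + (LINT \<omega>|completion M. - (LINT s:{0..T}|lborel. driver b \<sigma> C s \<omega>))) \<and>
         (\<exists>\<rho>\<in>admissible M T W \<sigma> C.
            ereal (expected_log_utility M T W b \<sigma> x \<rho>) = value_function M T W b \<sigma> C x \<and>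
            (\<forall>t\<in>{0..T}. AE \<omega> in M.
               \<rho> t \<omega> \<in> proj_set (constraint_set C \<sigma> t \<omega>) (market_price_of_risk b \<sigma> t \<omega>)))"
proof -
  interpret brownian M T W using assms(2,3) by unfold_locales
  let ?Q = "predictable_sigma M T W"
  define s where "s = case_prod \<sigma>"
  define \<beta> where "\<beta> = case_prod b"
  define \<theta> where "\<theta> = case_prod (market_price_of_risk b \<sigma>)"
  define S where "S = (\<lambda>p. (\<lambda>c. c v* s p) ` C)"
  \<comment> \<open>A predictable condition on the single point. The Loewner bounds imply it, but
    they hold only almost surely at each time.\<close>
  define regular where "regular p \<longleftrightarrow> det (s p ** transpose (s p)) \<noteq> 0" for p
  have S: "constraint_set C \<sigma> t \<omega> = S (t, \<omega>)" for t \<omega>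
    by (auto simp: constraint_set_def S_def s_def)
  have S_ne: "S p \<noteq> {}" for p using assms(12) by (simp add: S_def)
  obtain c0 where c0: "c0 \<in> C" using assms(12) by blast

  \<comment> \<open>Predictability of \<theta> and of the set of regular points\<close>
  have sm: "s \<in> borel_measurable ?Q" and bm': "\<beta> \<in> borel_measurable ?Q"
    using assms(5,7) by (simp_all add: predictable_def s_def \<beta>_def)
  have \<theta>_eq: "\<theta> p = (matrix_inv (s p ** transpose (s p)) *v \<beta> p) v* s p" for p
    by (simp add: \<theta>_def s_def \<beta>_def market_price_of_risk_def case_prod_unfold)
  have \<theta>m: "\<theta> \<in> borel_measurable ?Q"
    unfolding \<theta>_eq[abs_def]
    by (intro borel_measurable_vector_matrix_mult sm borel_measurable_matrix_inv_mult
        borel_measurable_gram_nth borel_measurable_vec_nth bm')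
  have regm: "{p \<in> space ?Q. regular p} \<in> sets ?Q"
  proof -
    have "(\<lambda>p. det (s p ** transpose (s p))) \<in> borel_measurable ?Q"
      by (intro borel_measurable_det borel_measurable_gram_nth sm)
    from measurable_sets[OF this, of "- {0}"] show ?thesis
      by (simp add: regular_def vimage_def Int_def conj_commute)
  qed

  \<comment> \<open>Predictable choice of a nearest point\<close>
  have shift: "(\<lambda>z. z - \<theta> p) ` S p = (\<lambda>c. c v* s p - \<theta> p) ` C" for p
    by (simp add: S_def image_image)
  have hit: "hit_measurable ?Q (\<lambda>p. (\<lambda>c. c v* s p - \<theta> p) ` C)"
  proof (rule hit_measurable_parametrized[OF assms(13)])
    show "(\<lambda>p. c v* s p - \<theta> p) \<in> borel_measurable ?Q" for c
      by (intro borel_measurable_diff borel_measurable_vector_matrix_mult sm \<theta>m borel_measurable_const)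
    show "continuous_on UNIV (\<lambda>c. c v* s p - \<theta> p)" for p
      by (intro continuous_intros linear_continuous_on linear_conv_bounded_linear[THEN iffD1]
          linear_vector_matrix_mult)
  qed
  \<comment> \<open>Closedness of the image of \<open>C\<close> is secured by injectivity, hence at
    regular points; elsewhere {0} keeps the values closed and nonempty, and \<rho> becomes \<theta>
    there. The shift by \<theta> makes a nearest point of the constraint set a point of minimal
    norm.\<close>
  define \<Phi> where "\<Phi> = (\<lambda>p. if regular p then (\<lambda>c. c v* s p - \<theta> p) ` C else {0})"
  have \<Phi>: "hit_measurable ?Q \<Phi>"
    unfolding \<Phi>_def by (rule hit_measurable_If[OF hit hit_measurable_const regm])
  have \<Phi>cl: "closed (\<Phi> p)" for p
  proof (cases "regular p")
    case True
    then have "inj (\<lambda>c. c v* s p)"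
      unfolding regular_def by (rule vector_matrix_mult_injective)
    then have "closed ((\<lambda>c. c v* s p) ` C)"
      by (intro closed_injective_linear_image[OF assms(13) linear_vector_matrix_mult])
    from closed_translation[OF this, of "- \<theta> p"] show ?thesis
      using True by (simp add: \<Phi>_def image_image)
  qed (simp add: \<Phi>_def)
  have \<Phi>ne: "\<Phi> p \<noteq> {}" for p using assms(12) by (simp add: \<Phi>_def)
  obtain f where f: "f \<in> borel_measurable ?Q" "\<And>p. p \<in> space ?Q \<Longrightarrow> f p \<in> \<Phi> p"
    "\<And>p y. p \<in> space ?Q \<Longrightarrow> y \<in> \<Phi> p \<Longrightarrow> norm (f p) \<le> norm y"
    using measurable_norm_minimizer[OF \<Phi> \<Phi>cl \<Phi>ne] by blast
  define \<rho> where "\<rho> t \<omega> = f (t, \<omega>) + \<theta> (t, \<omega>)" for t \<omega>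
  have \<rho>f: "case_prod \<rho> = (\<lambda>p. f p + \<theta> p)" by (simp add: \<rho>_def fun_eq_iff)
  have \<rho>m: "case_prod \<rho> \<in> borel_measurable ?Q"
    unfolding \<rho>f by (rule borel_measurable_add[OF f(1) \<theta>m])
  have \<rho>pred: "predictable M T W \<rho>" using \<rho>m by (simp add: predictable_def)
  have \<rho>proj: "case_prod \<rho> p \<in> proj_set (S p) (\<theta> p)" if "p \<in> space ?Q" "regular p" for p
  proof (rule proj_setI_norm_minimal)
    have eq: "\<Phi> p = (\<lambda>z. z - \<theta> p) ` S p" using that(2) by (simp add: \<Phi>_def shift)
    then show "case_prod \<rho> p \<in> S p" using f(2)[OF that(1)] by (auto simp: \<rho>f)
    show "dist (\<theta> p) (case_prod \<rho> p) \<le> dist (\<theta> p) z" if "z \<in> S p" for z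
      using f(3)[OF \<open>p \<in> space ?Q\<close>, of "z - \<theta> p"] eq that
      by (auto simp: \<rho>f dist_norm norm_minus_commute)
  qed

  \<comment> \<open>Bounds holding almost everywhere\<close>
  obtain B where B: "\<And>t \<omega>. t \<in> {0..T} \<Longrightarrow> \<omega> \<in> space M \<Longrightarrow> norm (b t \<omega>) \<le> B"
    using assms(6) unfolding uniformly_bounded_def by blast
  \<comment> \<open>\<open>B\<^sup>2 / \<epsilon>\<close> bounds |\<theta>|^2, and
    \<open>K * (norm c0)\<^sup>2\<close> bounds the squared norm of the constraint point given by
    \<open>c0\<close>, against which the selection will be compared.\<close>
  define R where "R = max (B\<^sup>2 / \<epsilon>) (K * (norm c0)\<^sup>2)"
  define good where "good p \<longleftrightarrow> regular p \<and> (norm (\<theta> p))\<^sup>2 \<le> R \<and> (norm (c0 v* s p))\<^sup>2 \<le> R" for p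
  have good_AE: "AE \<omega> in M. good (t, \<omega>)" if t: "t \<in> {0..T}" for t
    using assms(11)[rule_format, OF t] AE_space
  proof eventually_elim
    case (elim \<omega>)
    have "(norm (b t \<omega>))\<^sup>2 \<le> B\<^sup>2" using B[OF t elim(2)] by (intro power_mono) auto
    then have "(norm (b t \<omega>))\<^sup>2 / \<epsilon> \<le> R"
      using assms(9) divide_right_mono[of "(norm (b t \<omega>))\<^sup>2" "B\<^sup>2" \<epsilon>] by (simp add: R_def)
    moreover have "(norm (\<theta> (t, \<omega>)))\<^sup>2 \<le> (norm (b t \<omega>))\<^sup>2 / \<epsilon>"
      using norm_market_price_of_risk_le[OF assms(9), of "\<sigma> t \<omega>" "b t \<omega>"] elim
      by (simp add: \<theta>_def market_price_of_risk_def)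
    moreover have "regular (t, \<omega>)"
      using gram_det_nonzero[OF assms(9), of "\<sigma> t \<omega>"] elim by (simp add: regular_def s_def)
    moreover have "(norm (c0 v* s (t, \<omega>)))\<^sup>2 \<le> R"
      using loewner_le_gram_mat[of "\<sigma> t \<omega>" K c0] elim by (simp add: R_def s_def)
    ultimately show ?case by (simp add: good_def)
  qed
  \<comment> \<open>Passing from an almost sure statement at each t to the product measure requires
    a measurable exceptional set; \<open>good\<close> is built from predictable functions for this
    purpose.\<close>
  have good_N: "AE p in N. good p"
  proof (rule N.AE_pair_measure)
    have "{p \<in> space ?Q. good p} =
        {p \<in> space ?Q. regular p} \<inter> {p \<in> space ?Q. (norm (\<theta> p))\<^sup>2 \<le> R} \<inter>
        {p \<in> space ?Q. (norm (c0 v* s p))\<^sup>2 \<le> R}"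
      by (auto simp: good_def)
    also have "\<dots> \<in> sets ?Q"
    proof (intro sets.Int regm borel_measurable_le borel_measurable_const borel_measurable_power)
      show "(\<lambda>p. norm (\<theta> p)) \<in> borel_measurable ?Q"
        by (rule measurable_compose[OF \<theta>m borel_measurable_norm])
      show "(\<lambda>p. norm (c0 v* s p)) \<in> borel_measurable ?Q"
        by (rule measurable_compose[OF borel_measurable_vector_matrix_mult[OF sm borel_measurable_const]
              borel_measurable_norm])
    qed
    finally show "{p \<in> space N. good p} \<in> sets N"
      using sets_predictable_space_subset by (auto simp: space_N space_predictable_space)
    show "AE t in L. AE \<omega> in P. good (t, \<omega>)"
      by (rule AE_I2) (simp add: space_restrict_space good_AE AE_completion)
  qed
  have space_AE: "AE p in N. p \<in> space ?Q"
    using AE_space[of N] by (simp add: space_N space_predictable_space)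

  have \<theta>N: "case_prod (market_price_of_risk b \<sigma>) \<in> borel_measurable N"
    using measurable_predictable_imp_N[OF \<theta>m] by (simp add: \<theta>_def)
  have \<theta>R: "AE p in N. (norm (case_prod (market_price_of_risk b \<sigma>) p))\<^sup>2 \<le> R"
    using good_N by eventually_elim (simp add: good_def \<theta>_def)
  define u where "u \<rho> = (\<lambda>(s, \<omega>). \<rho> s \<omega> \<bullet> market_price_of_risk b \<sigma> s \<omega> - 1/2 * (norm (\<rho> s \<omega>))\<^sup>2)" for \<rho>
  have u_eq: "u \<rho> p = 1/2 * (norm (\<theta> p))\<^sup>2 - 1/2 * (dist (\<theta> p) (case_prod \<rho> p))\<^sup>2" for \<rho> p
    by (cases p) (simp only: u_def \<theta>_def prod.case inner_minus_half_square)
  have d_eq: "case_prod (driver b \<sigma> C) p = 1/2 * (infdist (\<theta> p) (S p))\<^sup>2 - 1/2 * (norm (\<theta> p))\<^sup>2" for p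
    by (cases p) (simp add: driver_def \<theta>_def S)

  \<comment> \<open>Admissibility of the selected strategy\<close>
  have \<rho>sq: "square_integrable_predictable \<rho>"
    unfolding square_integrable_predictable_def
  proof (intro conjI \<rho>pred)
    have \<rho>N: "case_prod \<rho> \<in> borel_measurable N" by (rule measurable_predictable_imp_N[OF \<rho>m])
    have meas: "(\<lambda>p. ennreal ((norm (case_prod \<rho> p))\<^sup>2)) \<in> borel_measurable N"
      by (intro measurable_compose[OF _ measurable_ennreal] borel_measurable_power
          measurable_compose[OF \<rho>N borel_measurable_norm])
    \<comment> \<open>The selected point is no farther from \<theta> than the constraint point given
      by \<open>c0\<close>, so |\<rho>| \<le> |c0 \<sigma>| + 2 |\<theta>| \<le> 3 sqrt R, whence
      the 9.\<close>
    have bound: "AE p in N. (norm (case_prod \<rho> p))\<^sup>2 \<le> 9 * R"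
      using good_N space_AE
    proof eventually_elim
      case (elim p)
      have "norm (f p) \<le> norm (c0 v* s p - \<theta> p)"
        using elim c0 by (intro f(3)) (auto simp: \<Phi>_def good_def)
      then have "norm (case_prod \<rho> p) \<le> norm (c0 v* s p) + 2 * norm (\<theta> p)"
        unfolding \<rho>f using norm_triangle_ineq[of "f p" "\<theta> p"] norm_triangle_ineq4[of "c0 v* s p" "\<theta> p"]
        by linarith
      moreover have "norm (c0 v* s p) \<le> sqrt R" "norm (\<theta> p) \<le> sqrt R"
        using elim by (auto simp: good_def intro: real_le_rsqrt)
      ultimately have "norm (case_prod \<rho> p) \<le> 3 * sqrt R" by linarith
      then have "(norm (case_prod \<rho> p))\<^sup>2 \<le> (3 * sqrt R)\<^sup>2" by (intro power_mono) auto
      moreover have "0 \<le> R" using elim by (auto simp: good_def intro: order_trans[OF zero_le_power2])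
      ultimately show ?case by (simp add: power_mult_distrib)
    qed
    have "(\<integral>\<^sup>+p. ennreal ((norm (case_prod \<rho> p))\<^sup>2) \<partial>N) \<le> (\<integral>\<^sup>+p. ennreal (9 * R) \<partial>N)"
      using bound by (intro nn_integral_mono_AE) (auto elim!: eventually_mono intro: ennreal_leI)
    also have "\<dots> < \<infinity>"
      using N.emeasure_finite[of "space N", unfolded infinity_ennreal_def top.not_eq_extremum]
      by (simp add: ennreal_mult_less_top)
    finally show "(\<integral>\<^sup>+\<omega>. (\<integral>\<^sup>+s\<in>{0..T}. ennreal ((norm (\<rho> s \<omega>))\<^sup>2) \<partial>lborel) \<partial>P) < \<infinity>"
      using nn_integral_N_iterated[OF meas] by simp
  qed
  have \<rho>adm: "\<rho> \<in> admissible M T W \<sigma> C"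
    unfolding admissible_def
  proof (intro CollectI conjI)
    show "AE (t, \<omega>) in N. \<rho> t \<omega> \<in> constraint_set C \<sigma> t \<omega>"
      using good_N space_AE
    proof eventually_elim
      case (elim p)
      then have "case_prod \<rho> p \<in> S p" using \<rho>proj[of p] by (simp add: good_def proj_set_def)
      then show ?case by (cases p) (simp add: S)
    qed
  qed (use \<rho>sq in \<open>simp_all add: square_integrable_predictable_def\<close>)

  \<comment> \<open>Comparison of expected utilities\<close>
  have u_int: "integrable N (u \<rho>')" if "square_integrable_predictable \<rho>'" for \<rho>'
    unfolding u_def by (rule integrable_local_utility[OF that \<theta>N \<theta>R])
  have dm: "case_prod (driver b \<sigma> C) \<in> borel_measurable N"
  proof (rule measurable_predictable_imp_N)
    have "(\<lambda>p. infdist (\<theta> p) (S p)) \<in> borel_measurable ?Q"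
      by (rule borel_measurable_infdist_hit[OF _ S_ne]) (simp add: shift hit)
    then show "case_prod (driver b \<sigma> C) \<in> borel_measurable ?Q"
      unfolding d_eq[abs_def]
      by (intro borel_measurable_diff borel_measurable_times borel_measurable_const
          borel_measurable_power measurable_compose[OF \<theta>m borel_measurable_norm])
  qed
  have opt: "AE p in N. u \<rho> p = - case_prod (driver b \<sigma> C) p"
    using good_N space_AE
  proof eventually_elim
    case (elim p)
    then have "dist (\<theta> p) (case_prod \<rho> p) = infdist (\<theta> p) (S p)"
      using \<rho>proj[of p] by (simp add: good_def proj_set_def)
    then show ?case by (simp add: u_eq d_eq)
  qed
  \<comment> \<open>Integrability of the driver is not estimated directly: its negative agrees
    almost everywhere with the integrable local utility of \<rho>, and \<open>dm\<close> supplies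
    the measurability that the transfer needs.\<close>
  have d_int: "integrable N (\<lambda>p. - case_prod (driver b \<sigma> C) p)"
    using u_int[OF \<rho>sq] opt dm by (subst integrable_cong_AE[where g="u \<rho>"]) auto
  have d_val: "(LINT \<omega>|P. - (LINT s:{0..T}|lborel. driver b \<sigma> C s \<omega>)) =
      (\<integral>p. - case_prod (driver b \<sigma> C) p \<partial>N)"
    using iterated_integral_N[of "driver b \<sigma> C"] d_int by simp

  have elu: "expected_log_utility M T W b \<sigma> x \<rho>' = ln x + (\<integral>p. u \<rho>' p \<partial>N)"
    if "square_integrable_predictable \<rho>'" for \<rho>'
    using expected_log_utility_eq[OF that assms(14) \<theta>N \<theta>R] by (simp add: u_def)
  have upper: "expected_log_utility M T W b \<sigma> x \<rho>' \<le>
      ln x + (\<integral>p. - case_prod (driver b \<sigma> C) p \<partial>N)" if "\<rho>' \<in> admissible M T W \<sigma> C" for \<rho>'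
  proof -
    have sq: "square_integrable_predictable \<rho>'"
      and con: "AE (t, \<omega>) in N. \<rho>' t \<omega> \<in> constraint_set C \<sigma> t \<omega>"
      using that by (auto simp: admissible_def square_integrable_predictable_def)
    have "AE p in N. u \<rho>' p \<le> - case_prod (driver b \<sigma> C) p"
      using con
    proof eventually_elim
      case (elim p)
      then have "case_prod \<rho>' p \<in> S p" by (cases p) (simp add: S)
      then have "infdist (\<theta> p) (S p) \<le> dist (\<theta> p) (case_prod \<rho>' p)" by (rule infdist_le)
      then have "(infdist (\<theta> p) (S p))\<^sup>2 \<le> (dist (\<theta> p) (case_prod \<rho>' p))\<^sup>2"
        by (intro power_mono infdist_nonneg)
      then show ?case unfolding u_eq d_eq by simp
    qed
    from integral_mono_AE[OF u_int[OF sq] d_int this] show ?thesis unfolding elu[OF sq] by simp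
  qed
  have attained: "expected_log_utility M T W b \<sigma> x \<rho> =
      ln x + (\<integral>p. - case_prod (driver b \<sigma> C) p \<partial>N)"
    unfolding elu[OF \<rho>sq]
    using integral_cong_AE[OF borel_measurable_integrable[OF u_int[OF \<rho>sq]]
        borel_measurable_integrable[OF d_int] opt] by simp
  have V: "value_function M T W b \<sigma> C x = ereal (ln x + (\<integral>p. - case_prod (driver b \<sigma> C) p \<partial>N))"
    unfolding value_function_def
  proof (rule antisym)
    show "(SUP \<rho>\<in>admissible M T W \<sigma> C. ereal (expected_log_utility M T W b \<sigma> x \<rho>)) \<le>
        ereal (ln x + (\<integral>p. - case_prod (driver b \<sigma> C) p \<partial>N))"
      using upper by (intro SUP_least) simp
    show "ereal (ln x + (\<integral>p. - case_prod (driver b \<sigma> C) p \<partial>N)) \<le>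
        (SUP \<rho>\<in>admissible M T W \<sigma> C. ereal (expected_log_utility M T W b \<sigma> x \<rho>))"
      unfolding attained[symmetric] by (rule SUP_upper[OF \<rho>adm])
  qed
  \<comment> \<open>The pointwise projection property is combined with \<open>good_AE\<close> at the
    given t; an almost everywhere statement for \<open>N\<close> could miss a null set of
    times.\<close>
  have "AE \<omega> in M. \<rho> t \<omega> \<in> proj_set (constraint_set C \<sigma> t \<omega>) (market_price_of_risk b \<sigma> t \<omega>)"
    if t: "t \<in> {0..T}" for t
    using good_AE[OF t] AE_space
  proof eventually_elim
    case (elim \<omega>)
    then show ?case
      using \<rho>proj[of "(t, \<omega>)"] t by (simp add: good_def space_predictable_space S \<theta>_def)
  qed
  then show ?thesis
    using V d_val attained \<rho>adm by (intro conjI bexI[of _ \<rho>]) auto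
qed

end
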